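(* Let $u_0=u(\cdot;a_0,E_0,c_0)$ be a non-constant periodic traveling wave profile of $u_t=u_{xxx}+f(u)_x$ as described in the context. Assume that the Jacobian $\{T,M,P\}_{a,E,c}=\det\frac{\partial(T,M,P)}{\partial(a,E,c)}$ is non-zero at $(a_0,E_0,c_0)$, and that the matrix $\frac{\partial(\dot u)}{\partial(a,E,s)}\big|_{(a,E,s)=(a_0,E_0,0)}$ is nonsingular, where $\dot u=\dot u(a,E,s)\in\mathcal P$ denotes the class modulo translation of the wave $u(\cdot;a,E,c_0-s)$. Then a necessary condition for the spectral stability of $u_0$ is that all eigenvalues of the $3\times 3$ matrix $$A(a,E,s)=\left(\frac{\partial(a-sM\omega,\,-sP\omega-2E,\,-s\omega)}{\partial(a,E,s)}\right)^{-1}\left(\frac{\partial(M\omega,P\omega,\omega)}{\partial(a,E,s)}\right)$$ be real at $(a,E,s)=(a_0,E_0,0)$; equivalently, that the Whitham system $$\partial_t(M\omega,P\omega,\omega)(a,E,s)-\partial_x(a-sM\omega,\,-sP\omega-2E,\,-s\omega)(a,E,s)=0$$ be hyperbolic at $(a_0,E_0,0)$.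
   Context: **Profiles.** Let $f:\mathbb R\to\mathbb R$ be a (sufficiently smooth) nonlinearity, $F'=f$, $F(0)=0$, and $V(u;a,c)=F(u)-au-\frac c2u^2$. Traveling waves $u(x+ct)$ of $u_t=u_{xxx}+f(u)_x$ have profiles satisfying $u_{xxx}+f(u)_x-cu_x=0$, which integrates to $\frac{u_x^2}{2}=E-V(u;a,c)$ with constants $a,E$. Parameters $(a,E,c)$ are considered in an open set of $\mathbb R^3$ (containing $(a_0,E_0,c_0)$) on which there are simple roots $u_-<u_+$ of $E=V(\cdot;a,c)$ with $V(u;a,c)<E$ for $u\in(u_-,u_+)$; $u(\cdot;a,E,c)$ denotes the corresponding non-constant periodic profile, normalized by $u(0)=u_-$. **Period, mass, momentum.** The following are $C^1$ functions of $(a,E,c)$: $T(a,E,c)=\sqrt2\int_{u_-}^{u_+}\frac{du}{\sqrt{E-V(u;a,c)}}$ (the period of $u(\cdot;a,E,c)$), $M(a,E,c)=\int_0^T u(x)\,dx$, $P(a,E,c)=\int_0^T u(x)^2\,dx$. Put $\omega=1/T$. **Variables $(a,E,s)$.** With $c_0$ fixed, in expressions involving $(a,E,s)$ the functions $T,M,P,\omega$ are evaluated at $(a,E,c)=(a,E,c_0-s)$, and $\frac{\partial(g_1,g_2,g_3)}{\partial(a,E,s)}$ denotes the $3\times3$ Jacobian matrix. **The space $\mathcal P$.** $\mathcal T$ is the set of periodic traveling wave profiles (all translates of the $u(\cdot;a,E,c)$) and $\mathcal P=\mathcal T/\mathcal R$ is its quotient by translations ($u\,\mathcal R\,v$ iff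 $v=u(\cdot-\xi)$ for some $\xi\in\mathbb R$); $\mathcal P$ is locally a three-dimensional manifold. Nonsingularity of $\frac{\partial(\dot u)}{\partial(a,E,s)}$ at $(a_0,E_0,0)$ means that the differential at $(a_0,E_0,0)$ of the map $(a,E,s)\mapsto\dot u(a,E,s)\in\mathcal P$ is invertible, so that waves in $\mathcal P$ near $\dot u_0$ are coordinatized by $(a,E,s)$. **Spectral stability.** Let $\mathcal L[u_0]=-\partial_x^2-f'(u_0)+c_0$. The wave $u_0$ is spectrally stable if the $L^2(\mathbb R)$ spectrum of $\partial_x\mathcal L[u_0]$ is contained in the imaginary axis. **Hyperbolicity.** The Whitham system (for unknowns $(a,E,s)$ depending on $(x,t)$) is called hyperbolic at $(a_0,E_0,0)$ if the characteristic equation of its linearization about the constant state $(a_0,E_0,0)$, $$\det\left(\mu\frac{\partial(M\omega,P\omega,\omega)}{\partial(a,E,s)}-\frac{i\kappa}{T}\frac{\partial(a-sM\omega,\,-sP\omega-2E,\,-s\omega)}{\partial(a,E,s)}\right)(a_0,E_0,0)=0,$$ has three real roots (counted with multiplicity) in the variable $\frac{i\kappa}{\mu T}$. *)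

theory Defs
  imports "HOL-Analysis.Analysis"
begin

definition C_k_real :: "nat \<Rightarrow> (real \<Rightarrow> real) \<Rightarrow> bool" where
  "C_k_real k g \<longleftrightarrow>
     (\<forall>j<k. (deriv ^^ j) g differentiable_on UNIV) \<and> continuous_on UNIV ((deriv ^^ k) g)"

definition C1_on :: "(real^3) set \<Rightarrow> (real^3 \<Rightarrow> real^3) \<Rightarrow> bool" where
  "C1_on U g \<longleftrightarrow> g differentiable_on U \<and> continuous_on U (\<lambda>p. jacobian g (at p))"


text \<open>A point \<open>p\<close> of the parameter space is the triple \<open>(a, E, c)\<close>, that is
  \<open>p $ 1 = a\<close>, \<open>p $ 2 = E\<close>, \<open>p $ 3 = c\<close>.\<close>

definition potential :: "(real \<Rightarrow> real) \<Rightarrow> real^3 \<Rightarrow> real \<Rightarrow> real" where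
  "potential F p v = F v - p $ 1 * v - p $ 3 / 2 * v\<^sup>2"

text \<open>The third-order equation and its first integral both have constant solutions; for a
  non-constant solution of both, the constant in the once-integrated equation is \<open>a\<close>, so the
  value \<open>u 0\<close> at a simple root of \<open>E - V\<close> determines \<open>u\<close> uniquely.\<close>

definition periodic_profile :: "(real \<Rightarrow> real) \<Rightarrow> (real \<Rightarrow> real) \<Rightarrow> real^3 \<Rightarrow> (real \<Rightarrow> real) \<Rightarrow> bool" where
  "periodic_profile f F p u \<longleftrightarrow>
     C_k_real 3 u \<and>
     (\<forall>x. (deriv ^^ 3) u x + deriv (\<lambda>y. f (u y)) x - p $ 3 * deriv u x = 0) \<and>
     (\<forall>x. (deriv u x)\<^sup>2 / 2 = p $ 2 - potential F p (u x)) \<and>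
     (\<exists>L>0. \<forall>x. u (x + L) = u x) \<and>
     \<not> u constant_on UNIV"

text \<open>Continuity of \<open>um\<close> and \<open>up\<close> says that the same potential well is followed over \<open>U\<close>.\<close>

definition wave_family ::
  "(real \<Rightarrow> real) \<Rightarrow> (real \<Rightarrow> real) \<Rightarrow> (real^3) set \<Rightarrow>
   (real^3 \<Rightarrow> real) \<Rightarrow> (real^3 \<Rightarrow> real) \<Rightarrow> (real^3 \<Rightarrow> real \<Rightarrow> real) \<Rightarrow> bool" where
  "wave_family f F U um up u \<longleftrightarrow>
     open U \<and> continuous_on U um \<and> continuous_on U up \<and>
     (\<forall>p\<in>U. um p < up p \<and>
        potential F p (um p) = p $ 2 \<and> deriv (potential F p) (um p) \<noteq> 0 \<and>
        potential F p (up p) = p $ 2 \<and> deriv (potential F p) (up p) \<noteq> 0 \<and>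
        (\<forall>v\<in>{um p<..<up p}. potential F p v < p $ 2) \<and>
        periodic_profile f F p (u p) \<and> u p 0 = um p)"

definition period :: "(real \<Rightarrow> real) \<Rightarrow> (real^3 \<Rightarrow> real) \<Rightarrow> (real^3 \<Rightarrow> real) \<Rightarrow> real^3 \<Rightarrow> real" where
  "period F um up p =
     sqrt 2 * integral {um p..up p} (\<lambda>v. 1 / sqrt (p $ 2 - potential F p v))"

definition mass :: "(real^3 \<Rightarrow> real) \<Rightarrow> (real^3 \<Rightarrow> real \<Rightarrow> real) \<Rightarrow> real^3 \<Rightarrow> real" where
  "mass T u p = integral {0..T p} (u p)"

definition momentum :: "(real^3 \<Rightarrow> real) \<Rightarrow> (real^3 \<Rightarrow> real \<Rightarrow> real) \<Rightarrow> real^3 \<Rightarrow> real" where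
  "momentum T u p = integral {0..T p} (\<lambda>x. (u p x)\<^sup>2)"


text \<open>The change of variables from \<open>(a, E, s)\<close> to \<open>(a, E, c) = (a, E, c0 - s)\<close>.\<close>

definition aEs :: "real \<Rightarrow> real^3 \<Rightarrow> real^3" where
  "aEs c0 q = vector [q $ 1, q $ 2, c0 - q $ 3]"

text \<open>Densities and fluxes of the Whitham system as functions of \<open>q = (a, E, s)\<close>;
  \<open>T\<close>, \<open>M\<close>, \<open>P\<close> are functions of \<open>(a, E, c)\<close>, and \<open>\<omega> = 1 / T\<close>.\<close>

definition whitham_density ::
  "real \<Rightarrow> (real^3 \<Rightarrow> real) \<Rightarrow> (real^3 \<Rightarrow> real) \<Rightarrow> (real^3 \<Rightarrow> real) \<Rightarrow> real^3 \<Rightarrow> real^3" where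
  "whitham_density c0 T M P q =
     (let p = aEs c0 q; \<omega> = 1 / T p in vector [M p * \<omega>, P p * \<omega>, \<omega>])"

definition whitham_flux ::
  "real \<Rightarrow> (real^3 \<Rightarrow> real) \<Rightarrow> (real^3 \<Rightarrow> real) \<Rightarrow> (real^3 \<Rightarrow> real) \<Rightarrow> real^3 \<Rightarrow> real^3" where
  "whitham_flux c0 T M P q =
     (let p = aEs c0 q; \<omega> = 1 / T p; a = q $ 1; E = q $ 2; s = q $ 3
      in vector [a - s * M p * \<omega>, - s * P p * \<omega> - 2 * E, - s * \<omega>])"

definition whitham_matrix ::
  "real \<Rightarrow> (real^3 \<Rightarrow> real) \<Rightarrow> (real^3 \<Rightarrow> real) \<Rightarrow> (real^3 \<Rightarrow> real) \<Rightarrow> real^3 \<Rightarrow> real^3^3" where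
  "whitham_matrix c0 T M P q =
     matrix_inv (jacobian (whitham_flux c0 T M P) (at q)) **
       jacobian (whitham_density c0 T M P) (at q)"

definition complex_eigenvalue :: "real^'n^'n \<Rightarrow> complex \<Rightarrow> bool" where
  "complex_eigenvalue A z \<longleftrightarrow>
     (\<exists>v::complex^'n. v \<noteq> 0 \<and> map_matrix complex_of_real A *v v = z *s v)"

definition whitham_char ::
  "real \<Rightarrow> (real^3 \<Rightarrow> real) \<Rightarrow> (real^3 \<Rightarrow> real) \<Rightarrow> (real^3 \<Rightarrow> real) \<Rightarrow> real^3 \<Rightarrow>
   complex \<Rightarrow> complex \<Rightarrow> complex" where
  "whitham_char c0 T M P q \<mu> \<kappa> =
     det (map_matrix (\<lambda>x. \<mu> * of_real x) (jacobian (whitham_density c0 T M P) (at q)) -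
          map_matrix (\<lambda>x. \<i> * \<kappa> / of_real (T (aEs c0 q)) * of_real x)
            (jacobian (whitham_flux c0 T M P) (at q)))"

text \<open>The characteristic determinant is homogeneous of degree 3 in \<open>(\<mu>, \<kappa>)\<close>. Divided by
  \<open>\<mu> ^ 3\<close> it is a polynomial in \<open>\<i> * \<kappa> / (\<mu> * T)\<close>, which is required to be
  a cubic with real roots \<open>r1\<close>, \<open>r2\<close>, \<open>r3\<close>, repeated according to multiplicity.\<close>

definition whitham_hyperbolic ::
  "real \<Rightarrow> (real^3 \<Rightarrow> real) \<Rightarrow> (real^3 \<Rightarrow> real) \<Rightarrow> (real^3 \<Rightarrow> real) \<Rightarrow> real^3 \<Rightarrow> bool" where
  "whitham_hyperbolic c0 T M P q \<longleftrightarrow>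
     (\<exists>(k::complex) (r1::real) (r2::real) (r3::real). k \<noteq> 0 \<and>
        (\<forall>\<mu> \<kappa>. \<mu> \<noteq> 0 \<longrightarrow>
           (let z = \<i> * \<kappa> / (\<mu> * of_real (T (aEs c0 q)))
            in whitham_char c0 T M P q \<mu> \<kappa> =
                 \<mu> ^ 3 * (k * (z - of_real r1) * (z - of_real r2) * (z - of_real r3)))))"


definition waves :: "(real^3) set \<Rightarrow> (real^3 \<Rightarrow> real \<Rightarrow> real) \<Rightarrow> (real \<Rightarrow> real) set" where
  "waves U u = {\<lambda>x. u p (x - \<xi>) | p \<xi>. p \<in> U}"

definition translation_rel ::
  "(real \<Rightarrow> real) set \<Rightarrow> ((real \<Rightarrow> real) \<times> (real \<Rightarrow> real)) set" where
  "translation_rel W = {(v, w). v \<in> W \<and> w \<in> W \<and> (\<exists>\<xi>. w = (\<lambda>x. v (x - \<xi>)))}"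

definition waves_mod_translation ::
  "(real^3) set \<Rightarrow> (real^3 \<Rightarrow> real \<Rightarrow> real) \<Rightarrow> (real \<Rightarrow> real) set set" where
  "waves_mod_translation U u = waves U u // translation_rel (waves U u)"

definition wave_class ::
  "(real^3) set \<Rightarrow> (real^3 \<Rightarrow> real \<Rightarrow> real) \<Rightarrow> real \<Rightarrow> real^3 \<Rightarrow> (real \<Rightarrow> real) set" where
  "wave_class U u c0 q = translation_rel (waves U u) `` {u (aEs c0 q)}"

text \<open>Nonsingularity at \<open>q0\<close> of a map \<open>\<Phi>\<close> into a quotient \<open>Q\<close> of a set of functions by
  translations. The map is represented near \<open>q0\<close> by a differentiable choice \<open>w q \<in> \<Phi> q\<close>.
  The tangent space of the quotient at the class of \<open>w q0\<close> consists of the velocities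
  modulo the derivative of \<open>w q0\<close>, which spans the tangent space of its translation orbit, so the
  differential of \<open>\<Phi>\<close> at \<open>q0\<close> is \<open>D\<close> followed by this projection. For a three-dimensional
  quotient, the differential is invertible iff its kernel is trivial.\<close>

definition nonsingular_mod_translation ::
  "(real \<Rightarrow> real) set set \<Rightarrow> (real^3 \<Rightarrow> (real \<Rightarrow> real) set) \<Rightarrow> real^3 \<Rightarrow> bool" where
  "nonsingular_mod_translation Q \<Phi> q0 \<longleftrightarrow>
     (\<exists>(w :: real^3 \<Rightarrow> real \<Rightarrow> real) (D :: real^3 \<Rightarrow> real \<Rightarrow> real).
        (\<forall>\<^sub>F q in nhds q0. \<Phi> q \<in> Q \<and> w q \<in> \<Phi> q) \<and>
        (\<forall>x. ((\<lambda>q. w q x) has_derivative (\<lambda>h. D h x)) (at q0)) \<and>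
        (\<forall>h \<delta>. (\<forall>x. D h x = \<delta> * deriv (w q0) x) \<longrightarrow> h = 0))"


text \<open>Elements of \<open>L\<^sup>2(\<real>; \<complex>)\<close> are represented by functions; equality in \<open>L\<^sup>2\<close> is equality almost
  everywhere. Operators are represented by their graphs.\<close>

definition L2 :: "(real \<Rightarrow> complex) set" where
  "L2 = {v. v \<in> borel_measurable lborel \<and> integrable lborel (\<lambda>x. (norm (v x))\<^sup>2)}"

definition L2_norm :: "(real \<Rightarrow> complex) \<Rightarrow> real" where
  "L2_norm v = sqrt (LINT x|lborel. (norm (v x))\<^sup>2)"

definition test_function :: "(real \<Rightarrow> real) \<Rightarrow> bool" where
  "test_function \<phi> \<longleftrightarrow> (\<forall>k. C_k_real k \<phi>) \<and> compact (closure {x. \<phi> x \<noteq> 0})"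

definition has_L2_weak_deriv :: "(real \<Rightarrow> complex) \<Rightarrow> (real \<Rightarrow> complex) \<Rightarrow> bool" where
  "has_L2_weak_deriv v w \<longleftrightarrow> v \<in> L2 \<and> w \<in> L2 \<and>
     (\<forall>\<phi>. test_function \<phi> \<longrightarrow>
        (LINT x|lborel. deriv \<phi> x *\<^sub>R v x) = - (LINT x|lborel. \<phi> x *\<^sub>R w x))"

text \<open>The graph of \<open>\<partial>\<^sub>x \<L>[u]\<close> with \<open>\<L>[u] = - \<partial>\<^sub>x\<^sup>2 - f'(u) + c\<close>. For \<open>f\<close> of class \<open>C\<^sup>2\<close> and a periodic
  profile \<open>u\<close>, its domain is the Sobolev space \<open>H\<^sup>3(\<real>)\<close>.\<close>

definition linearization ::
  "(real \<Rightarrow> real) \<Rightarrow> real \<Rightarrow> (real \<Rightarrow> real) \<Rightarrow> ((real \<Rightarrow> complex) \<times> (real \<Rightarrow> complex)) set" where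
  "linearization f c u =
     {(v, g). \<exists>v1 v2. has_L2_weak_deriv v v1 \<and> has_L2_weak_deriv v1 v2 \<and>
        has_L2_weak_deriv
          (\<lambda>x. - v2 x - of_real (deriv f (u x)) * v x + of_real c * v x) g}"

text \<open>The resolvent set consists of the \<open>z\<close> for which the operator minus \<open>z\<close> is onto \<open>L\<^sup>2\<close> and
  bounded below, i.e. injective with bounded inverse.\<close>

definition L2_spectrum :: "((real \<Rightarrow> complex) \<times> (real \<Rightarrow> complex)) set \<Rightarrow> complex set" where
  "L2_spectrum A = {z. \<not>
     ((\<forall>h\<in>L2. \<exists>(v, g)\<in>A. AE x in lborel. g x - z * v x = h x) \<and>
      (\<exists>K. \<forall>(v, g)\<in>A. L2_norm v \<le> K * L2_norm (\<lambda>x. g x - z * v x)))}"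

definition spectrally_stable :: "(real \<Rightarrow> real) \<Rightarrow> real \<Rightarrow> (real \<Rightarrow> real) \<Rightarrow> bool" where
  "spectrally_stable f c u \<longleftrightarrow> L2_spectrum (linearization f c u) \<subseteq> {z. Re z = 0}"

end

theory Submission
  imports Defs "HOL-Complex_Analysis.Great_Picard"
    "HOL-Computational_Algebra.Fundamental_Theorem_Algebra"
begin

text \<open>Let \<open>L = - \<partial>\<^sup>2 - f'(u) + c\<close>. Differentiating the profile equation in the parameters gives
  \<open>L u\<^sub>a = -1\<close>, \<open>L u\<^sub>E = 0\<close>, \<open>L u\<^sub>c = - u\<close>, besides \<open>L u\<^sub>x = 0\<close>, and differentiating
  \<open>u (x + T) = u x\<close> expresses the jumps of these functions over a period by the gradients of \<open>T\<close>, \<open>M\<close>, \<open>P\<close>.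
  For small \<open>\<lambda>\<close> the equation \<open>\<partial> L v = \<lambda> v\<close> has three independent solutions \<open>u\<^sub>x - \<lambda> u\<^sub>c + \<dots>\<close>, \<open>u\<^sub>E + \<dots>\<close>,
  \<open>u\<^sub>a + \<dots>\<close>, given by Neumann series in \<open>\<lambda>\<close>; here the quantities \<open>L v\<close> and \<open>u L v + u\<^sub>x v\<^sub>x - u\<^sub>x\<^sub>x v\<close> jump
  by \<open>\<lambda> \<integral>v\<close> and \<open>\<lambda> \<integral>u v\<close>. Hence the determinant whose vanishing gives a solution with Floquet
  multiplier \<open>exp \<epsilon>\<close>, \<open>\<epsilon> = \<i> \<theta>\<close>, becomes, with \<open>\<lambda> = \<epsilon> t\<close> and after division by \<open>\<epsilon>\<^sup>3\<close>, a holomorphic function of \<open>t\<close>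
  that converges locally uniformly, as \<open>\<theta> \<rightarrow> 0\<close>, to a multiple of the Whitham characteristic polynomial in
  \<open>z = - 1 / (t T)\<close>. If the latter has a non-real root, Hurwitz's theorem yields zeros with \<open>Re \<lambda> \<noteq> 0\<close>, that is,
  bounded solutions of the eigenvalue equation; cutting them off produces approximate eigenfunctions in \<open>L\<^sup>2\<close>,
  so \<open>\<lambda>\<close> is an unstable point of the spectrum.\<close>

section \<open>Periodic profiles\<close>

text \<open>Differentiability of the profiles in the parameters is not part of the notion of a wave
  family, which provides only continuous turning points. The derivatives are therefore constructed
  as limits of difference quotients, one direction and one sequence of step sizes at a time; the
  gradients of T, M, P then enter through quotients taken at the moving endpoint T.

  The component \<open>q = L v\<close> is kept beside v and v', so that the third-order equation
  becomes a first-order system in which \<open>f'(u)\<close> is never differentiated. The quantity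
  \<open>u L v + u\<^sub>x v\<^sub>x - u\<^sub>x\<^sub>x v\<close> replaces v as a coordinate at the
  ends of the period: its derivative is \<lambda> u v, which is how the momentum appears, and where
  \<open>u\<^sub>x = 0\<close> it determines v together with q, because
  \<open>u\<^sub>x\<^sub>x\<close> is non-zero at a simple root.

  Hurwitz's theorem needs a limit that is not constant. The point t = 0 corresponds to z at
  infinity, and there the limit of the determinant is \<open>- u\<^sub>x\<^sub>x(0)\<close>, which
  is not zero.\<close>

lemma gronwall_second_order:
  fixes r s :: "real \<Rightarrow> real"
  assumes dr: "\<And>x. 0 \<le> x \<Longrightarrow> x \<le> B \<Longrightarrow> (r has_real_derivative s x) (at x)"
    and ds: "\<And>x. 0 \<le> x \<Longrightarrow> x \<le> B \<Longrightarrow> (s has_real_derivative \<beta> x + k x * r x) (at x)"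
    and k: "\<And>x. 0 \<le> x \<Longrightarrow> x \<le> B \<Longrightarrow> \<bar>k x\<bar> \<le> K"
    and \<beta>: "\<And>x. 0 \<le> x \<Longrightarrow> x \<le> B \<Longrightarrow> \<bar>\<beta> x\<bar> \<le> \<eta>"
    and x: "0 \<le> x" "x \<le> B"
  shows "(r x)\<^sup>2 + (s x)\<^sup>2 \<le> ((r 0)\<^sup>2 + (s 0)\<^sup>2 + \<eta>\<^sup>2) * exp ((2 + K) * x)"
proof -
  \<comment> \<open>The term \<eta>^2 in the weighted energy absorbs the forcing: the cross terms
    cost \<open>1 + K\<close> and the estimate \<open>2 s \<beta> \<le> s^2 + \<eta>^2\<close> costs
    one more, which gives the rate \<open>2 + K\<close>.\<close>
  define g where "g y = ((r y)\<^sup>2 + (s y)\<^sup>2 + \<eta>\<^sup>2) * exp (- (2 + K) * y)" for y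
  have "g x \<le> g 0"
  proof (rule DERIV_nonpos_imp_nonincreasing[OF x(1)])
    fix y assume y: "0 \<le> y" "y \<le> x"
    then have yB: "y \<le> B" using x by simp
    define e' where "e' = 2 * r y * s y + 2 * s y * (\<beta> y + k y * r y)
        - (2 + K) * ((r y)\<^sup>2 + (s y)\<^sup>2 + \<eta>\<^sup>2)"
    have d: "(g has_real_derivative e' * exp (- (2 + K) * y)) (at y)"
      unfolding g_def e'_def
      by (rule derivative_eq_intros dr ds y yB refl | simp add: algebra_simps)+
    have K: "0 \<le> K" "\<bar>k y\<bar> \<le> K" using k[OF y(1) yB] by auto
    have "2 * r y * s y + 2 * s y * (k y * r y) = (1 + k y) * (2 * r y * s y)"
      by (simp add: algebra_simps)
    also have "\<dots> \<le> \<bar>1 + k y\<bar> * \<bar>2 * r y * s y\<bar>"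
      by (metis abs_ge_self abs_mult)
    also have "\<dots> \<le> (1 + K) * ((r y)\<^sup>2 + (s y)\<^sup>2)"
    proof (rule mult_mono)
      have "\<bar>2 * r y * s y\<bar> = 2 * \<bar>r y\<bar> * \<bar>s y\<bar>" by (simp add: abs_mult)
      also have "\<dots> \<le> (r y)\<^sup>2 + (s y)\<^sup>2"
        using sum_squares_bound[of "\<bar>r y\<bar>" "\<bar>s y\<bar>"] by simp
      finally show "\<bar>2 * r y * s y\<bar> \<le> (r y)\<^sup>2 + (s y)\<^sup>2" .
    qed (use K in auto)
    finally have 1: "2 * r y * s y + 2 * s y * (k y * r y) \<le> (1 + K) * ((r y)\<^sup>2 + (s y)\<^sup>2)" .
    have 2: "2 * s y * \<beta> y \<le> (s y)\<^sup>2 + \<eta>\<^sup>2"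
    proof -
      have "(\<beta> y)\<^sup>2 \<le> \<eta>\<^sup>2" using \<beta>[OF y(1) yB] by (simp add: abs_le_square_iff[symmetric])
      then show ?thesis using sum_squares_bound[of "s y" "\<beta> y"] by simp
    qed
    have "0 \<le> (r y)\<^sup>2 + (1 + K) * \<eta>\<^sup>2" using K by simp
    then have "e' \<le> 0" using 1 2 unfolding e'_def by (simp add: algebra_simps)
    then show "\<exists>z. (g has_real_derivative z) (at y) \<and> z \<le> 0"
      using d by (meson exp_ge_zero mult_nonpos_nonneg)
  qed
  then have "((r x)\<^sup>2 + (s x)\<^sup>2 + \<eta>\<^sup>2) * exp (- (2 + K) * x) * exp ((2 + K) * x)
      \<le> ((r 0)\<^sup>2 + (s 0)\<^sup>2 + \<eta>\<^sup>2) * exp ((2 + K) * x)"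
    unfolding g_def by (intro mult_right_mono) auto
  then have "(r x)\<^sup>2 + (s x)\<^sup>2 + \<eta>\<^sup>2 \<le> ((r 0)\<^sup>2 + (s 0)\<^sup>2 + \<eta>\<^sup>2) * exp ((2 + K) * x)"
    by (simp add: mult.assoc mult_exp_exp algebra_simps)
  then show ?thesis by (smt (verit) zero_le_power2)
qed

lemma C1_lipschitz_on_interval:
  fixes f :: "real \<Rightarrow> real"
  assumes d: "\<And>x. (f has_real_derivative f' x) (at x)" and c: "continuous_on UNIV f'"
  obtains K where "0 \<le> K" "\<And>x y. x \<in> {lo..hi} \<Longrightarrow> y \<in> {lo..hi} \<Longrightarrow> \<bar>f x - f y\<bar> \<le> K * \<bar>x - y\<bar>"
proof -
  have "compact (f' ` {lo..hi})"
    by (intro compact_continuous_image continuous_on_subset[OF c]) auto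
  then obtain K where K: "\<And>x. x \<in> {lo..hi} \<Longrightarrow> \<bar>f' x\<bar> \<le> K"
    by (metis bounded_real compact_imp_bounded imageI)
  have "\<bar>f x - f y\<bar> \<le> max 0 K * \<bar>x - y\<bar>" if "x \<in> {lo..hi}" "y \<in> {lo..hi}" for x y
    using field_differentiable_bound[of "{lo..hi}" f f' "max 0 K" x y] K that
    by (force intro: has_field_derivative_at_within[OF d] simp: le_max_iff_disj)
  then show ?thesis using that[of "max 0 K"] by auto
qed

section \<open>The orbit in the potential well\<close>

locale profile_well =
  fixes f F :: "real \<Rightarrow> real" and p :: "real^3" and m n :: real and v :: "real \<Rightarrow> real"
  assumes f_C1: "\<And>x. (f has_real_derivative deriv f x) (at x)" "continuous_on UNIV (deriv f)"
    and F_deriv: "\<And>x. (F has_real_derivative f x) (at x)"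
    and mn: "m < n"
    and root_m: "potential F p m = p $ 2" "deriv (potential F p) m \<noteq> 0"
    and root_n: "potential F p n = p $ 2" "deriv (potential F p) n \<noteq> 0"
    and well: "\<And>x. x \<in> {m<..<n} \<Longrightarrow> potential F p x < p $ 2"
    and profile: "periodic_profile f F p v"
    and v_0: "v 0 = m"
begin

definition force :: "real \<Rightarrow> real" where "force x = p $ 1 - f x + p $ 3 * x"

lemma potential_deriv: "(potential F p has_real_derivative - force x) (at x)"
  unfolding potential_def force_def
  by (rule derivative_eq_intros F_deriv refl | simp add: algebra_simps)+

lemma energy: "(deriv v x)\<^sup>2 / 2 = p $ 2 - potential F p (v x)"
  using profile unfolding periodic_profile_def by auto

lemma v_deriv: "(v has_real_derivative deriv v x) (at x)"
  and v_deriv2: "(deriv v has_real_derivative deriv (deriv v) x) (at x)"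
  and v_deriv3: "(deriv (deriv v) has_real_derivative (deriv ^^ 3) v x) (at x)"
proof -
  have "(deriv ^^ j) v differentiable_on UNIV" if "j < 3" for j
    using profile that unfolding periodic_profile_def C_k_real_def by auto
  from this[of 0] this[of 1] this[of 2] show "(v has_real_derivative deriv v x) (at x)"
    "(deriv v has_real_derivative deriv (deriv v) x) (at x)"
    "(deriv (deriv v) has_real_derivative (deriv ^^ 3) v x) (at x)"
    by (simp_all add: differentiable_on_def DERIV_deriv_iff_real_differentiable eval_nat_numeral)
qed

lemma deriv_v_eq_force: "deriv v x * deriv (deriv v) x = force (v x) * deriv v x"
proof -
  have "((\<lambda>x. (deriv v x)\<^sup>2 / 2) has_real_derivative deriv v x * deriv (deriv v) x) (at x)"
    by (rule derivative_eq_intros v_deriv2 refl | simp)+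
  moreover have "((\<lambda>x. p $ 2 - potential F p (v x)) has_real_derivative force (v x) * deriv v x) (at x)"
    by (rule derivative_eq_intros DERIV_chain2[OF potential_deriv v_deriv] refl | simp)+
  ultimately show ?thesis
    using energy by (simp add: DERIV_unique)
qed

text \<open>The differentiated energy identity gives the equation of motion only where
  \<open>deriv v\<close> is non-zero. The third-order equation makes \<open>H\<close> constant in x,
  and as v is not constant, one point with \<open>deriv v y \<noteq> 0\<close> fixes this constant
  as \<open>p $ 1\<close> everywhere, turning points included.\<close>

lemma v_second: "(deriv v has_real_derivative force (v x)) (at x)"
proof -
  define H where "H x = deriv (deriv v) x + f (v x) - p $ 3 * v x" for x
  have fv: "((\<lambda>y. f (v y)) has_real_derivative deriv (\<lambda>y. f (v y)) x) (at x)" for x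
    by (metis DERIV_chain2 DERIV_imp_deriv f_C1(1) v_deriv)
  have "(H has_real_derivative 0) (at x)" for x
  proof -
    have "(H has_real_derivative (deriv ^^ 3) v x + deriv (\<lambda>y. f (v y)) x - p $ 3 * deriv v x) (at x)"
      unfolding H_def by (rule derivative_eq_intros v_deriv3 v_deriv fv refl | simp)+
    then show ?thesis using profile unfolding periodic_profile_def by simp
  qed
  then have const: "H x = H y" for x y
    using DERIV_isconst_all by blast
  have "\<exists>y. deriv v y \<noteq> 0"
  proof (rule ccontr)
    assume "\<not> ?thesis"
    then have "\<And>x. (v has_real_derivative 0) (at x)" using v_deriv by metis
    then have "v x = v 0" for x using DERIV_isconst_all by blast
    then have "v constant_on UNIV" unfolding constant_on_def by blast
    then show False using profile unfolding periodic_profile_def by simp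
  qed
  then obtain y where "deriv v y \<noteq> 0" by blast
  then have "deriv (deriv v) y = force (v y)" using deriv_v_eq_force[of y] by simp
  then have "H y = p $ 1" unfolding H_def force_def by simp
  then have "deriv (deriv v) x = force (v x)" using const[of x y] unfolding H_def force_def by simp
  then show ?thesis using v_deriv2 by metis
qed

lemmas v_chain = DERIV_chain2[OF v_deriv, THEN DERIV_cong]
lemmas deriv_v_chain = DERIV_chain2[OF v_second, THEN DERIV_cong]

lemma v_cont: "continuous_on S v"
  by (meson DERIV_continuous_on has_field_derivative_at_within v_deriv)

lemma deriv_v_cont: "continuous_on S (deriv v)"
  by (meson DERIV_continuous_on has_field_derivative_at_within v_second)

text \<open>At a simple root the force is non-zero, and with the wrong sign the potential would rise
  above the energy just inside the well.\<close>

lemma force_m_pos: "0 < force m"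
proof (rule ccontr)
  assume "\<not> ?thesis"
  moreover have "force m \<noteq> 0" using root_m(2) DERIV_imp_deriv[OF potential_deriv] by simp
  ultimately have "0 < - force m" by simp
  then obtain d where d: "d > 0" "\<And>h. 0 < h \<Longrightarrow> h < d \<Longrightarrow> potential F p m < potential F p (m + h)"
    using DERIV_pos_inc_right[OF potential_deriv, of m] by auto
  define h where "h = min (d / 2) ((n - m) / 2)"
  have "0 < h" "h < d" "m + h < n" using d(1) mn by (auto simp: h_def min_def field_simps)
  then show False using d(2)[of h] well[of "m + h"] root_m by auto
qed

lemma force_n_neg: "force n < 0"
proof (rule ccontr)
  assume "\<not> ?thesis"
  moreover have "force n \<noteq> 0" using root_n(2) DERIV_imp_deriv[OF potential_deriv] by simp
  ultimately have "- force n < 0" by simp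
  then obtain d where d: "d > 0" "\<And>h. 0 < h \<Longrightarrow> h < d \<Longrightarrow> potential F p n < potential F p (n - h)"
    using DERIV_neg_dec_left[OF potential_deriv, of n] by auto
  define h where "h = min (d / 2) ((n - m) / 2)"
  have "0 < h" "h < d" "m < n - h" using d(1) mn by (auto simp: h_def min_def field_simps)
  then show False using d(2)[of h] well[of "n - h"] root_n by auto
qed

lemma deriv_v_0: "deriv v x = 0" if "v x = m \<or> v x = n"
  using energy[of x] root_m(1) root_n(1) that by auto

lemma attained_between:
  assumes "y \<in> closed_segment (v x) (v z)"
  shows "\<exists>t. v t = y"
proof -
  have "connected (range v)" by (intro connected_continuous_image v_cont) simp
  then have "convex (range v)" by (simp add: connected_convex_1)
  then have "closed_segment (v x) (v z) \<subseteq> range v" by (simp add: closed_segment_subset)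
  then show ?thesis using assms by auto
qed

lemma potential_le: "potential F p (v x) \<le> p $ 2"
  using energy[of x] zero_le_power2[of "deriv v x"] by linarith

text \<open>Just outside the well the potential exceeds the energy. An orbit that starts at m and
  gets below it would take such a value, by the intermediate value theorem.\<close>

lemma v_ge: "m \<le> v x"
proof (rule ccontr)
  assume lt: "\<not> m \<le> v x"
  obtain d where d: "d > 0" "\<And>h. 0 < h \<Longrightarrow> h < d \<Longrightarrow> potential F p m < potential F p (m - h)"
    using DERIV_neg_dec_left[OF potential_deriv, of m] force_m_pos by auto
  define h where "h = min (d / 2) (m - v x)"
  have h: "0 < h" "h < d" "v x \<le> m - h" using d(1) lt by (auto simp: h_def min_def field_simps)
  then obtain t where "v t = m - h"
    using attained_between[of "m - h" x 0] v_0 by (auto simp: closed_segment_eq_real_ivl)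
  then show False using d(2)[OF h(1,2)] potential_le[of t] root_m by auto
qed

lemma half_period:
  obtains h where "0 < h" "\<And>x. 0 < x \<Longrightarrow> x < h \<Longrightarrow> 0 < deriv v x" "v h = n"
proof -
  obtain d where d: "d > 0" "\<And>h. 0 < h \<Longrightarrow> h < d \<Longrightarrow> 0 < deriv v h"
    using DERIV_pos_inc_right[OF v_second, of 0] force_m_pos v_0 deriv_v_0[of 0] by auto
  obtain L where L: "L > 0" "\<And>x. v (x + L) = v x" using profile unfolding periodic_profile_def by auto
  have "deriv v L = 0" using L(2)[of 0] v_0 deriv_v_0[of L] by simp
  then have Ld: "L \<ge> d" using d(2)[of L] L(1) by force
  \<comment> \<open>The least zero of \<open>deriv v\<close> after 0 is the half period. Starting at
    \<open>d/2\<close> excludes the zero at 0 itself; L belongs to Z because v is back at m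
    there.\<close>
  define Z where "Z = {d/2..L} \<inter> {x. deriv v x = 0}"
  have "closed {x. deriv v x = 0}"
    by (intro closed_Collect_eq deriv_v_cont continuous_intros)
  then have "compact Z" unfolding Z_def by blast
  moreover have "L \<in> Z" using \<open>deriv v L = 0\<close> Ld L(1) d(1) by (auto simp: Z_def)
  ultimately obtain h where h: "h \<in> Z" "\<And>x. x \<in> Z \<Longrightarrow> h \<le> x"
    using compact_attains_inf[of Z] by auto
  have h0: "0 < h" "deriv v h = 0" "h \<le> L" using h(1) d(1) by (auto simp: Z_def)
  have pos: "0 < deriv v x" if x: "0 < x" "x < h" for x
  proof (cases "x < d")
    case False
    show ?thesis
    proof (rule ccontr)
      assume "\<not> 0 < deriv v x"
      then have "deriv v x \<le> 0" "0 \<le> deriv v (d/2)" "d/2 \<le> x"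
        using d(1) d(2)[of "d/2"] False by auto
      then obtain y where "d/2 \<le> y" "y \<le> x" "deriv v y = 0"
        using IVT2'[OF _ _ _ deriv_v_cont] by metis
      then have "y \<in> Z" using x h0 by (auto simp: Z_def)
      then show False using h(2)[of y] \<open>y \<le> x\<close> x by simp
    qed
  qed (use d(2) x in auto)
  \<comment> \<open>At h the potential equals the energy, and \<open>v h > m\<close>, so
    \<open>v h\<close> is at least n. Overshooting would mean crossing n, where
    \<open>deriv v\<close> vanishes, before h.\<close>
  have "v 0 < v h"
    by (rule DERIV_pos_imp_increasing_open[OF h0(1)]) (use pos v_deriv v_cont in blast)+
  moreover have "potential F p (v h) = p $ 2" using energy[of h] h0 by simp
  ultimately have ge: "n \<le> v h" using well[of "v h"] v_0 by force
  have "v h = n"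
  proof (rule ccontr)
    assume "v h \<noteq> n"
    then have "v 0 \<le> n" "n < v h" using ge v_0 mn by auto
    then obtain y where y: "0 \<le> y" "y \<le> h" "v y = n"
      using IVT'[of v 0 n h] v_cont h0 by auto
    then have "y \<noteq> 0" "y \<noteq> h" using v_0 mn \<open>v h \<noteq> n\<close> by auto
    then show False using pos[of y] y deriv_v_0[of y] by auto
  qed
  then show ?thesis using that h0(1) pos by blast
qed

lemma v_le: "v x \<le> n"
proof (rule ccontr)
  assume lt: "\<not> v x \<le> n"
  obtain d where d: "d > 0" "\<And>h. 0 < h \<Longrightarrow> h < d \<Longrightarrow> potential F p n < potential F p (n + h)"
    using DERIV_pos_inc_right[OF potential_deriv, of n] force_n_neg by auto
  define h where "h = min (d / 2) (v x - n)"
  have h: "0 < h" "h < d" "n + h \<le> v x" using d(1) lt by (auto simp: h_def min_def field_simps)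
  then obtain t where "v t = n + h"
    using attained_between[of "n + h" 0 x] v_0 mn by (auto simp: closed_segment_eq_real_ivl)
  then show False using d(2)[OF h(1,2)] potential_le[of t] root_n by auto
qed

lemma ode_unique:
  assumes d: "\<And>x. (v1 has_real_derivative v1' x) (at x)" "\<And>x. (v1' has_real_derivative force (v1 x)) (at x)"
    "\<And>x. (v2 has_real_derivative v2' x) (at x)" "\<And>x. (v2' has_real_derivative force (v2 x)) (at x)"
    and b: "\<And>x. v1 x \<in> {m..n}" "\<And>x. v2 x \<in> {m..n}"
    and init: "v1 0 = v2 0" "v1' 0 = v2' 0" and x: "0 \<le> x"
  shows "v1 x = v2 x"
proof -
  obtain K where K: "0 \<le> K" "\<And>x y. x \<in> {m..n} \<Longrightarrow> y \<in> {m..n} \<Longrightarrow> \<bar>f x - f y\<bar> \<le> K * \<bar>x - y\<bar>"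
    using C1_lipschitz_on_interval[OF f_C1] by blast
  \<comment> \<open>The difference of the two solutions satisfies a linear equation whose
    coefficient is this divided difference of the force. Where the solutions agree, division by zero
    gives 0, which still satisfies the equation.\<close>
  define k where "k y = (force (v1 y) - force (v2 y)) / (v1 y - v2 y)" for y
  have "(v1 x - v2 x)\<^sup>2 + (v1' x - v2' x)\<^sup>2
      \<le> ((v1 0 - v2 0)\<^sup>2 + (v1' 0 - v2' 0)\<^sup>2 + 0\<^sup>2) * exp ((2 + (K + \<bar>p $ 3\<bar>)) * x)"
  proof (rule gronwall_second_order[where B = x and \<beta> = "\<lambda>_. 0" and k = k])
    fix y
    show "((\<lambda>y. v1 y - v2 y) has_real_derivative v1' y - v2' y) (at y)"
      by (intro derivative_intros d)
    have "((\<lambda>y. v1' y - v2' y) has_real_derivative force (v1 y) - force (v2 y)) (at y)"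
      by (intro derivative_intros d)
    then show "((\<lambda>y. v1' y - v2' y) has_real_derivative 0 + k y * (v1 y - v2 y)) (at y)"
      by (cases "v1 y = v2 y") (auto simp: k_def)
    have "\<bar>force (v1 y) - force (v2 y)\<bar> = \<bar>p $ 3 * (v1 y - v2 y) - (f (v1 y) - f (v2 y))\<bar>"
      by (simp add: force_def algebra_simps)
    also have "\<dots> \<le> \<bar>p $ 3\<bar> * \<bar>v1 y - v2 y\<bar> + \<bar>f (v1 y) - f (v2 y)\<bar>"
      by (metis abs_mult abs_triangle_ineq4)
    also have "\<dots> \<le> (K + \<bar>p $ 3\<bar>) * \<bar>v1 y - v2 y\<bar>"
      using K(2)[OF b] by (simp add: algebra_simps)
    finally show "\<bar>k y\<bar> \<le> K + \<bar>p $ 3\<bar>"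
      using K(1) by (cases "v1 y = v2 y") (auto simp: k_def abs_divide divide_le_eq)
  qed (use x in auto)
  then have "(v1 x - v2 x)\<^sup>2 + (v1' x - v2' x)\<^sup>2 \<le> 0" using init by simp
  then show ?thesis by (simp add: sum_power2_le_zero_iff)
qed

lemma v_in: "v x \<in> {m..n}"
  using v_ge v_le by auto

text \<open>On the rising half, v has an inverse \<open>X\<close> with derivative
  \<open>1 / sqrt (2 * (E - V))\<close>, so \<open>sqrt 2 * X\<close> is a primitive of the
  integrand. The integrand is unbounded near both turning points, so the fundamental theorem is used
  in the form that asks for the derivative in the interior only.\<close>

lemma period_eq:
  assumes h: "0 < h" "\<And>x. 0 < x \<Longrightarrow> x < h \<Longrightarrow> 0 < deriv v x" "v h = n"
  shows "sqrt 2 * integral {m..n} (\<lambda>x. 1 / sqrt (p $ 2 - potential F p x)) = 2 * h"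
proof -
  have mono: "v x < v y" if "0 \<le> x" "x < y" "y \<le> h" for x y
    by (rule DERIV_pos_imp_increasing_open[OF that(2)])
       (use that h(2) v_deriv v_cont in \<open>force+\<close>)
  have inj: "inj_on v {0..h}"
    by (rule linorder_inj_onI) (use mono in force)+
  have img: "v ` {0..h} = {m..n}"
  proof
    show "v ` {0..h} \<subseteq> {m..n}" using v_in by auto
    show "{m..n} \<subseteq> v ` {0..h}"
      using IVT'[of v 0 _ h] v_0 h v_cont by (force simp: image_iff)
  qed
  define X where "X = inv_into {0..h} v"
  have vX: "v (X y) = y" "X y \<in> {0..h}" if "y \<in> {m..n}" for y
    using that img unfolding X_def by (metis f_inv_into_f, metis inv_into_into)
  have Xv: "X (v x) = x" if "x \<in> {0..h}" for x
    using that inj unfolding X_def by simp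
  have contX: "continuous_on {m..n} X"
    unfolding img[symmetric] using Xv by (intro continuous_on_inv v_cont) auto
  have "((\<lambda>y. 1 / sqrt (p $ 2 - potential F p y)) has_integral sqrt 2 * X n - sqrt 2 * X m) {m..n}"
  proof (rule fundamental_theorem_of_calculus_interior)
    show "continuous_on {m..n} (\<lambda>y. sqrt 2 * X y)" by (intro continuous_intros contX)
    fix y assume y: "y \<in> {m<..<n}"
    then have y': "y \<in> {m..n}" by auto
    have "X y \<noteq> 0" "X y \<noteq> h" using vX(1)[OF y'] v_0 h(3) y by auto
    then have Xy: "0 < X y" "X y < h" using vX(2)[OF y'] by auto
    then have pos: "0 < deriv v (X y)" using h(2) by blast
    have "isCont X y" using continuous_on_interior[OF contX, of y] y
      by (simp add: interior_atLeastAtMost_real)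
    then have "(X has_real_derivative inverse (deriv v (X y))) (at y)"
      using pos y vX(1) by (intro DERIV_inverse_function[OF v_deriv, where a = m and b = n]) auto
    then have D: "((\<lambda>y. sqrt 2 * X y) has_real_derivative sqrt 2 * inverse (deriv v (X y))) (at y)"
      by (rule DERIV_cmult)
    have "(deriv v (X y))\<^sup>2 = 2 * (p $ 2 - potential F p y)" using energy[of "X y"] vX(1)[OF y'] by simp
    then have "deriv v (X y) = sqrt 2 * sqrt (p $ 2 - potential F p y)"
      using pos by (metis real_sqrt_mult real_sqrt_unique less_imp_le)
    then have "sqrt 2 * inverse (deriv v (X y)) = 1 / sqrt (p $ 2 - potential F p y)"
      by (simp add: field_simps)
    then show "((\<lambda>y. sqrt 2 * X y) has_vector_derivative 1 / sqrt (p $ 2 - potential F p y)) (at y)"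
      using D by (simp add: has_real_derivative_iff_has_vector_derivative)
  qed (use mn in auto)
  moreover have "X n = h" "X m = 0" using Xv[of h] Xv[of 0] h v_0 by auto
  ultimately show ?thesis by (simp add: integral_unique)
qed

definition per :: real where
  "per = sqrt 2 * integral {m..n} (\<lambda>x. 1 / sqrt (p $ 2 - potential F p x))"

lemma per_pos: "0 < per"
  using half_period period_eq unfolding per_def by (metis mult_pos_pos zero_less_numeral)

text \<open>The equation is reversible, so v is symmetric about its turning point h. Hence v is back
  at m with zero velocity at \<open>2 * h\<close>, and uniqueness repeats the orbit.\<close>

lemma v_per: "v (x + per) = v x"
proof -
  obtain h where h: "0 < h" "\<And>x. 0 < x \<Longrightarrow> x < h \<Longrightarrow> 0 < deriv v x" "v h = n" by (rule half_period) blast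
  have per: "per = 2 * h" using period_eq[OF h] unfolding per_def .
  have refl: "v (h + x) = v (h - x)" if "0 \<le> x" for x
  proof (rule ode_unique[where ?v1' = "\<lambda>x. deriv v (h + x)" and ?v2' = "\<lambda>x. - deriv v (h - x)", OF _ _ _ _ _ _ _ _ that])
    fix x
    show "((\<lambda>x. v (h + x)) has_real_derivative deriv v (h + x)) (at x)"
      "((\<lambda>x. deriv v (h + x)) has_real_derivative force (v (h + x))) (at x)"
      "((\<lambda>x. v (h - x)) has_real_derivative - deriv v (h - x)) (at x)"
      "((\<lambda>x. - deriv v (h - x)) has_real_derivative force (v (h - x))) (at x)"
      by (rule v_chain deriv_v_chain derivative_eq_intros refl | simp)+
  qed (use v_in h deriv_v_0[of h] in auto)
  have 2: "v (2 * h) = m" using refl[of h] h v_0 by simp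
  have pos: "v (per + x) = v x" if "0 \<le> x" for x
  proof (rule ode_unique[where ?v1' = "\<lambda>x. deriv v (per + x)" and ?v2' = "deriv v", OF _ _ _ _ _ _ _ _ that])
    fix x
    show "((\<lambda>x. v (per + x)) has_real_derivative deriv v (per + x)) (at x)"
      "((\<lambda>x. deriv v (per + x)) has_real_derivative force (v (per + x))) (at x)"
      by (rule v_chain deriv_v_chain derivative_eq_intros refl | simp)+
  qed (use v_in v_deriv v_second per 2 v_0 deriv_v_0[of "2 * h"] deriv_v_0[of 0] in auto)
  \<comment> \<open>Uniqueness is available for non-negative arguments only; multiples of the
    unspecified period \<open>L\<close> of the profile move any x there.\<close>
  obtain L where L: "L > 0" "\<And>x. v (x + L) = v x" using profile unfolding periodic_profile_def by auto
  have Ln: "v (x + real i * L) = v x" for i x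
  proof (induction i)
    case (Suc i)
    then show ?case using L(2)[of "x + real i * L"] by (simp add: algebra_simps)
  qed simp
  obtain i where "- x / L < real i" using reals_Archimedean2 by blast
  then have i: "0 \<le> x + real i * L" using L(1) by (simp add: field_simps)
  have "v (x + per) = v (per + (x + real i * L))" using Ln[of "x + per" i] by (simp add: algebra_simps)
  then show ?thesis using pos[OF i] Ln by simp
qed

lemma deriv_v_per: "deriv v per = 0"
  using v_per[of 0] v_0 by (intro deriv_v_0) simp

end

section \<open>Dependence of the profile on the parameters\<close>

lemma has_vector_derivative_uniform_limit:
  fixes h :: "nat \<Rightarrow> real \<Rightarrow> 'a::banach"
  assumes S: "convex S" "x \<in> S"
    and d: "\<And>n x. x \<in> S \<Longrightarrow> (h n has_vector_derivative h' n x) (at x within S)"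
    and ul: "uniform_limit S h' g' sequentially"
    and lim: "\<And>x. x \<in> S \<Longrightarrow> (\<lambda>n. h n x) \<longlonglongrightarrow> g x"
  shows "(g has_vector_derivative g' x) (at x within S)"
proof -
  have "\<exists>G. \<forall>x\<in>S. (\<lambda>n. h n x) \<longlonglongrightarrow> G x \<and> (G has_derivative (\<lambda>t. t *\<^sub>R g' x)) (at x within S)"
  proof (rule has_derivative_sequence[where S = S and f = h and f' = "\<lambda>n x t. t *\<^sub>R h' n x"])
    show "convex S" "x \<in> S" "(\<lambda>n. h n x) \<longlonglongrightarrow> g x" by (use S lim in blast)+
    show "(h n has_derivative (\<lambda>t. t *\<^sub>R h' n x)) (at x within S)" if "x \<in> S" for n x
      using d[OF that] by (simp add: has_vector_derivative_def)
    fix e :: real assume "e > 0"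
    then have "\<forall>\<^sub>F n in sequentially. \<forall>x\<in>S. dist (h' n x) (g' x) < e"
      using ul by (simp add: uniform_limit_iff)
    then show "\<forall>\<^sub>F n in sequentially. \<forall>x\<in>S. \<forall>t. norm (t *\<^sub>R h' n x - t *\<^sub>R g' x) \<le> e * norm t"
    proof (rule eventually_mono, intro ballI allI)
      fix n x t assume a: "\<forall>x\<in>S. dist (h' n x) (g' x) < e" "x \<in> S"
      then have "\<bar>t\<bar> * norm (h' n x - g' x) \<le> \<bar>t\<bar> * e"
        by (intro mult_left_mono) (auto simp: dist_norm less_imp_le)
      then show "norm (t *\<^sub>R h' n x - t *\<^sub>R g' x) \<le> e * norm t"
        by (simp flip: scaleR_right_diff_distrib add: mult.commute)
    qed
  qed
  then obtain G where G: "\<And>x. x \<in> S \<Longrightarrow> (\<lambda>n. h n x) \<longlonglongrightarrow> G x"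
    "\<And>x. x \<in> S \<Longrightarrow> (G has_derivative (\<lambda>t. t *\<^sub>R g' x)) (at x within S)" by blast
  have "g x = G x" if "x \<in> S" for x
    using LIMSEQ_unique[OF lim[OF that] G(1)[OF that]] .
  then show ?thesis
    unfolding has_vector_derivative_def using G(2)[OF S(2)] S(2) by (metis has_derivative_transform)
qed

text \<open>The period varies with the parameter, so the quotients have to be evaluated at points
  that move along with the sequence.\<close>

lemma uniform_limit_tendsto_moving:
  fixes h :: "nat \<Rightarrow> 'a::metric_space \<Rightarrow> 'b::metric_space"
  assumes ul: "uniform_limit S h g sequentially" and c: "continuous_on S g"
    and X: "X \<longlonglongrightarrow> x" "\<forall>\<^sub>F n in sequentially. X n \<in> S" "x \<in> S"
  shows "(\<lambda>n. h n (X n)) \<longlonglongrightarrow> g x"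
proof (rule tendstoI)
  fix e :: real assume "e > 0"
  have "(\<lambda>n. g (X n)) \<longlonglongrightarrow> g x"
    using continuous_on_tendsto_compose[OF c X(1,3,2)] .
  then have "\<forall>\<^sub>F n in sequentially. dist (g (X n)) (g x) < e / 2"
    using \<open>e > 0\<close> by (intro tendstoD) auto
  moreover have "\<forall>\<^sub>F n in sequentially. \<forall>x\<in>S. dist (h n x) (g x) < e / 2"
    using ul \<open>e > 0\<close> by (intro uniform_limitD) auto
  ultimately show "\<forall>\<^sub>F n in sequentially. dist (h n (X n)) (g x) < e"
    using X(2)
  proof eventually_elim
    case (elim n)
    then show ?case using dist_triangle_half_r[of "g (X n)" "h n (X n)" e "g x"] by (simp add: dist_commute)
  qed
qed

lemma uniform_limit_antiderivative:
  fixes h :: "nat \<Rightarrow> real \<Rightarrow> real"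
  assumes ul: "uniform_limit {0..B} h g sequentially" and c: "\<And>n. continuous_on {0..B} (h n)" "continuous_on {0..B} g"
  shows "uniform_limit {0..B} (\<lambda>n x. integral {0..x} (h n)) (\<lambda>x. integral {0..x} g) sequentially"
proof (rule uniform_limitI)
  fix e :: real assume e: "e > 0"
  define e' where "e' = e / (1 + \<bar>B\<bar>)"
  have "e' > 0" using e by (simp add: e'_def)
  then have "\<forall>\<^sub>F n in sequentially. \<forall>x\<in>{0..B}. dist (h n x) (g x) < e'"
    using ul by (simp add: uniform_limit_iff)
  then show "\<forall>\<^sub>F n in sequentially. \<forall>x\<in>{0..B}. dist (integral {0..x} (h n)) (integral {0..x} g) < e"
  proof (rule eventually_mono, intro ballI)
    fix n x assume a: "\<forall>x\<in>{0..B}. dist (h n x) (g x) < e'" and x: "x \<in> {0..B}"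
    have i: "h n integrable_on {0..x}" "g integrable_on {0..x}"
      using x by (auto intro!: integrable_continuous_interval continuous_on_subset[OF c(1)] continuous_on_subset[OF c(2)])
    then have "integral {0..x} (h n) - integral {0..x} g = integral {0..x} (\<lambda>t. h n t - g t)"
      by (simp add: integral_diff)
    also have "norm \<dots> \<le> integral {0..x} (\<lambda>_. e')"
      by (rule integral_norm_bound_integral) (use i a x in \<open>auto intro: integrable_diff simp: dist_norm less_imp_le\<close>)
    also have "\<dots> = x * e'" using x by simp
    also have "\<dots> \<le> \<bar>B\<bar> * e'" using x \<open>e' > 0\<close> by (intro mult_right_mono) auto
    also have "\<dots> < (1 + \<bar>B\<bar>) * e'" using \<open>e' > 0\<close> by simp
    also have "\<dots> = e" by (simp add: e'_def)
    finally show "dist (integral {0..x} (h n)) (integral {0..x} g) < e" by (simp add: dist_norm)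
  qed
qed

text \<open>Caratheodory's slope function is used because \<open>X n\<close> may equal
  \<open>x\<close>, so that dividing by \<open>X n - x\<close> is not possible.\<close>

lemma difference_quotient_moving:
  fixes g :: "real \<Rightarrow> real"
  assumes "(g has_real_derivative D) (at x)" "X \<longlonglongrightarrow> x" "(\<lambda>n. (X n - x) / e n) \<longlonglongrightarrow> d"
  shows "(\<lambda>n. (g (X n) - g x) / e n) \<longlonglongrightarrow> D * d"
proof -
  obtain s where s: "\<And>z. g z - g x = s z * (z - x)" "isCont s x" "s x = D"
    using assms(1) CARAT_DERIV by metis
  have "(\<lambda>n. s (X n) * ((X n - x) / e n)) \<longlonglongrightarrow> D * d"
    using tendsto_mult[OF isCont_tendsto_compose[OF s(2) assms(2)] assms(3)] unfolding s(3) .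
  then show ?thesis using s(1) by simp
qed

text \<open>The Leibniz rule along a sequence: the quotient splits into the integral of
  \<open>(G n - G0) / e n\<close> up to \<open>X n\<close> and the quotient of the fixed primitive
  of \<open>G0\<close>, which produces the boundary term.\<close>

lemma integral_endpoint_difference_quotient:
  fixes G :: "nat \<Rightarrow> real \<Rightarrow> real"
  assumes ul: "uniform_limit {0..B} (\<lambda>n x. (G n x - G0 x) / e n) g sequentially"
    and c: "\<And>n. continuous_on {0..B} (G n)" "continuous_on {0..B} G0"
    and e: "\<And>n. e n \<noteq> 0"
    and X: "X \<longlonglongrightarrow> x" "(\<lambda>n. (X n - x) / e n) \<longlonglongrightarrow> d" and x: "0 < x" "x < B"
  shows "(\<lambda>n. (integral {0..X n} (G n) - integral {0..x} G0) / e n) \<longlonglongrightarrow> integral {0..x} g + G0 x * d"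
proof -
  define h where "h = (\<lambda>n x. (G n x - G0 x) / e n)"
  have ch: "continuous_on {0..B} (h n)" for n
    unfolding h_def using e by (intro continuous_intros c) auto
  have cg: "continuous_on {0..B} g"
    using uniform_limit_theorem[OF _ ul] ch unfolding h_def by simp
  have Xin: "\<forall>\<^sub>F n in sequentially. X n \<in> {0..B}"
    using order_tendstoD(1)[OF X(1) x(1)] order_tendstoD(2)[OF X(1) x(2)] by eventually_elim simp
  have 1: "(\<lambda>n. integral {0..X n} (h n)) \<longlonglongrightarrow> integral {0..x} g"
  proof (rule uniform_limit_tendsto_moving[where S = "{0..B}", OF _ _ X(1) Xin])
    show "uniform_limit {0..B} (\<lambda>n x. integral {0..x} (h n)) (\<lambda>x. integral {0..x} g) sequentially"
      by (rule uniform_limit_antiderivative) (use ul ch cg in \<open>auto simp: h_def\<close>)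
    show "continuous_on {0..B} (\<lambda>x. integral {0..x} g)"
      by (intro indefinite_integral_continuous_1 integrable_continuous_interval cg)
  qed (use x in auto)
  have "((\<lambda>t. integral {0..t} G0) has_real_derivative G0 x) (at x within {0..B})"
    by (rule integral_has_real_derivative[OF c(2)]) (use x in auto)
  then have "((\<lambda>t. integral {0..t} G0) has_real_derivative G0 x) (at x)"
    using x at_within_interior[of x "{0..B}"] by (simp add: interior_atLeastAtMost_real)
  then have 2: "(\<lambda>n. (integral {0..X n} G0 - integral {0..x} G0) / e n) \<longlonglongrightarrow> G0 x * d"
    by (rule difference_quotient_moving[OF _ X])
  have "(\<lambda>n. integral {0..X n} (h n) + (integral {0..X n} G0 - integral {0..x} G0) / e n) \<longlonglongrightarrow> integral {0..x} g + G0 x * d"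
    by (rule tendsto_add[OF 1 2])
  moreover have "\<forall>\<^sub>F n in sequentially. integral {0..X n} (h n) + (integral {0..X n} G0 - integral {0..x} G0) / e n
      = (integral {0..X n} (G n) - integral {0..x} G0) / e n"
    using Xin
  proof eventually_elim
    case (elim n)
    have "G n integrable_on {0..X n}" "G0 integrable_on {0..X n}"
      using elim by (auto intro!: integrable_continuous_interval continuous_on_subset[OF c(1)] continuous_on_subset[OF c(2)])
    then have "integral {0..X n} (h n) = (integral {0..X n} (G n) - integral {0..X n} G0) / e n"
      unfolding h_def by (simp add: integral_diff divide_inverse)
    then show ?case by (simp add: diff_divide_distrib)
  qed
  ultimately show ?thesis by (rule Lim_transform_eventually)
qed

text \<open>With this value on the diagonal the divided difference is always a value of
  \<open>deriv f\<close> between the arguments, so its convergence to \<open>deriv f\<close> is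
  uniform even where two profiles cross.\<close>

definition secant :: "(real \<Rightarrow> real) \<Rightarrow> real \<Rightarrow> real \<Rightarrow> real" where
  "secant f a b = (if a = b then deriv f b else (f a - f b) / (a - b))"

lemma secant_eq_deriv:
  assumes "\<And>x. (f has_real_derivative deriv f x) (at x)"
  obtains \<xi> where "\<bar>\<xi> - b\<bar> \<le> \<bar>a - b\<bar>" "min a b \<le> \<xi>" "\<xi> \<le> max a b" "secant f a b = deriv f \<xi>"
proof (cases a b rule: linorder_cases)
  case less
  from MVT2[OF less, of f "deriv f"] assms
  obtain z where "a < z" "z < b" "f b - f a = (b - a) * deriv f z" by blast
  then show ?thesis using less by (intro that[of z]) (auto simp: secant_def field_simps)
next
  case greater
  from MVT2[OF greater, of f "deriv f"] assms
  obtain z where "b < z" "z < a" "f a - f b = (a - b) * deriv f z" by blast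
  then show ?thesis using greater by (intro that[of z]) (auto simp: secant_def field_simps)
qed (use that[of b] in \<open>simp add: secant_def\<close>)

section \<open>Difference quotients along a direction in parameter space\<close>

locale wave_branch =
  fixes f F :: "real \<Rightarrow> real" and U :: "(real^3) set" and um up :: "real^3 \<Rightarrow> real"
    and u :: "real^3 \<Rightarrow> real \<Rightarrow> real" and p0 :: "real^3"
  assumes f_C1: "\<And>x. (f has_real_derivative deriv f x) (at x)" "continuous_on UNIV (deriv f)"
    and F_deriv: "\<And>x. (F has_real_derivative f x) (at x)"
    and family: "wave_family f F U um up u"
    and p0: "p0 \<in> U"
begin

lemma well: "p \<in> U \<Longrightarrow> profile_well f F p (um p) (up p) (u p)"
  using f_C1 F_deriv family unfolding wave_family_def profile_well_def by blast

lemma openU: "open U" and um_cont: "isCont um p0" and up_cont: "isCont up p0"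
  using family p0 unfolding wave_family_def by (auto simp: continuous_on_eq_continuous_at)

sublocale base: profile_well f F p0 "um p0" "up p0" "u p0"
  by (rule well[OF p0])

lemma period_eq_per: "period F um up p0 = base.per"
  by (simp add: period_def base.per_def)

end

text \<open>The difference quotients of the profiles in the direction \<open>\<delta>\<close> solve linear equations whose coefficients
  converge uniformly on \<open>[0, B]\<close>; by Gronwall's inequality they are then uniformly Cauchy.\<close>

locale wave_direction = wave_branch +
  fixes \<delta> :: "real^3" and e :: "nat \<Rightarrow> real" and B :: real
  assumes e_nz: "\<And>n. e n \<noteq> 0" and e_lim: "e \<longlonglongrightarrow> 0"
    and in_U: "\<And>n. p0 + e n *\<^sub>R \<delta> \<in> U"
    and um_ge: "\<And>n. um p0 - 1 \<le> um (p0 + e n *\<^sub>R \<delta>)" and up_le: "\<And>n. up (p0 + e n *\<^sub>R \<delta>) \<le> up p0 + 1"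
    and B: "0 < B"
begin

definition p :: "nat \<Rightarrow> real^3" where "p n = p0 + e n *\<^sub>R \<delta>"
definition r where "r n x = (u (p n) x - u p0 x) / e n"
definition s where "s n x = (deriv (u (p n)) x - deriv (u p0) x) / e n"
definition k where "k n x = p0 $ 3 - secant f (u (p n) x) (u p0 x)"
definition \<beta> where "\<beta> n x = \<delta> $ 1 + \<delta> $ 3 * u (p n) x"
text \<open>A single compact interval for the values of all profiles of the sequence makes the
  bounds on \<open>deriv f\<close> uniform in n. The margin 1 is that of \<open>um_ge\<close> and
  \<open>up_le\<close>.\<close>

definition I where "I = {um p0 - 1..up p0 + 1}"

lemma pn: "profile_well f F (p n) (um (p n)) (up (p n)) (u (p n))"
  using well in_U by (simp add: p_def)

lemma p_lim: "p \<longlonglongrightarrow> p0"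
proof -
  have "(\<lambda>n. p0 + e n *\<^sub>R \<delta>) \<longlonglongrightarrow> p0 + 0 *\<^sub>R \<delta>" by (intro tendsto_intros e_lim)
  then show ?thesis by (simp add: p_def[abs_def])
qed

lemma u_in: "u (p n) x \<in> I" "u p0 x \<in> I"
  using profile_well.v_in[OF pn, of n x] base.v_in[of x] um_ge[of n] up_le[of n] by (auto simp: I_def p_def)

lemma I_convex: "a \<in> I \<Longrightarrow> b \<in> I \<Longrightarrow> min a b \<le> z \<Longrightarrow> z \<le> max a b \<Longrightarrow> z \<in> I"
  by (auto simp: I_def)

lemma r_deriv: "(r n has_real_derivative s n x) (at x)"
  unfolding r_def[abs_def] s_def
  by (intro DERIV_cdivide DERIV_diff profile_well.v_deriv[OF pn] base.v_deriv)

text \<open>Subtracting the two equations of motion and inserting the divided difference of f gives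
  an equation that is exactly linear in \<open>r n\<close>, with no remainder to estimate.\<close>

lemma s_deriv: "(s n has_real_derivative \<beta> n x + k n x * r n x) (at x)"
proof -
  have "(s n has_real_derivative (profile_well.force f (p n) (u (p n) x) - base.force (u p0 x)) / e n) (at x)"
    unfolding s_def[abs_def]
    by (intro DERIV_cdivide DERIV_diff profile_well.v_second[OF pn] base.v_second)
  moreover have "profile_well.force f (p n) (u (p n) x) - base.force (u p0 x) = e n * (\<beta> n x + k n x * r n x)"
  proof -
    have r: "u (p n) x - u p0 x = e n * r n x" using e_nz[of n] by (simp add: r_def)
    have "profile_well.force f (p n) (u (p n) x) - base.force (u p0 x)
        = e n * \<beta> n x + p0 $ 3 * (u (p n) x - u p0 x) - (f (u (p n) x) - f (u p0 x))"
      unfolding base.force_def profile_well.force_def[OF pn] \<beta>_def by (simp add: p_def algebra_simps)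
    also have "f (u (p n) x) - f (u p0 x) = secant f (u (p n) x) (u p0 x) * (u (p n) x - u p0 x)"
      by (simp add: secant_def)
    finally show ?thesis unfolding r by (simp add: k_def algebra_simps)
  qed
  ultimately show ?thesis using e_nz[of n] by simp
qed

lemma s_0: "s n 0 = 0"
  using profile_well.deriv_v_0[OF pn, of n 0] profile_well.v_0[OF pn] base.deriv_v_0[of 0] base.v_0
  by (simp add: s_def)

lemma um_p_lim: "(\<lambda>n. um (p n)) \<longlonglongrightarrow> um p0"
  using isCont_tendsto_compose[OF um_cont p_lim] .

text \<open>Implicit differentiation of V = E at the turning point. Only continuity of
  \<open>um\<close> is known, so the slope function \<open>S\<close> of the potential is used: its
  limit \<open>- base.force (um p0)\<close> is non-zero at a simple root, and dividing by it yields
  the convergence of the quotient.\<close>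

lemma r_0_lim:
  "(\<lambda>n. r n 0) \<longlonglongrightarrow> - (\<delta> $ 2 + \<delta> $ 1 * um p0 + \<delta> $ 3 * (um p0)\<^sup>2 / 2) / base.force (um p0)"
proof -
  obtain S where S: "\<And>z. potential F p0 z - potential F p0 (um p0) = S z * (z - um p0)"
    "isCont S (um p0)" "S (um p0) = - base.force (um p0)"
    using base.potential_deriv[of "um p0"] CARAT_DERIV by metis
  have lim: "(\<lambda>n. S (um (p n))) \<longlonglongrightarrow> - base.force (um p0)"
    using isCont_tendsto_compose[OF S(2) um_p_lim] S(3) by simp
  then have nz: "\<forall>\<^sub>F n in sequentially. S (um (p n)) \<noteq> 0"
    using base.force_m_pos by (intro tendsto_imp_eventually_ne) auto
  have eq: "S (um (p n)) * (r n 0 * e n) = e n * (\<delta> $ 2 + \<delta> $ 1 * um (p n) + \<delta> $ 3 * (um (p n))\<^sup>2 / 2)" for n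
  proof -
    have "S (um (p n)) * (um (p n) - um p0) = potential F p0 (um (p n)) - p0 $ 2"
      using S(1)[of "um (p n)"] base.root_m by simp
    also have "\<dots> = potential F (p n) (um (p n)) - p0 $ 2 + e n * \<delta> $ 1 * um (p n) + e n * \<delta> $ 3 / 2 * (um (p n))\<^sup>2"
      by (simp add: potential_def p_def algebra_simps add_divide_distrib)
    also have "potential F (p n) (um (p n)) = p0 $ 2 + e n * \<delta> $ 2"
      using profile_well.root_m(1)[OF pn, of n] by (simp add: p_def)
    finally have "S (um (p n)) * (um (p n) - um p0) = e n * (\<delta> $ 2 + \<delta> $ 1 * um (p n) + \<delta> $ 3 * (um (p n))\<^sup>2 / 2)"
      by (simp add: algebra_simps)
    moreover have "r n 0 * e n = um (p n) - um p0"
      using profile_well.v_0[OF pn] base.v_0 e_nz[of n] by (simp add: r_def)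
    ultimately show ?thesis by simp
  qed
  have "(\<lambda>n. (\<delta> $ 2 + \<delta> $ 1 * um (p n) + \<delta> $ 3 * (um (p n))\<^sup>2 / 2) / S (um (p n)))
      \<longlonglongrightarrow> (\<delta> $ 2 + \<delta> $ 1 * um p0 + \<delta> $ 3 * (um p0)\<^sup>2 / 2) / - base.force (um p0)"
    using base.force_m_pos by (intro tendsto_intros lim um_p_lim) auto
  moreover have "\<forall>\<^sub>F n in sequentially. (\<delta> $ 2 + \<delta> $ 1 * um (p n) + \<delta> $ 3 * (um (p n))\<^sup>2 / 2) / S (um (p n)) = r n 0"
    using nz
  proof eventually_elim
    case (elim n)
    have "e n * (S (um (p n)) * r n 0) = e n * (\<delta> $ 2 + \<delta> $ 1 * um (p n) + \<delta> $ 3 * (um (p n))\<^sup>2 / 2)"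
      using eq[of n] by (simp add: mult_ac)
    then have "S (um (p n)) * r n 0 = \<delta> $ 2 + \<delta> $ 1 * um (p n) + \<delta> $ 3 * (um (p n))\<^sup>2 / 2"
      using e_nz[of n] by (simp only: mult_cancel_left simp_thms)
    then show ?case using elim by (metis nonzero_mult_div_cancel_left)
  qed
  ultimately have "(\<lambda>n. r n 0) \<longlonglongrightarrow> (\<delta> $ 2 + \<delta> $ 1 * um p0 + \<delta> $ 3 * (um p0)\<^sup>2 / 2) / - base.force (um p0)"
    by (rule Lim_transform_eventually)
  then show ?thesis by (simp only: divide_minus_right minus_divide_left)
qed

lemma deriv_f_bound: obtains K where "0 \<le> K" "\<And>x. x \<in> I \<Longrightarrow> \<bar>deriv f x\<bar> \<le> K"
proof -
  have "compact (deriv f ` I)"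
    unfolding I_def by (intro compact_continuous_image continuous_on_subset[OF f_C1(2)]) auto
  then obtain K where "\<And>x. x \<in> I \<Longrightarrow> \<bar>deriv f x\<bar> \<le> K"
    by (metis bounded_real compact_imp_bounded imageI)
  then show ?thesis using that[of "max 0 K"] by (auto simp: le_max_iff_disj)
qed

lemma k_bound: obtains K where "0 \<le> K" "\<And>n x. \<bar>k n x\<bar> \<le> K"
proof -
  obtain K where K: "0 \<le> K" "\<And>x. x \<in> I \<Longrightarrow> \<bar>deriv f x\<bar> \<le> K" by (rule deriv_f_bound) blast
  have "\<bar>k n x\<bar> \<le> \<bar>p0 $ 3\<bar> + K" for n x
  proof -
    obtain z where "min (u (p n) x) (u p0 x) \<le> z" "z \<le> max (u (p n) x) (u p0 x)"
      "secant f (u (p n) x) (u p0 x) = deriv f z"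
      using secant_eq_deriv[OF f_C1(1)] by metis
    then have "\<bar>secant f (u (p n) x) (u p0 x)\<bar> \<le> K" using K(2) I_convex u_in by metis
    then show ?thesis unfolding k_def by linarith
  qed
  then show ?thesis using that[of "\<bar>p0 $ 3\<bar> + K"] K(1) by simp
qed

lemma \<beta>_bound: obtains C where "\<And>n x. \<bar>\<beta> n x\<bar> \<le> C"
proof -
  define R where "R = max \<bar>um p0 - 1\<bar> \<bar>up p0 + 1\<bar>"
  have "\<bar>\<beta> n x\<bar> \<le> \<bar>\<delta> $ 1\<bar> + \<bar>\<delta> $ 3\<bar> * R" for n x
  proof -
    have "\<bar>u (p n) x\<bar> \<le> R" using u_in(1)[of n x] unfolding R_def I_def by (auto simp: abs_if)
    then have "\<bar>\<delta> $ 3 * u (p n) x\<bar> \<le> \<bar>\<delta> $ 3\<bar> * R" by (simp add: abs_mult mult_left_mono)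
    then show ?thesis unfolding \<beta>_def by linarith
  qed
  then show ?thesis using that by blast
qed

text \<open>This has to precede the Cauchy property, where the product
  \<open>(k i x - k j x) * r j x\<close> counts as forcing and must be small.\<close>

lemma rs_bound: obtains C where "0 \<le> C" "\<And>n x. x \<in> {0..B} \<Longrightarrow> \<bar>r n x\<bar> \<le> C" "\<And>n x. x \<in> {0..B} \<Longrightarrow> \<bar>s n x\<bar> \<le> C"
proof -
  obtain K where K: "0 \<le> K" "\<And>n x. \<bar>k n x\<bar> \<le> K" by (rule k_bound) blast
  obtain C where C: "\<And>n x. \<bar>\<beta> n x\<bar> \<le> C" by (rule \<beta>_bound) blast
  have "Bseq (\<lambda>n. r n 0)" using r_0_lim convergentI convergent_imp_Bseq by blast
  then obtain C0 where C0: "\<And>n. \<bar>r n 0\<bar> \<le> C0" by (auto simp: Bseq_def)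
  define D where "D = (C0\<^sup>2 + C\<^sup>2) * exp ((2 + K) * B)"
  have le: "(r n x)\<^sup>2 + (s n x)\<^sup>2 \<le> D" if x: "x \<in> {0..B}" for n x
  proof -
    have "(r n x)\<^sup>2 + (s n x)\<^sup>2 \<le> ((r n 0)\<^sup>2 + (s n 0)\<^sup>2 + C\<^sup>2) * exp ((2 + K) * x)"
      by (rule gronwall_second_order[where B = B and \<beta> = "\<beta> n" and k = "k n"])
         (use x r_deriv s_deriv K(2) C in auto)
    also have "\<dots> \<le> D"
      unfolding D_def s_0 using C0[of n] x K(1)
      by (intro mult_mono) (auto simp: abs_le_square_iff[symmetric] mult_left_mono)
    finally show ?thesis .
  qed
  have le2: "t\<^sup>2 \<le> D \<Longrightarrow> \<bar>t\<bar> \<le> sqrt D" for t by (simp add: real_le_rsqrt)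
  have "\<bar>r n x\<bar> \<le> sqrt D" "\<bar>s n x\<bar> \<le> sqrt D" if "x \<in> {0..B}" for n x
    using le[OF that, of n] zero_le_power2[of "r n x"] zero_le_power2[of "s n x"] by (intro le2; linarith)+
  moreover have "0 \<le> sqrt D" by (simp add: D_def)
  ultimately show ?thesis using that by blast
qed

lemma u_uniform: "uniform_limit {0..B} (\<lambda>n. u (p n)) (u p0) sequentially"
proof (rule uniform_limitI)
  fix \<epsilon> :: real assume \<epsilon>: "\<epsilon> > 0"
  obtain C where C: "0 \<le> C" "\<And>n x. x \<in> {0..B} \<Longrightarrow> \<bar>r n x\<bar> \<le> C" by (rule rs_bound) blast
  have "(\<lambda>n. \<bar>e n\<bar> * C) \<longlonglongrightarrow> 0" using e_lim by (intro tendsto_mult_left_zero tendsto_rabs_zero)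
  then have "\<forall>\<^sub>F n in sequentially. \<bar>e n\<bar> * C < \<epsilon>" using \<epsilon> by (rule order_tendstoD)
  then show "\<forall>\<^sub>F n in sequentially. \<forall>x\<in>{0..B}. dist (u (p n) x) (u p0 x) < \<epsilon>"
  proof eventually_elim
    case (elim n)
    have "dist (u (p n) x) (u p0 x) \<le> \<bar>e n\<bar> * C" if "x \<in> {0..B}" for x
    proof -
      have "dist (u (p n) x) (u p0 x) = \<bar>e n\<bar> * \<bar>r n x\<bar>"
        using e_nz[of n] by (simp add: r_def dist_real_def abs_divide)
      then show ?thesis using C(2)[OF that, of n] by (simp add: mult_left_mono)
    qed
    then show ?case using elim by (meson le_less_trans)
  qed
qed

lemma k_uniform: "uniform_limit {0..B} k (\<lambda>x. p0 $ 3 - deriv f (u p0 x)) sequentially"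
proof (rule uniform_limitI)
  fix \<epsilon> :: real assume \<epsilon>: "\<epsilon> > 0"
  have "uniformly_continuous_on I (deriv f)"
    unfolding I_def by (intro compact_uniformly_continuous continuous_on_subset[OF f_C1(2)]) auto
  then obtain d where d: "d > 0" "\<And>x y. x \<in> I \<Longrightarrow> y \<in> I \<Longrightarrow> dist y x < d \<Longrightarrow> dist (deriv f y) (deriv f x) < \<epsilon>"
    using \<epsilon> unfolding uniformly_continuous_on_def by metis
  have "\<forall>\<^sub>F n in sequentially. \<forall>x\<in>{0..B}. dist (u (p n) x) (u p0 x) < d"
    using u_uniform d(1) by (simp add: uniform_limit_iff)
  then show "\<forall>\<^sub>F n in sequentially. \<forall>x\<in>{0..B}. dist (k n x) (p0 $ 3 - deriv f (u p0 x)) < \<epsilon>"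
  proof (rule eventually_mono, intro ballI)
    fix n x assume a: "\<forall>x\<in>{0..B}. dist (u (p n) x) (u p0 x) < d" "x \<in> {0..B}"
    obtain z where z: "\<bar>z - u p0 x\<bar> \<le> \<bar>u (p n) x - u p0 x\<bar>" "min (u (p n) x) (u p0 x) \<le> z" "z \<le> max (u (p n) x) (u p0 x)"
      "secant f (u (p n) x) (u p0 x) = deriv f z"
      using secant_eq_deriv[OF f_C1(1)] by metis
    have "z \<in> I" using z I_convex u_in by metis
    moreover have "dist z (u p0 x) < d" using z(1) a by (fastforce simp: dist_real_def)
    ultimately have "dist (deriv f z) (deriv f (u p0 x)) < \<epsilon>" using d(2) u_in by blast
    then show "dist (k n x) (p0 $ 3 - deriv f (u p0 x)) < \<epsilon>"
      unfolding k_def z(4) dist_real_def by linarith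
  qed
qed

lemma rs_Cauchy:
  assumes \<epsilon>: "\<epsilon> > 0"
  shows "\<exists>N. \<forall>x\<in>{0..B}. \<forall>i\<ge>N. \<forall>j\<ge>N. \<bar>r i x - r j x\<bar> < \<epsilon> \<and> \<bar>s i x - s j x\<bar> < \<epsilon>"
proof -
  obtain K where K: "0 \<le> K" "\<And>n x. \<bar>k n x\<bar> \<le> K" by (rule k_bound) blast
  obtain C where C: "0 \<le> C" "\<And>n x. x \<in> {0..B} \<Longrightarrow> \<bar>r n x\<bar> \<le> C" by (rule rs_bound) blast
  \<comment> \<open>Chosen so that the Gronwall bound
    \<open>2 * \<eta>^2 * exp ((2 + K) * B)\<close> equals \<open>\<epsilon>^2 / 2\<close>; then
    \<zeta> is chosen so that the forcing, which is at most \<zeta> times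
    \<open>\<bar>\<delta> $ 3\<bar> + C\<close>, stays below \<eta>.\<close>
  define \<eta> where "\<eta> = \<epsilon> / (2 * exp ((2 + K) * B / 2))"
  have \<eta>: "\<eta> > 0" using \<epsilon> by (simp add: \<eta>_def)
  define \<zeta> where "\<zeta> = \<eta> / (1 + \<bar>\<delta> $ 3\<bar> + C)"
  have D0: "0 < 1 + \<bar>\<delta> $ 3\<bar> + C" using C(1) by linarith
  have \<zeta>: "\<zeta> > 0" using \<eta> D0 by (simp add: \<zeta>_def)
  have "uniformly_Cauchy_on {0..B} (\<lambda>n. u (p n))" "uniformly_Cauchy_on {0..B} k" "Cauchy (\<lambda>n. r n 0)"
    using u_uniform k_uniform r_0_lim
    by (auto intro: LIMSEQ_imp_Cauchy simp: uniformly_convergent_eq_Cauchy[symmetric] uniformly_convergent_on_def)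
  then obtain N1 N2 N3 where
    N1: "\<And>x i j. x \<in> {0..B} \<Longrightarrow> i \<ge> N1 \<Longrightarrow> j \<ge> N1 \<Longrightarrow> dist (u (p i) x) (u (p j) x) < \<zeta>" and
    N2: "\<And>x i j. x \<in> {0..B} \<Longrightarrow> i \<ge> N2 \<Longrightarrow> j \<ge> N2 \<Longrightarrow> dist (k i x) (k j x) < \<zeta>" and
    N3: "\<And>i j. i \<ge> N3 \<Longrightarrow> j \<ge> N3 \<Longrightarrow> dist (r i 0) (r j 0) < \<eta>"
    unfolding uniformly_Cauchy_on_def Cauchy_def using \<zeta> \<eta> by metis
  have main: "(r i x - r j x)\<^sup>2 + (s i x - s j x)\<^sup>2 < \<epsilon>\<^sup>2"
    if x: "x \<in> {0..B}" and ij: "i \<ge> max N1 (max N2 N3)" "j \<ge> max N1 (max N2 N3)" for x i j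
  proof -
    have "(r i x - r j x)\<^sup>2 + (s i x - s j x)\<^sup>2 \<le> ((r i 0 - r j 0)\<^sup>2 + (s i 0 - s j 0)\<^sup>2 + \<eta>\<^sup>2) * exp ((2 + K) * x)"
    proof (rule gronwall_second_order[where B = B and k = "k i" and \<beta> = "\<lambda>x. \<beta> i x - \<beta> j x + (k i x - k j x) * r j x"])
      fix y assume y: "0 \<le> y" "y \<le> B"
      show "((\<lambda>x. r i x - r j x) has_real_derivative s i y - s j y) (at y)"
        by (intro derivative_intros r_deriv)
      have "((\<lambda>x. s i x - s j x) has_real_derivative (\<beta> i y + k i y * r i y) - (\<beta> j y + k j y * r j y)) (at y)"
        by (intro derivative_intros s_deriv)
      then show "((\<lambda>x. s i x - s j x) has_real_derivative
          (\<beta> i y - \<beta> j y + (k i y - k j y) * r j y) + k i y * (r i y - r j y)) (at y)"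
        by (simp add: algebra_simps)
      have y': "y \<in> {0..B}" using y by simp
      have "\<bar>\<beta> i y - \<beta> j y\<bar> = \<bar>\<delta> $ 3\<bar> * dist (u (p i) y) (u (p j) y)"
        unfolding \<beta>_def dist_real_def by (simp add: abs_mult[symmetric] algebra_simps)
      also have "\<dots> \<le> \<bar>\<delta> $ 3\<bar> * \<zeta>" using N1[OF y', of i j] ij by (intro mult_left_mono) auto
      finally have 1: "\<bar>\<beta> i y - \<beta> j y\<bar> \<le> \<bar>\<delta> $ 3\<bar> * \<zeta>" .
      have 2: "\<bar>(k i y - k j y) * r j y\<bar> \<le> \<zeta> * C"
        unfolding abs_mult using N2[OF y', of i j] ij C(2)[OF y', of j] \<zeta>
        by (intro mult_mono) (auto simp: dist_real_def)
      have "\<bar>\<delta> $ 3\<bar> * \<zeta> + \<zeta> * C \<le> \<eta>"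
      proof -
        have "\<bar>\<delta> $ 3\<bar> * \<zeta> + \<zeta> * C \<le> (1 + \<bar>\<delta> $ 3\<bar> + C) * \<zeta>" using \<zeta> by (simp add: algebra_simps)
        also have "\<dots> = \<eta>" using D0 by (simp add: \<zeta>_def)
        finally show ?thesis .
      qed
      then show "\<bar>\<beta> i y - \<beta> j y + (k i y - k j y) * r j y\<bar> \<le> \<eta>" using 1 2 by linarith
    qed (use x K in auto)
    also have "\<dots> \<le> (\<eta>\<^sup>2 + \<eta>\<^sup>2) * exp ((2 + K) * B)"
    proof (rule mult_mono)
      have "\<bar>r i 0 - r j 0\<bar> \<le> \<bar>\<eta>\<bar>" using N3[of i j] ij \<eta> by (simp add: dist_real_def)
      then show "(r i 0 - r j 0)\<^sup>2 + (s i 0 - s j 0)\<^sup>2 + \<eta>\<^sup>2 \<le> \<eta>\<^sup>2 + \<eta>\<^sup>2"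
        by (simp add: s_0 abs_le_square_iff)
    qed (use x K(1) in \<open>auto intro: mult_left_mono\<close>)
    also have "\<dots> = \<epsilon>\<^sup>2 / 2"
    proof -
      have "(exp ((2 + K) * B / 2))\<^sup>2 = exp ((2 + K) * B)" by (simp flip: exp_double)
      then show ?thesis unfolding \<eta>_def power_divide power_mult_distrib by simp
    qed
    also have "\<dots> < \<epsilon>\<^sup>2" using \<epsilon> by simp
    finally show ?thesis .
  qed
  have lt: "t\<^sup>2 < \<epsilon>\<^sup>2 \<Longrightarrow> \<bar>t\<bar> < \<epsilon>" for t
    using power2_less_imp_less[of "\<bar>t\<bar>" \<epsilon>] \<epsilon> by simp
  have "\<bar>r i x - r j x\<bar> < \<epsilon> \<and> \<bar>s i x - s j x\<bar> < \<epsilon>"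
    if "x \<in> {0..B}" "i \<ge> max N1 (max N2 N3)" "j \<ge> max N1 (max N2 N3)" for x i j
    using main[OF that] zero_le_power2[of "r i x - r j x"] zero_le_power2[of "s i x - s j x"] by (intro conjI lt; linarith)
  then show ?thesis by blast
qed

definition y where "y x = lim (\<lambda>n. r n x)"
definition y' where "y' x = lim (\<lambda>n. s n x)"

lemma r_uniform: "uniform_limit {0..B} r y sequentially"
  and s_uniform: "uniform_limit {0..B} s y' sequentially"
proof -
  have "uniformly_Cauchy_on {0..B} r" "uniformly_Cauchy_on {0..B} s"
    unfolding uniformly_Cauchy_on_def dist_real_def using rs_Cauchy by metis+
  then show "uniform_limit {0..B} r y sequentially" "uniform_limit {0..B} s y' sequentially"
    unfolding y_def[abs_def] y'_def[abs_def]
    by (simp_all add: Cauchy_uniformly_convergent uniformly_convergent_uniform_limit_iff[symmetric])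
qed

lemma r_cont: "continuous_on S (r n)" and s_cont: "continuous_on S (s n)"
  by (meson DERIV_continuous_on has_field_derivative_at_within r_deriv s_deriv)+

lemma y_cont: "continuous_on {0..B} y" and y'_cont: "continuous_on {0..B} y'"
  using uniform_limit_theorem[OF _ r_uniform] uniform_limit_theorem[OF _ s_uniform] r_cont s_cont by simp_all

lemma y_deriv:
  assumes x: "x \<in> {0..B}"
  shows "(y has_real_derivative y' x) (at x within {0..B})"
  unfolding has_real_derivative_iff_has_vector_derivative
  by (rule has_vector_derivative_uniform_limit[OF _ x _ s_uniform tendsto_uniform_limitI[OF r_uniform]])
     (auto intro: has_field_derivative_at_within r_deriv simp flip: has_real_derivative_iff_has_vector_derivative)

lemma y'_deriv:
  assumes x: "x \<in> {0..B}"
  shows "(y' has_real_derivative \<delta> $ 1 + \<delta> $ 3 * u p0 x + (p0 $ 3 - deriv f (u p0 x)) * y x) (at x within {0..B})"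
proof -
  have ck: "continuous_on {0..B} (\<lambda>x. p0 $ 3 - deriv f (u p0 x))"
    by (intro continuous_intros continuous_on_compose2[OF f_C1(2)] base.v_cont) auto
  have b: "bounded ((\<lambda>x. p0 $ 3 - deriv f (u p0 x)) ` {0..B})" "bounded (y ` {0..B})"
    by (intro compact_imp_bounded compact_continuous_image ck y_cont; simp)+
  have "uniform_limit {0..B} (\<lambda>n x. \<beta> n x + k n x * r n x)
      (\<lambda>x. \<delta> $ 1 + \<delta> $ 3 * u p0 x + (p0 $ 3 - deriv f (u p0 x)) * y x) sequentially"
    unfolding \<beta>_def
    by (intro uniform_limit_add uniform_limit_const uniform_lim_mult[OF k_uniform r_uniform b]
        bounded_linear.uniform_limit[OF bounded_linear_mult_right u_uniform])
  then show ?thesis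
    unfolding has_real_derivative_iff_has_vector_derivative
    by (intro has_vector_derivative_uniform_limit[OF _ x _ _ tendsto_uniform_limitI[OF s_uniform]])
       (auto intro: has_field_derivative_at_within s_deriv simp flip: has_real_derivative_iff_has_vector_derivative)
qed

lemma y_0: "y 0 = - (\<delta> $ 2 + \<delta> $ 1 * um p0 + \<delta> $ 3 * (um p0)\<^sup>2 / 2) / base.force (um p0)"
  using r_0_lim unfolding y_def by (rule limI)

lemma y'_0: "y' 0 = 0"
  by (simp add: y'_def s_0)

end

context wave_direction
begin

context
  fixes dT :: real
  assumes per_B: "base.per < B"
    and T_lim: "(\<lambda>n. (period F um up (p n) - period F um up p0) / e n) \<longlonglongrightarrow> dT"
begin

abbreviation (input) X where "X n \<equiv> period F um up (p n)"

lemma X_lim: "X \<longlonglongrightarrow> base.per"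
proof -
  have "(\<lambda>n. base.per + e n * ((X n - base.per) / e n)) \<longlonglongrightarrow> base.per + 0 * dT"
    using T_lim unfolding period_eq_per by (intro tendsto_intros e_lim)
  then show ?thesis using e_nz by simp
qed

lemma X_quotient: "(\<lambda>n. (X n - base.per) / e n) \<longlonglongrightarrow> dT"
  using T_lim unfolding period_eq_per .

lemma X_in: "\<forall>\<^sub>F n in sequentially. X n \<in> {0..B}"
  using order_tendstoD(1)[OF X_lim base.per_pos] order_tendstoD(2)[OF X_lim per_B] by eventually_elim simp

lemma deriv_u_X: "deriv (u (p n)) (X n) = 0"
  using profile_well.deriv_v_per[OF pn] unfolding profile_well.per_def[OF pn] period_def .

lemma u_per: "u p0 base.per = um p0"
  using base.v_per[of 0] base.v_0 by simp

text \<open>The equation u_x(T) = 0 is differentiated along the family. Each velocity vanishes at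
  its own period, so \<open>s n (X n)\<close> is minus the difference quotient of
  \<open>deriv (u p0)\<close> between the two periods, whose limit is the acceleration times
  \<open>dT\<close>.\<close>

lemma y'_per: "y' base.per = - base.force (um p0) * dT"
proof -
  have 1: "(\<lambda>n. s n (X n)) \<longlonglongrightarrow> y' base.per"
    by (rule uniform_limit_tendsto_moving[OF s_uniform y'_cont X_lim X_in])
       (use per_B base.per_pos in auto)
  have "(\<lambda>n. (deriv (u p0) (X n) - deriv (u p0) base.per) / e n) \<longlonglongrightarrow> base.force (u p0 base.per) * dT"
    by (rule difference_quotient_moving[OF base.v_second X_lim X_quotient])
  moreover have "s n (X n) = - ((deriv (u p0) (X n) - deriv (u p0) base.per) / e n)" for n
    by (simp add: s_def deriv_u_X base.deriv_v_per)
  ultimately have "(\<lambda>n. s n (X n)) \<longlonglongrightarrow> - (base.force (um p0) * dT)"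
    unfolding u_per by (simp add: tendsto_minus)
  then show ?thesis using LIMSEQ_unique[OF 1] by simp
qed

text \<open>Differentiating the mass gives the integral of y plus the boundary term u(T)
  \<open>dT\<close>, and the profile has the value \<open>um p0\<close> at the end of its
  period.\<close>

lemma integral_y:
  assumes "(\<lambda>n. (mass (period F um up) u (p n) - mass (period F um up) u p0) / e n) \<longlonglongrightarrow> dM"
  shows "integral {0..base.per} y = dM - um p0 * dT"
proof -
  have "(\<lambda>n. (integral {0..X n} (u (p n)) - integral {0..base.per} (u p0)) / e n)
      \<longlonglongrightarrow> integral {0..base.per} y + u p0 base.per * dT"
    by (rule integral_endpoint_difference_quotient[where B = B])
       (use r_uniform X_lim X_quotient e_nz per_B base.per_pos base.v_cont profile_well.v_cont[OF pn]
         in \<open>auto simp: r_def[abs_def]\<close>)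
  then show ?thesis
    using LIMSEQ_unique[OF assms] unfolding mass_def period_eq_per u_per by simp
qed

lemma integral_u_y:
  assumes "(\<lambda>n. (momentum (period F um up) u (p n) - momentum (period F um up) u p0) / e n) \<longlonglongrightarrow> dP"
  shows "integral {0..base.per} (\<lambda>x. u p0 x * y x) = (dP - (um p0)\<^sup>2 * dT) / 2"
proof -
  have b: "bounded (y ` {0..B})" "bounded ((\<lambda>x. u p0 x + u p0 x) ` {0..B})"
    by (intro compact_imp_bounded compact_continuous_image continuous_intros y_cont base.v_cont; simp)+
  have "uniform_limit {0..B} (\<lambda>n x. r n x * (u (p n) x + u p0 x)) (\<lambda>x. y x * (u p0 x + u p0 x)) sequentially"
    by (intro uniform_lim_mult r_uniform uniform_limit_add u_uniform uniform_limit_const b)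
  \<comment> \<open>The difference quotient of the squares factors through \<open>r n\<close>, which
    in the limit doubles the integrand; this is the origin of the factor 1/2 in the result.\<close>
  moreover have "r n x * (u (p n) x + u p0 x) = ((u (p n) x)\<^sup>2 - (u p0 x)\<^sup>2) / e n" for n x
    by (simp add: r_def power2_eq_square field_simps)
  ultimately have "uniform_limit {0..B} (\<lambda>n x. ((u (p n) x)\<^sup>2 - (u p0 x)\<^sup>2) / e n) (\<lambda>x. y x * (u p0 x + u p0 x)) sequentially"
    by simp
  then have "(\<lambda>n. (integral {0..X n} (\<lambda>x. (u (p n) x)\<^sup>2) - integral {0..base.per} (\<lambda>x. (u p0 x)\<^sup>2)) / e n)
      \<longlonglongrightarrow> integral {0..base.per} (\<lambda>x. y x * (u p0 x + u p0 x)) + (u p0 base.per)\<^sup>2 * dT"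
    by (rule integral_endpoint_difference_quotient[where B = B])
       (use X_lim X_quotient e_nz per_B base.per_pos base.v_cont profile_well.v_cont[OF pn]
         in \<open>auto intro!: continuous_intros\<close>)
  then have "dP = integral {0..base.per} (\<lambda>x. y x * (u p0 x + u p0 x)) + (um p0)\<^sup>2 * dT"
    using LIMSEQ_unique[OF assms] unfolding momentum_def period_eq_per u_per by simp
  also have "(\<lambda>x. y x * (u p0 x + u p0 x)) = (\<lambda>x. 2 * (u p0 x * y x))" by (simp add: algebra_simps)
  finally show ?thesis by simp
qed

end

end

section \<open>The resolvent equation on one period\<close>

definition weighted_integral :: "(real \<Rightarrow> real) \<Rightarrow> (real \<Rightarrow> complex) \<Rightarrow> real \<Rightarrow> complex" where
  "weighted_integral k g x = integral {0..x} (\<lambda>t. k t *\<^sub>R g t)"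

lemma weighted_integral_deriv:
  assumes "continuous_on {0..T} k" "continuous_on {0..T} g" "x \<in> {0..T}"
  shows "(weighted_integral k g has_vector_derivative k x *\<^sub>R g x) (at x within {0..T})"
  unfolding weighted_integral_def[abs_def]
  by (rule integral_has_vector_derivative) (use assms in \<open>auto intro!: continuous_intros\<close>)

lemma weighted_integral_0 [simp]: "weighted_integral k g 0 = 0"
  by (simp add: weighted_integral_def)

lemma weighted_integral_bound:
  assumes c: "continuous_on {0..T} k" "continuous_on {0..T} g" and x: "x \<in> {0..T}"
    and K: "\<And>t. t \<in> {0..T} \<Longrightarrow> \<bar>k t\<bar> \<le> K" and N: "\<And>t. t \<in> {0..T} \<Longrightarrow> cmod (g t) \<le> N"
  shows "cmod (weighted_integral k g x) \<le> T * K * N"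
proof -
  have K0: "0 \<le> K" using K[OF x] by (meson abs_ge_zero order_trans)
  have N0: "0 \<le> N" using N[OF x] by (meson norm_ge_zero order_trans)
  have "cmod (weighted_integral k g x) \<le> K * N * (x - 0)"
    unfolding weighted_integral_def
  proof (rule integral_bound)
    show "continuous_on {0..x} (\<lambda>t. k t *\<^sub>R g t)"
      using x by (intro continuous_intros continuous_on_subset[OF c(1)] continuous_on_subset[OF c(2)]) auto
    show "cmod (k t *\<^sub>R g t) \<le> K * N" if "t \<in> {0..x}" for t
      using K[of t] N[of t] K0 that x by (auto intro!: mult_mono)
  qed (use x in auto)
  also have "\<dots> \<le> K * N * T" using x K0 N0 by (intro mult_left_mono) auto
  finally show ?thesis by (simp add: mult_ac)
qed

lemma geometric_series_uniform_limit:
  fixes g :: "nat \<Rightarrow> real \<Rightarrow> complex"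
  assumes g: "\<And>n x. x \<in> S \<Longrightarrow> cmod (g n x) \<le> N * C ^ n" and C: "0 \<le> C" "cmod \<mu> * C < 1"
  shows "uniform_limit S (\<lambda>n x. \<Sum>i<n. \<mu> ^ i * g i x) (\<lambda>x. \<Sum>i. \<mu> ^ i * g i x) sequentially"
    and "x \<in> S \<Longrightarrow> (\<lambda>i. \<mu> ^ i * g i x) sums (\<Sum>i. \<mu> ^ i * g i x)"
proof -
  have le: "cmod (\<mu> ^ n * g n x) \<le> N * (cmod \<mu> * C) ^ n" if "x \<in> S" for n x
    using mult_left_mono[OF g[OF that, of n], of "cmod \<mu> ^ n"]
    by (simp add: norm_mult norm_power power_mult_distrib mult_ac)
  have sm: "summable (\<lambda>n. N * (cmod \<mu> * C) ^ n)"
    using C by (intro summable_mult summable_geometric) (simp add: abs_mult)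
  show "uniform_limit S (\<lambda>n x. \<Sum>i<n. \<mu> ^ i * g i x) (\<lambda>x. \<Sum>i. \<mu> ^ i * g i x) sequentially"
    by (rule Weierstrass_m_test[OF le sm])
  show "(\<lambda>i. \<mu> ^ i * g i x) sums (\<Sum>i. \<mu> ^ i * g i x)" if "x \<in> S"
    by (rule summable_sums, rule summable_comparison_test'[OF sm, of 0]) (use le that in auto)
qed

text \<open>Uniform convergence permits integration term by term. The period jumps used later are
  built from such weighted integrals, so this makes them power series in \<mu>.\<close>

lemma weighted_integral_series:
  fixes g :: "nat \<Rightarrow> real \<Rightarrow> complex"
  assumes g: "\<And>n x. x \<in> {0..T} \<Longrightarrow> cmod (g n x) \<le> N * C ^ n" and C: "0 \<le> C" "cmod \<mu> * C < 1"
    and cg: "\<And>n. continuous_on {0..T} (g n)" and ck: "continuous_on {0..T} k" and x: "x \<in> {0..T}"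
  shows "(\<lambda>i. \<mu> ^ i * weighted_integral k (g i) x) sums weighted_integral k (\<lambda>t. \<Sum>i. \<mu> ^ i * g i t) x"
proof -
  have sub: "{0..x} \<subseteq> {0..T}" using x by auto
  have ck': "continuous_on {0..x} k" and cg': "continuous_on {0..x} (g n)" for n
    using continuous_on_subset[OF ck sub] continuous_on_subset[OF cg sub] by blast+
  have ul: "uniform_limit {0..x} (\<lambda>n t. \<Sum>i<n. \<mu> ^ i * g i t) (\<lambda>t. \<Sum>i. \<mu> ^ i * g i t) sequentially"
    by (rule uniform_limit_on_subset[OF geometric_series_uniform_limit(1)[OF g C] sub])
  have cw: "continuous_on {0..x} (\<lambda>t. \<Sum>i. \<mu> ^ i * g i t)"
    by (rule uniform_limit_theorem[OF _ ul]) (auto intro!: always_eventually continuous_intros cg')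
  have "uniform_limit {0..x} (\<lambda>n t. k t *\<^sub>R (\<Sum>i<n. \<mu> ^ i * g i t)) (\<lambda>t. k t *\<^sub>R (\<Sum>i. \<mu> ^ i * g i t)) sequentially"
    by (intro bounded_bilinear.bounded_uniform_limit[OF bounded_bilinear_scaleR] uniform_limit_const ul
        compact_imp_bounded compact_continuous_image ck' cw) auto
  then obtain I J where I: "\<And>n. ((\<lambda>t. k t *\<^sub>R (\<Sum>i<n. \<mu> ^ i * g i t)) has_integral I n) {0..x}"
    and J: "((\<lambda>t. k t *\<^sub>R (\<Sum>i. \<mu> ^ i * g i t)) has_integral J) {0..x}" and IJ: "I \<longlonglongrightarrow> J"
    by (rule uniform_limit_integral) (auto intro!: continuous_intros ck' cg')
  have "I n = (\<Sum>i<n. \<mu> ^ i * weighted_integral k (g i) x)" for n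
  proof -
    have "((\<lambda>t. \<Sum>i<n. \<mu> ^ i * (k t *\<^sub>R g i t)) has_integral (\<Sum>i<n. \<mu> ^ i * weighted_integral k (g i) x)) {0..x}"
      unfolding weighted_integral_def
      by (intro has_integral_sum has_integral_mult_right integrable_integral integrable_continuous_interval
          continuous_intros ck' cg') auto
    then show ?thesis
      using has_integral_unique[OF I[of n]] by (simp add: scaleR_sum_right)
  qed
  then have "I = (\<lambda>n. \<Sum>i<n. \<mu> ^ i * weighted_integral k (g i) x)" by (rule ext)
  then have "(\<lambda>i. \<mu> ^ i * weighted_integral k (g i) x) sums J" using IJ by (simp add: sums_def)
  moreover have "J = weighted_integral k (\<lambda>t. \<Sum>i. \<mu> ^ i * g i t) x"
    using J by (simp add: weighted_integral_def integral_unique)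
  ultimately show ?thesis by simp
qed

section \<open>Variation of constants and the Neumann series\<close>

locale fundamental_pair =
  fixes T :: real and b \<phi>1 \<psi>1 \<phi>2 \<psi>2 :: "real \<Rightarrow> real"
  assumes T: "0 < T"
    and d\<phi>1: "\<And>x. x \<in> {0..T} \<Longrightarrow> (\<phi>1 has_real_derivative \<psi>1 x) (at x within {0..T})"
    and d\<psi>1: "\<And>x. x \<in> {0..T} \<Longrightarrow> (\<psi>1 has_real_derivative b x * \<phi>1 x) (at x within {0..T})"
    and d\<phi>2: "\<And>x. x \<in> {0..T} \<Longrightarrow> (\<phi>2 has_real_derivative \<psi>2 x) (at x within {0..T})"
    and d\<psi>2: "\<And>x. x \<in> {0..T} \<Longrightarrow> (\<psi>2 has_real_derivative b x * \<phi>2 x) (at x within {0..T})"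
    and wronskian_0: "\<phi>1 0 * \<psi>2 0 - \<psi>1 0 * \<phi>2 0 = 1"
begin

lemma wronskian: "x \<in> {0..T} \<Longrightarrow> \<phi>1 x * \<psi>2 x - \<psi>1 x * \<phi>2 x = 1"
proof -
  assume x: "x \<in> {0..T}"
  have "((\<lambda>x. \<phi>1 x * \<psi>2 x - \<psi>1 x * \<phi>2 x) has_real_derivative 0) (at x within {0..T})" if "x \<in> {0..T}" for x
    by (rule derivative_eq_intros d\<phi>1 d\<phi>2 d\<psi>1 d\<psi>2 that refl | simp)+
  then have "\<exists>c. \<forall>x\<in>{0..T}. \<phi>1 x * \<psi>2 x - \<psi>1 x * \<phi>2 x = c"
    by (intro has_field_derivative_zero_constant) auto
  then show ?thesis using wronskian_0 x T by (metis atLeastAtMost_iff less_imp_le order_refl)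
qed

lemma c\<phi>1: "continuous_on {0..T} \<phi>1" and c\<phi>2: "continuous_on {0..T} \<phi>2"
  by (rule DERIV_continuous_on[OF d\<phi>1] DERIV_continuous_on[OF d\<phi>2]; assumption)+

definition \<Phi>1 where "\<Phi>1 x = integral {0..x} \<phi>1"
definition \<Phi>2 where "\<Phi>2 x = integral {0..x} \<phi>2"
text \<open>The solution of y'' = b y - 1 with zero data at 0, that is, the response to the constant
  q = 1.\<close>

definition \<kappa> where "\<kappa> x = \<phi>1 x * \<Phi>2 x - \<phi>2 x * \<Phi>1 x"
definition \<kappa>' where "\<kappa>' x = \<psi>1 x * \<Phi>2 x - \<psi>2 x * \<Phi>1 x"

lemma d\<Phi>1: "x \<in> {0..T} \<Longrightarrow> (\<Phi>1 has_real_derivative \<phi>1 x) (at x within {0..T})"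
  and d\<Phi>2: "x \<in> {0..T} \<Longrightarrow> (\<Phi>2 has_real_derivative \<phi>2 x) (at x within {0..T})"
  unfolding \<Phi>1_def[abs_def] \<Phi>2_def[abs_def]
  by (auto intro!: integral_has_real_derivative c\<phi>1 c\<phi>2)

lemma c\<Phi>1: "continuous_on {0..T} \<Phi>1" and c\<Phi>2: "continuous_on {0..T} \<Phi>2"
  by (rule DERIV_continuous_on[OF d\<Phi>1] DERIV_continuous_on[OF d\<Phi>2]; assumption)+

lemma d\<kappa>: "x \<in> {0..T} \<Longrightarrow> (\<kappa> has_real_derivative \<kappa>' x) (at x within {0..T})"
  unfolding \<kappa>_def[abs_def] \<kappa>'_def
  by (rule derivative_eq_intros d\<phi>1 d\<phi>2 d\<Phi>1 d\<Phi>2 refl | simp add: algebra_simps)+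

lemma d\<kappa>': "x \<in> {0..T} \<Longrightarrow> (\<kappa>' has_real_derivative b x * \<kappa> x - 1) (at x within {0..T})"
proof -
  assume x: "x \<in> {0..T}"
  have "(\<kappa>' has_real_derivative b x * \<kappa> x - (\<phi>1 x * \<psi>2 x - \<psi>1 x * \<phi>2 x)) (at x within {0..T})"
    unfolding \<kappa>'_def[abs_def] \<kappa>_def
    by (rule derivative_eq_intros d\<psi>1 d\<psi>2 d\<Phi>1 d\<Phi>2 x refl | simp add: algebra_simps)+
  then show ?thesis using wronskian[OF x] by simp
qed

lemma c\<kappa>: "continuous_on {0..T} \<kappa>"
  by (rule DERIV_continuous_on[OF d\<kappa>])

text \<open>The solution \<open>y\<close> of \<open>y'' = b y - q\<close>, \<open>q' = g\<close> with \<open>y = y' = q = 0\<close> at \<open>0\<close>: variation of constants,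
  where the iterated integral of \<open>g\<close> has been integrated by parts.\<close>

definition Volterra :: "(real \<Rightarrow> complex) \<Rightarrow> real \<Rightarrow> complex" where
  "Volterra g x = \<kappa> x *\<^sub>R weighted_integral (\<lambda>_. 1) g x + \<phi>2 x *\<^sub>R weighted_integral \<Phi>1 g x
     - \<phi>1 x *\<^sub>R weighted_integral \<Phi>2 g x"

definition Volterra' :: "(real \<Rightarrow> complex) \<Rightarrow> real \<Rightarrow> complex" where
  "Volterra' g x = \<kappa>' x *\<^sub>R weighted_integral (\<lambda>_. 1) g x + \<psi>2 x *\<^sub>R weighted_integral \<Phi>1 g x
     - \<psi>1 x *\<^sub>R weighted_integral \<Phi>2 g x"

lemma Volterra_0 [simp]: "Volterra g 0 = 0" "Volterra' g 0 = 0"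
  by (simp_all add: Volterra_def Volterra'_def)

lemma Volterra_deriv:
  assumes g: "continuous_on {0..T} g" and x: "x \<in> {0..T}"
  shows "(Volterra g has_vector_derivative Volterra' g x) (at x within {0..T})"
    and "(Volterra' g has_vector_derivative b x *\<^sub>R Volterra g x - weighted_integral (\<lambda>_. 1) g x) (at x within {0..T})"
proof -
  note wi = weighted_integral_deriv[OF _ g x]
  have 1: "(weighted_integral (\<lambda>_. 1) g has_vector_derivative g x) (at x within {0..T})"
    using wi[of "\<lambda>_. 1"] by simp
  note 2 = wi[OF c\<Phi>1] wi[OF c\<Phi>2]
  show "(Volterra g has_vector_derivative Volterra' g x) (at x within {0..T})"
    using has_vector_derivative_diff[OF has_vector_derivative_add[OF
        has_vector_derivative_scaleR[OF d\<kappa>[OF x] 1] has_vector_derivative_scaleR[OF d\<phi>2[OF x] 2(1)]]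
        has_vector_derivative_scaleR[OF d\<phi>1[OF x] 2(2)]]
    unfolding Volterra_def[abs_def] Volterra'_def
    by (simp add: \<kappa>_def algebra_simps)
  show "(Volterra' g has_vector_derivative b x *\<^sub>R Volterra g x - weighted_integral (\<lambda>_. 1) g x) (at x within {0..T})"
    using has_vector_derivative_diff[OF has_vector_derivative_add[OF
        has_vector_derivative_scaleR[OF d\<kappa>'[OF x] 1] has_vector_derivative_scaleR[OF d\<psi>2[OF x] 2(1)]]
        has_vector_derivative_scaleR[OF d\<psi>1[OF x] 2(2)]]
    unfolding Volterra'_def[abs_def] Volterra_def
    by (simp add: \<kappa>'_def algebra_simps)
qed

lemma Volterra_cont: "continuous_on {0..T} g \<Longrightarrow> continuous_on {0..T} (Volterra g)"
  using Volterra_deriv(1) by (meson continuous_on_vector_derivative)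

lemma Volterra_bound:
  obtains C where "0 < C" "\<And>g N x. continuous_on {0..T} g \<Longrightarrow> (\<And>t. t \<in> {0..T} \<Longrightarrow> cmod (g t) \<le> N) \<Longrightarrow>
    x \<in> {0..T} \<Longrightarrow> cmod (Volterra g x) \<le> C * N"
proof -
  have bdd: "\<exists>K. \<forall>x\<in>{0..T}. \<bar>h x\<bar> \<le> K" if "continuous_on {0..T} h" for h :: "real \<Rightarrow> real"
    using compact_imp_bounded[OF compact_continuous_image[OF that compact_Icc]] unfolding bounded_real by blast
  obtain K1 K2 K3 K4 K5 where K: "\<And>x. x \<in> {0..T} \<Longrightarrow> \<bar>\<kappa> x\<bar> \<le> K1" "\<And>x. x \<in> {0..T} \<Longrightarrow> \<bar>\<phi>1 x\<bar> \<le> K2"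
    "\<And>x. x \<in> {0..T} \<Longrightarrow> \<bar>\<phi>2 x\<bar> \<le> K3" "\<And>x. x \<in> {0..T} \<Longrightarrow> \<bar>\<Phi>1 x\<bar> \<le> K4" "\<And>x. x \<in> {0..T} \<Longrightarrow> \<bar>\<Phi>2 x\<bar> \<le> K5"
    using bdd[OF c\<kappa>] bdd[OF c\<phi>1] bdd[OF c\<phi>2] bdd[OF c\<Phi>1] bdd[OF c\<Phi>2] by metis
  have T0: "0 \<in> {0..T}" using T by simp
  have K0: "0 \<le> K1" "0 \<le> K2" "0 \<le> K3" "0 \<le> K4" "0 \<le> K5"
    using K(1)[OF T0] K(2)[OF T0] K(3)[OF T0] K(4)[OF T0] K(5)[OF T0] by linarith+
  define C where "C = 1 + (K1 * (T * 1) + K3 * (T * K4) + K2 * (T * K5))"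
  have "0 \<le> K1 * (T * 1) + K3 * (T * K4) + K2 * (T * K5)" using K0 T by simp
  then have C: "0 < C" by (simp add: C_def)
  moreover have "cmod (Volterra g x) \<le> C * N"
    if g: "continuous_on {0..T} g" and N: "\<And>t. t \<in> {0..T} \<Longrightarrow> cmod (g t) \<le> N" and x: "x \<in> {0..T}" for g N x
  proof -
    have N0: "0 \<le> N" using N[OF x] by (meson norm_ge_zero order_trans)
    note wb = weighted_integral_bound[OF _ g x _ N]
    have "cmod (Volterra g x) \<le> cmod (\<kappa> x *\<^sub>R weighted_integral (\<lambda>_. 1) g x)
        + cmod (\<phi>2 x *\<^sub>R weighted_integral \<Phi>1 g x) + cmod (\<phi>1 x *\<^sub>R weighted_integral \<Phi>2 g x)"
      unfolding Volterra_def by (meson norm_triangle_ineq norm_triangle_ineq4 add_right_mono order_trans)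
    also have "\<dots> \<le> K1 * (T * 1 * N) + K3 * (T * K4 * N) + K2 * (T * K5 * N)"
      unfolding norm_scaleR
      by (intro add_mono mult_mono K x wb c\<Phi>1 c\<Phi>2 K0) auto
    also have "\<dots> = (K1 * (T * 1) + K3 * (T * K4) + K2 * (T * K5)) * N" by (simp add: algebra_simps)
    also have "\<dots> \<le> C * N" using N0 by (simp add: C_def mult_right_mono)
    finally show ?thesis .
  qed
  ultimately show ?thesis using that by blast
qed

text \<open>The reciprocal of a bound for \<open>Volterra\<close> in the supremum norm. It is chosen
  once, independently of g, so that the three solutions built later live on the same disc.\<close>

definition radius :: real where
  "radius = (SOME \<rho>. 0 < \<rho> \<and> (\<forall>g N x. continuous_on {0..T} g \<longrightarrow> (\<forall>t\<in>{0..T}. cmod (g t) \<le> N) \<longrightarrow>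
    x \<in> {0..T} \<longrightarrow> cmod (Volterra g x) \<le> N / \<rho>))"

lemma radius: "0 < radius"
  "continuous_on {0..T} g \<Longrightarrow> (\<And>t. t \<in> {0..T} \<Longrightarrow> cmod (g t) \<le> N) \<Longrightarrow> x \<in> {0..T} \<Longrightarrow>
    cmod (Volterra g x) \<le> N / radius"
proof -
  obtain C where C: "0 < C" "\<And>g N x. continuous_on {0..T} g \<Longrightarrow> (\<And>t. t \<in> {0..T} \<Longrightarrow> cmod (g t) \<le> N) \<Longrightarrow>
    x \<in> {0..T} \<Longrightarrow> cmod (Volterra g x) \<le> C * N" by (rule Volterra_bound) blast
  have "0 < 1 / C \<and> (\<forall>g N x. continuous_on {0..T} g \<longrightarrow> (\<forall>t\<in>{0..T}. cmod (g t) \<le> N) \<longrightarrow>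
    x \<in> {0..T} \<longrightarrow> cmod (Volterra g x) \<le> N / (1 / C))"
    using C by (auto simp: mult.commute)
  then have *: "0 < radius \<and> (\<forall>g N x. continuous_on {0..T} g \<longrightarrow> (\<forall>t\<in>{0..T}. cmod (g t) \<le> N) \<longrightarrow>
    x \<in> {0..T} \<longrightarrow> cmod (Volterra g x) \<le> N / radius)"
    unfolding radius_def by (rule someI)
  show "0 < radius" using * by blast
  show "continuous_on {0..T} g \<Longrightarrow> (\<And>t. t \<in> {0..T} \<Longrightarrow> cmod (g t) \<le> N) \<Longrightarrow> x \<in> {0..T} \<Longrightarrow>
    cmod (Volterra g x) \<le> N / radius" using * by blast
qed

text \<open>The Neumann series for the inverse of \<open>1 - \<mu> * Volterra\<close>, applied to
  g.\<close>

definition resolvent :: "(real \<Rightarrow> complex) \<Rightarrow> complex \<Rightarrow> real \<Rightarrow> complex" where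
  "resolvent g \<mu> x = (\<Sum>n. \<mu> ^ n * (Volterra ^^ n) g x)"

context
  fixes g :: "real \<Rightarrow> complex"
  assumes g: "continuous_on {0..T} g"
begin

lemma iterate_cont: "continuous_on {0..T} ((Volterra ^^ n) g)"
  by (induction n) (auto intro: g Volterra_cont)

lemma iterate_bound: obtains N where "\<And>n x. x \<in> {0..T} \<Longrightarrow> cmod ((Volterra ^^ n) g x) \<le> N * (1 / radius) ^ n"
proof -
  have "bounded (g ` {0..T})" by (intro compact_imp_bounded compact_continuous_image g) simp
  then obtain N where N: "\<forall>x\<in>{0..T}. cmod (g x) \<le> N" by (auto simp: bounded_iff)
  have "cmod ((Volterra ^^ n) g x) \<le> N * (1 / radius) ^ n" if "x \<in> {0..T}" for n x
    using that
  proof (induction n arbitrary: x)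
    case (Suc n)
    then show ?case using radius(2)[OF iterate_cont Suc.IH] by simp
  qed (use N in simp)
  then show ?thesis using that by blast
qed

lemma ball_radius: "\<mu> \<in> ball 0 radius \<Longrightarrow> cmod \<mu> * (1 / radius) < 1" "0 \<le> 1 / radius"
  using radius(1) by (simp_all add: divide_less_eq)

lemma resolvent_cont:
  assumes "\<mu> \<in> ball 0 radius"
  shows "continuous_on {0..T} (resolvent g \<mu>)"
proof -
  obtain N where "\<And>n x. x \<in> {0..T} \<Longrightarrow> cmod ((Volterra ^^ n) g x) \<le> N * (1 / radius) ^ n" by (rule iterate_bound) blast
  then show ?thesis
    unfolding resolvent_def[abs_def]
    by (intro uniform_limit_theorem[OF _ geometric_series_uniform_limit(1)[OF _ ball_radius(2) ball_radius(1)[OF assms]]])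
       (auto intro!: always_eventually continuous_intros iterate_cont)
qed

lemma resolvent_weighted_integral_sums:
  assumes "\<mu> \<in> ball 0 radius" "continuous_on {0..T} k" "x \<in> {0..T}"
  shows "(\<lambda>n. \<mu> ^ n * weighted_integral k ((Volterra ^^ n) g) x) sums weighted_integral k (resolvent g \<mu>) x"
proof -
  obtain N where "\<And>n x. x \<in> {0..T} \<Longrightarrow> cmod ((Volterra ^^ n) g x) \<le> N * (1 / radius) ^ n" by (rule iterate_bound) blast
  then show ?thesis
    unfolding resolvent_def[abs_def]
    by (intro weighted_integral_series[OF _ ball_radius(2) ball_radius(1)[OF assms(1)] iterate_cont assms(2,3)]) auto
qed

lemma resolvent_holomorphic:
  assumes "continuous_on {0..T} k" "x \<in> {0..T}"
  shows "(\<lambda>\<mu>. weighted_integral k (resolvent g \<mu>) x) holomorphic_on ball 0 radius"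
  using resolvent_weighted_integral_sums[OF _ assms]
  by (intro power_series_holomorphic[where a = "\<lambda>n. weighted_integral k ((Volterra ^^ n) g) x"]) (auto simp: mult.commute)

text \<open>At each x, \<open>Volterra\<close> is a fixed combination of three weighted integrals,
  so it passes through the series term by term; shifting the index then gives the equation.\<close>

lemma resolvent_eq:
  assumes \<mu>: "\<mu> \<in> ball 0 radius" and x: "x \<in> {0..T}"
  shows "resolvent g \<mu> x = g x + \<mu> * Volterra (resolvent g \<mu>) x"
proof -
  obtain N where N: "\<And>n x. x \<in> {0..T} \<Longrightarrow> cmod ((Volterra ^^ n) g x) \<le> N * (1 / radius) ^ n" by (rule iterate_bound) blast
  note sums = resolvent_weighted_integral_sums[OF \<mu> _ x]
  have "(\<lambda>n. \<kappa> x *\<^sub>R (\<mu> ^ n * weighted_integral (\<lambda>_. 1) ((Volterra ^^ n) g) x)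
      + \<phi>2 x *\<^sub>R (\<mu> ^ n * weighted_integral \<Phi>1 ((Volterra ^^ n) g) x)
      - \<phi>1 x *\<^sub>R (\<mu> ^ n * weighted_integral \<Phi>2 ((Volterra ^^ n) g) x)) sums Volterra (resolvent g \<mu>) x"
    unfolding Volterra_def[of "resolvent g \<mu>"]
    by (intro sums_add sums_diff sums_scaleR_right sums c\<Phi>1 c\<Phi>2) auto
  then have "(\<lambda>n. \<mu> ^ n * (Volterra ^^ Suc n) g x) sums Volterra (resolvent g \<mu>) x"
    by (simp add: Volterra_def[of "(Volterra ^^ _) g"] scaleR_conv_of_real algebra_simps)
  then have "(\<lambda>n. \<mu> * (\<mu> ^ n * (Volterra ^^ Suc n) g x)) sums (\<mu> * Volterra (resolvent g \<mu>) x)"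
    by (rule sums_mult)
  then have "(\<lambda>n. \<mu> ^ Suc n * (Volterra ^^ Suc n) g x) sums (\<mu> * Volterra (resolvent g \<mu>) x)"
    by (simp add: mult.assoc)
  then have "(\<lambda>n. \<mu> ^ n * (Volterra ^^ n) g x) sums (\<mu> * Volterra (resolvent g \<mu>) x + \<mu> ^ 0 * (Volterra ^^ 0) g x)"
    by (rule sums_Suc)
  then show ?thesis
    unfolding resolvent_def[of g \<mu> x] by (simp add: sums_unique[symmetric] add.commute)
qed

lemma resolvent_0: "x \<in> {0..T} \<Longrightarrow> resolvent g 0 x = g x"
  using resolvent_eq[of 0 x] radius(1) by simp

end

end

section \<open>Bounded solutions and the spectrum\<close>

lemma integrable_compact_support:
  fixes g :: "real \<Rightarrow> 'a :: {banach, second_countable_topology}"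
  assumes "continuous_on UNIV g" "\<And>x. R \<le> \<bar>x\<bar> \<Longrightarrow> g x = 0"
  shows "integrable lborel g"
proof -
  have "set_integrable lborel {-R..R} g"
    by (intro borel_integrable_atLeastAtMost' continuous_on_subset[OF assms(1)]) auto
  moreover have "indicator {-R..R} x *\<^sub>R g x = g x" for x
    using assms(2)[of x] by (cases "x \<in> {-R..R}") auto
  ultimately show ?thesis by (simp add: set_integrable_def)
qed

text \<open>The test function may be non-zero at \<open>-R\<close> and \<open>R\<close>; the
  boundary terms of the integration by parts vanish because v does.\<close>

lemma has_L2_weak_deriv_compact_support:
  fixes v w :: "real \<Rightarrow> complex"
  assumes d: "\<And>x. (v has_vector_derivative w x) (at x)"
    and cw: "continuous_on UNIV w"
    and supp: "\<And>x. R \<le> \<bar>x\<bar> \<Longrightarrow> v x = 0" "\<And>x. R \<le> \<bar>x\<bar> \<Longrightarrow> w x = 0"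
    and R: "0 \<le> R"
  shows "has_L2_weak_deriv v w"
proof -
  have cv: "continuous_on UNIV v"
    by (meson continuous_at_imp_continuous_on has_vector_derivative_continuous d)
  have L2: "g \<in> L2" if "continuous_on UNIV g" "\<And>x. R \<le> \<bar>x\<bar> \<Longrightarrow> g x = 0" for g :: "real \<Rightarrow> complex"
    unfolding L2_def mem_Collect_eq
  proof
    show "g \<in> borel_measurable lborel"
      using that(1) by (simp add: borel_measurable_continuous_onI)
    show "integrable lborel (\<lambda>x. (cmod (g x))\<^sup>2)"
      by (rule integrable_compact_support[where R = R]) (use that in \<open>auto intro!: continuous_intros\<close>)
  qed
  have "(LINT x|lborel. deriv \<phi> x *\<^sub>R v x) = - (LINT x|lborel. \<phi> x *\<^sub>R w x)" if "test_function \<phi>" for \<phi>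
  proof -
    have C: "C_k_real 1 \<phi>" using that unfolding test_function_def by blast
    then have d\<phi>: "(\<phi> has_real_derivative deriv \<phi> x) (at x)" for x
      unfolding C_k_real_def by (auto simp: differentiable_on_def DERIV_deriv_iff_real_differentiable)
    have c\<phi>: "continuous_on UNIV \<phi>" "continuous_on UNIV (deriv \<phi>)"
      using C d\<phi> unfolding C_k_real_def by (auto intro: DERIV_continuous_on)
    have i: "integrable lborel (\<lambda>x. deriv \<phi> x *\<^sub>R v x)" "integrable lborel (\<lambda>x. \<phi> x *\<^sub>R w x)"
      by (rule integrable_compact_support[where R = R]; use supp in \<open>auto intro!: continuous_intros c\<phi> cv cw\<close>)+
    have "(LINT x|lborel. deriv \<phi> x *\<^sub>R v x) + (LINT x|lborel. \<phi> x *\<^sub>R w x)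
        = (LINT x|lborel. \<phi> x *\<^sub>R w x + deriv \<phi> x *\<^sub>R v x)"
      using i by simp
    also have "\<dots> = (LINT x|lborel. indicator {-R..R} x *\<^sub>R (\<phi> x *\<^sub>R w x + deriv \<phi> x *\<^sub>R v x))"
      by (rule arg_cong[where f = "integral\<^sup>L lborel"]) (use supp in \<open>force simp: indicator_def\<close>)
    also have "\<dots> = \<phi> R *\<^sub>R v R - \<phi> (-R) *\<^sub>R v (-R)"
    proof (rule integral_FTC_atLeastAtMost)
      fix x
      have "((\<lambda>x. \<phi> x *\<^sub>R v x) has_vector_derivative \<phi> x *\<^sub>R w x + deriv \<phi> x *\<^sub>R v x) (at x)"
        by (intro has_vector_derivative_scaleR d\<phi> d)
      then show "((\<lambda>x. \<phi> x *\<^sub>R v x) has_vector_derivative \<phi> x *\<^sub>R w x + deriv \<phi> x *\<^sub>R v x) (at x within {-R..R})"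
        by (rule has_vector_derivative_at_within)
    qed (use R in \<open>auto intro!: continuous_intros continuous_on_subset[OF c\<phi>(1)] continuous_on_subset[OF c\<phi>(2)]
          continuous_on_subset[OF cv] continuous_on_subset[OF cw]\<close>)
    also have "\<dots> = 0" using supp R by simp
    finally show ?thesis by (simp add: eq_neg_iff_add_eq_0)
  qed
  then show ?thesis
    unfolding has_L2_weak_deriv_def using L2 cv cw supp by blast
qed

lemma max_power_deriv:
  assumes "2 \<le> k"
  shows "((\<lambda>x. max 0 x ^ k) has_real_derivative real k * max 0 x ^ (k - 1)) (at x)"
proof -
  have "((\<lambda>x. if x \<in> {..0} then 0 else x ^ k) has_vector_derivative
      (if x \<in> {..0} then 0 else real k * x ^ (k - 1))) (at x within UNIV)"
  proof (rule has_vector_derivative_If_within_closures[where T = "{0..}"])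
    show "((\<lambda>x. x ^ k) has_vector_derivative real k * x ^ (k - 1)) (at x within {0..} \<union> closure {..0} \<inter> closure {0..})"
      unfolding has_real_derivative_iff_has_vector_derivative[symmetric]
      by (rule derivative_eq_intros refl | simp)+
  qed (use assms in \<open>auto simp: closure_closed power_0_left\<close>)
  moreover have "(if x \<in> {..0} then 0 else x ^ k) = max 0 x ^ k" for x :: real
    using assms by (auto simp: max_def power_0_left)
  moreover have "(if x \<in> {..0} then 0 else real k * x ^ (k - 1)) = real k * max 0 x ^ (k - 1)"
    using assms by (auto simp: max_def power_0_left)
  ultimately show ?thesis by (simp add: has_real_derivative_iff_has_vector_derivative)
qed

text \<open>The positive part of 1 - x^2 is raised to the fourth power: after three derivatives one
  factor of it is left, so the third derivative is continuous. Three derivatives fall on the cutoff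
  because the operator has order three.\<close>

lemma C3_cutoff:
  obtains \<chi>0 \<chi>1 \<chi>2 \<chi>3 :: "real \<Rightarrow> real" and C :: real where
    "\<And>x. (\<chi>0 has_real_derivative \<chi>1 x) (at x)" "\<And>x. (\<chi>1 has_real_derivative \<chi>2 x) (at x)"
    "\<And>x. (\<chi>2 has_real_derivative \<chi>3 x) (at x)" "continuous_on UNIV \<chi>3"
    "\<And>x. 1 \<le> \<bar>x\<bar> \<Longrightarrow> \<chi>0 x = 0 \<and> \<chi>1 x = 0 \<and> \<chi>2 x = 0 \<and> \<chi>3 x = 0"
    "\<And>x. \<bar>\<chi>0 x\<bar> \<le> C \<and> \<bar>\<chi>1 x\<bar> \<le> C \<and> \<bar>\<chi>2 x\<bar> \<le> C \<and> \<bar>\<chi>3 x\<bar> \<le> C" "\<chi>0 0 = 1"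
proof -
  define e where "e x = max 0 (1 - x\<^sup>2)" for x :: real
  have de: "((\<lambda>x. e x ^ k) has_real_derivative real k * e x ^ (k - 1) * (- 2 * x)) (at x)" if "2 \<le> k" for k x
    unfolding e_def by (rule DERIV_chain2[OF max_power_deriv[OF that]]) (auto intro!: derivative_eq_intros)
  have de2: "((\<lambda>x. (e x)\<^sup>2) has_real_derivative 2 * e x * (- 2 * x)) (at x)" for x
    using de[of 2 x] by simp
  have de3: "((\<lambda>x. e x ^ 3) has_real_derivative 3 * (e x)\<^sup>2 * (- 2 * x)) (at x)" for x
    using de[of 3 x] by simp
  have de4: "((\<lambda>x. e x ^ 4) has_real_derivative 4 * e x ^ 3 * (- 2 * x)) (at x)" for x
    using de[of 4 x] by simp
  have ce: "continuous_on UNIV e" unfolding e_def by (intro continuous_intros)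
  define cuts where "cuts = [\<lambda>x. e x ^ 4, \<lambda>x. - 8 * x * e x ^ 3, \<lambda>x. 48 * x\<^sup>2 * (e x)\<^sup>2 - 8 * e x ^ 3,
      \<lambda>x. 144 * x * (e x)\<^sup>2 - 192 * x ^ 3 * e x]"
  have cont: "continuous_on UNIV g" if "g \<in> set cuts" for g
    using that unfolding cuts_def by (auto intro!: continuous_intros ce)
  have supp: "g x = 0" if "g \<in> set cuts" "1 \<le> \<bar>x\<bar>" for g x
  proof -
    have "1 \<le> x\<^sup>2" using that(2) by (simp add: abs_le_square_iff[of 1 x, simplified])
    then show ?thesis using that(1) unfolding cuts_def by (auto simp: e_def)
  qed
  have "\<exists>C. \<forall>x. \<bar>g x\<bar> \<le> C" if g: "g \<in> set cuts" for g
  proof -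
    have "compact (g ` {-1..1})"
      by (intro compact_continuous_image continuous_on_subset[OF cont[OF g]]) auto
    then obtain C where C: "\<And>x. x \<in> {-1..1} \<Longrightarrow> \<bar>g x\<bar> \<le> C"
      by (metis bounded_real compact_imp_bounded imageI)
    have "\<bar>g x\<bar> \<le> max 0 C" for x
      using C[of x] supp[OF g, of x] by (cases "x \<in> {-1..1}") (auto simp: le_max_iff_disj)
    then show ?thesis by blast
  qed
  then obtain C where C: "\<And>g x. g \<in> set cuts \<Longrightarrow> \<bar>g x\<bar> \<le> C g" by metis
  define C' where "C' = Max (C ` set cuts)"
  have C': "\<bar>g x\<bar> \<le> C'" if "g \<in> set cuts" for g x
    unfolding C'_def using C[OF that] that by (meson Max_ge List.finite_set finite_imageI imageI order_trans)
  have mem: "(\<lambda>x. e x ^ 4) \<in> set cuts" "(\<lambda>x. - 8 * x * e x ^ 3) \<in> set cuts"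
    "(\<lambda>x. 48 * x\<^sup>2 * (e x)\<^sup>2 - 8 * e x ^ 3) \<in> set cuts"
    "(\<lambda>x. 144 * x * (e x)\<^sup>2 - 192 * x ^ 3 * e x) \<in> set cuts"
    unfolding cuts_def by (intro list.set_intros)+
  show ?thesis
  proof (rule that[of "\<lambda>x. e x ^ 4" "\<lambda>x. - 8 * x * e x ^ 3" "\<lambda>x. 48 * x\<^sup>2 * (e x)\<^sup>2 - 8 * e x ^ 3"
      "\<lambda>x. 144 * x * (e x)\<^sup>2 - 192 * x ^ 3 * e x" C'])
    fix x :: real
    show "((\<lambda>x. e x ^ 4) has_real_derivative - 8 * x * e x ^ 3) (at x)"
      using de4[of x] by (simp add: algebra_simps)
    show "((\<lambda>x. - 8 * x * e x ^ 3) has_real_derivative 48 * x\<^sup>2 * (e x)\<^sup>2 - 8 * e x ^ 3) (at x)"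
      by (rule derivative_eq_intros de3 refl | simp add: algebra_simps power2_eq_square)+
    show "((\<lambda>x. 48 * x\<^sup>2 * (e x)\<^sup>2 - 8 * e x ^ 3) has_real_derivative 144 * x * (e x)\<^sup>2 - 192 * x ^ 3 * e x) (at x)"
      by (rule derivative_eq_intros de2 de3 refl | simp add: algebra_simps power2_eq_square power3_eq_cube)+
  next
    show "e 0 ^ 4 = 1" by (simp add: e_def)
  qed (intro conjI cont supp C' mem; assumption)+
qed

text \<open>The solution is cut off at scale N. Every error term contains a derivative of the cutoff
  and thus a factor 1/N, on an interval of length 2N, so the squared norm of the error is O(1/N),
  whereas that of the cut-off solution stays above a positive constant. Hence the operator minus z
  is not bounded below.\<close>

lemma spectrum_of_bounded_solution:
  fixes y0 y1 q :: "real \<Rightarrow> complex" and u :: "real \<Rightarrow> real"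
  assumes b_cont: "continuous_on UNIV (\<lambda>x. deriv f (u x))"
    and dy: "\<And>x. (y0 has_vector_derivative y1 x) (at x)"
      "\<And>x. (y1 has_vector_derivative (of_real c - of_real (deriv f (u x))) * y0 x - q x) (at x)"
      "\<And>x. (q has_vector_derivative z * y0 x) (at x)"
    and bdd: "\<And>x. cmod (y0 x) \<le> D" "\<And>x. cmod (y1 x) \<le> D" "\<And>x. cmod (q x) \<le> D" "\<And>x. \<bar>deriv f (u x)\<bar> \<le> D"
    and nz: "y0 x0 \<noteq> 0"
  shows "z \<in> L2_spectrum (linearization f c u)"
proof -
  define b where "b x = deriv f (u x)" for x
  define y2 where "y2 x = (of_real c - of_real (b x)) * y0 x - q x" for x
  have dy1: "(y1 has_vector_derivative y2 x) (at x)" for x using dy(2) by (simp add: y2_def b_def)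
  have cy: "continuous_on S y0" "continuous_on S y1" "continuous_on S q" for S
    by (meson continuous_at_imp_continuous_on has_vector_derivative_continuous dy)+
  have cy2: "continuous_on UNIV y2" unfolding y2_def b_def by (intro continuous_intros b_cont cy)
  have D0: "0 \<le> D" using bdd(1)[of 0] by (meson norm_ge_zero order_trans)
  obtain \<chi>0 \<chi>1 \<chi>2 \<chi>3 C where
    d\<chi>: "\<And>x. (\<chi>0 has_real_derivative \<chi>1 x) (at x)" "\<And>x. (\<chi>1 has_real_derivative \<chi>2 x) (at x)"
    "\<And>x. (\<chi>2 has_real_derivative \<chi>3 x) (at x)" and c\<chi>3: "continuous_on UNIV \<chi>3"
    and supp: "\<And>x. 1 \<le> \<bar>x\<bar> \<Longrightarrow> \<chi>0 x = 0 \<and> \<chi>1 x = 0 \<and> \<chi>2 x = 0 \<and> \<chi>3 x = 0"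
    and C: "\<And>x. \<bar>\<chi>0 x\<bar> \<le> C \<and> \<bar>\<chi>1 x\<bar> \<le> C \<and> \<bar>\<chi>2 x\<bar> \<le> C \<and> \<bar>\<chi>3 x\<bar> \<le> C" and \<chi>0: "\<chi>0 0 = 1"
    by (rule C3_cutoff) blast
  have c\<chi>: "continuous_on S \<chi>0" "continuous_on S \<chi>1" "continuous_on S \<chi>2" for S
    by (meson continuous_at_imp_continuous_on DERIV_isCont d\<chi>)+
  have C0: "0 \<le> C" using C[of 0] by (meson abs_ge_zero order_trans)
  define V where "V N x = \<chi>0 (x / N) *\<^sub>R y0 x" for N x
  define V1 where "V1 N x = \<chi>0 (x / N) *\<^sub>R y1 x + (\<chi>1 (x / N) / N) *\<^sub>R y0 x" for N x
  define V2 where "V2 N x = \<chi>0 (x / N) *\<^sub>R y2 x + (2 * \<chi>1 (x / N) / N) *\<^sub>R y1 x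
      + (\<chi>2 (x / N) / N\<^sup>2) *\<^sub>R y0 x" for N x
  \<comment> \<open>\<open>Q N\<close> is L applied to \<open>V N\<close>, written with q so that
    the term \<open>f'(u)\<close> is not differentiated. \<open>Res N\<close> is what its derivative
    contains besides \<open>z * V N\<close>.\<close>
  define Q where "Q N x = \<chi>0 (x / N) *\<^sub>R q x - (2 * \<chi>1 (x / N) / N) *\<^sub>R y1 x
      - (\<chi>2 (x / N) / N\<^sup>2) *\<^sub>R y0 x" for N x
  define Res where "Res N x = (\<chi>1 (x / N) / N) *\<^sub>R q x - (3 * \<chi>2 (x / N) / N\<^sup>2) *\<^sub>R y1 x
      - (2 * \<chi>1 (x / N) / N) *\<^sub>R y2 x - (\<chi>3 (x / N) / N ^ 3) *\<^sub>R y0 x" for N x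
  define G where "G N x = z * V N x + Res N x" for N x
  have D\<chi>: "((\<lambda>x. \<chi>0 (x / N)) has_real_derivative \<chi>1 (x / N) / N) (at x)"
    "((\<lambda>x. \<chi>1 (x / N) / N) has_real_derivative \<chi>2 (x / N) / N\<^sup>2) (at x)"
    "((\<lambda>x. 2 * \<chi>1 (x / N) / N) has_real_derivative 2 * \<chi>2 (x / N) / N\<^sup>2) (at x)"
    "((\<lambda>x. \<chi>2 (x / N) / N\<^sup>2) has_real_derivative \<chi>3 (x / N) / N ^ 3) (at x)" if "1 \<le> N" for N x :: real
    using that
    by (auto intro!: derivative_eq_intros DERIV_chain2[OF d\<chi>(1), THEN DERIV_cong]
        DERIV_chain2[OF d\<chi>(2), THEN DERIV_cong] DERIV_chain2[OF d\<chi>(3), THEN DERIV_cong] simp: power2_eq_square power3_eq_cube)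
  have "(V N has_vector_derivative V1 N x) (at x)" if N: "1 \<le> N" for N x
    unfolding V_def V1_def by (intro has_vector_derivative_scaleR D\<chi>[OF N] dy)
  moreover have "(V1 N has_vector_derivative V2 N x) (at x)" if N: "1 \<le> N" for N x
    using has_vector_derivative_add[OF has_vector_derivative_scaleR[OF D\<chi>(1)[OF N] dy1]
        has_vector_derivative_scaleR[OF D\<chi>(2)[OF N] dy(1)]]
    unfolding V1_def V2_def by (simp add: algebra_simps scaleR_conv_of_real)
  moreover have "(Q N has_vector_derivative G N x) (at x)" if N: "1 \<le> N" for N x
    using has_vector_derivative_diff[OF has_vector_derivative_diff[OF
        has_vector_derivative_scaleR[OF D\<chi>(1)[OF N] dy(3)] has_vector_derivative_scaleR[OF D\<chi>(3)[OF N] dy1]]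
        has_vector_derivative_scaleR[OF D\<chi>(4)[OF N] dy(1)]]
    unfolding Q_def G_def Res_def V_def by (simp add: algebra_simps scaleR_conv_of_real)
  moreover have "- V2 N x - of_real (b x) * V N x + of_real c * V N x = Q N x" for N x
    unfolding V2_def V_def Q_def y2_def by (simp add: algebra_simps scaleR_conv_of_real)
  moreover have c\<chi>N: "continuous_on UNIV (\<lambda>x. \<chi>0 (x / N))" "continuous_on UNIV (\<lambda>x. \<chi>1 (x / N))"
    "continuous_on UNIV (\<lambda>x. \<chi>2 (x / N))" "continuous_on UNIV (\<lambda>x. \<chi>3 (x / N))" if "1 \<le> N" for N :: real
    using that by (auto intro!: continuous_intros continuous_on_compose2[OF c\<chi>(1)] continuous_on_compose2[OF c\<chi>(2)]
         continuous_on_compose2[OF c\<chi>(3)] continuous_on_compose2[OF c\<chi>3])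
  moreover have cont: "continuous_on UNIV (V N)" "continuous_on UNIV (V1 N)" "continuous_on UNIV (V2 N)"
    "continuous_on UNIV (Q N)" "continuous_on UNIV (Res N)" "continuous_on UNIV (G N)" if "1 \<le> N" for N
    unfolding V_def V1_def V2_def Q_def Res_def G_def using that
    by (intro continuous_intros c\<chi>N cy cy2; simp)+
  moreover have suppN: "V N x = 0" "V1 N x = 0" "V2 N x = 0" "Q N x = 0" "Res N x = 0" "G N x = 0"
    if "1 \<le> N" "N \<le> \<bar>x\<bar>" for N x
    using supp[of "x / N"] that unfolding V_def V1_def V2_def Q_def Res_def G_def by auto
  ultimately have mem: "(V N, G N) \<in> linearization f c u" if N: "1 \<le> N" for N
    unfolding linearization_def mem_Collect_eq case_prod_conv b_def[symmetric] using that
    by (intro exI[of _ "V1 N"] exI[of _ "V2 N"] conjI has_L2_weak_deriv_compact_support[where R = N])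
       (simp_all add: fun_eq_iff)
  define D2 where "D2 = (\<bar>c\<bar> + D) * D + D"
  have y2_le: "cmod (y2 x) \<le> D2" for x
  proof -
    have "cmod (y2 x) \<le> cmod (of_real c - of_real (b x)) * cmod (y0 x) + cmod (q x)"
      unfolding y2_def by (metis norm_mult norm_triangle_ineq4)
    also have "\<dots> \<le> (\<bar>c\<bar> + D) * D + D"
    proof (intro add_mono mult_mono bdd)
      have "cmod (of_real c - of_real (b x)) = \<bar>c - b x\<bar>" by (metis norm_of_real of_real_diff)
      also have "\<dots> \<le> \<bar>c\<bar> + D" using bdd(4)[of x] by (simp add: b_def)
      finally show "cmod (of_real c - of_real (b x)) \<le> \<bar>c\<bar> + D" .
    qed (use D0 in auto)
    finally show ?thesis by (simp add: D2_def)
  qed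
  have D20: "0 \<le> D2" using D0 by (simp add: D2_def)
  \<comment> \<open>The coefficients 1, 3, 2, 1 are those of the four terms of \<open>Res N\<close>;
    since \<open>1 \<le> N\<close>, the higher powers of 1/N are bounded by the first.\<close>
  define A where "A = C * D + 3 * C * D + 2 * C * D2 + C * D"
  have A0: "0 \<le> A" using C0 D0 D20 by (simp add: A_def)
  have Res_le: "cmod (Res N x) \<le> A / N" if N: "1 \<le> N" for N x
  proof -
    have le: "\<bar>t * X / N ^ k\<bar> * r \<le> t * C * r' / N" if "\<bar>X\<bar> \<le> C" "0 \<le> r" "r \<le> r'" "0 \<le> t" "1 \<le> k" for X t r r' :: real and k
    proof -
      have "N \<le> N ^ k" using N that(5) by (metis power_increasing power_one_right)
      then have "\<bar>t * X / N ^ k\<bar> \<le> t * C / N"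
        using N that C0 by (simp add: abs_mult) (intro frac_le mult_mono; simp)
      then have "\<bar>t * X / N ^ k\<bar> * r \<le> t * C / N * r'"
        using that C0 N by (intro mult_mono) auto
      then show ?thesis by simp
    qed
    have tri: "cmod (w1 - w2 - w3 - w4) \<le> cmod w1 + cmod w2 + cmod w3 + cmod w4" for w1 w2 w3 w4
      by norm
    have "cmod (Res N x) \<le> cmod ((\<chi>1 (x / N) / N) *\<^sub>R q x) + cmod ((3 * \<chi>2 (x / N) / N\<^sup>2) *\<^sub>R y1 x)
      + cmod ((2 * \<chi>1 (x / N) / N) *\<^sub>R y2 x) + cmod ((\<chi>3 (x / N) / N ^ 3) *\<^sub>R y0 x)"
      unfolding Res_def by (rule tri)
    also have "\<dots> = \<bar>1 * \<chi>1 (x / N) / N ^ 1\<bar> * cmod (q x) + \<bar>3 * \<chi>2 (x / N) / N ^ 2\<bar> * cmod (y1 x)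
       + \<bar>2 * \<chi>1 (x / N) / N ^ 1\<bar> * cmod (y2 x) + \<bar>1 * \<chi>3 (x / N) / N ^ 3\<bar> * cmod (y0 x)"
      by simp
    also have "\<dots> \<le> 1 * C * D / N + 3 * C * D / N + 2 * C * D2 / N + 1 * C * D / N"
      by (intro add_mono le) (use C bdd y2_le in auto)
    finally show ?thesis by (simp add: A_def add_divide_distrib)
  qed
  have Res_L2: "(L2_norm (Res N))\<^sup>2 \<le> 2 * A\<^sup>2 / N" if N: "1 \<le> N" for N
  proof -
    have "(LINT x|lborel. (cmod (Res N x))\<^sup>2) \<le> (LINT x|lborel. indicator {-N..N} x *\<^sub>R (A / N)\<^sup>2)"
    proof (rule integral_mono)
      show "integrable lborel (\<lambda>x. (cmod (Res N x))\<^sup>2)"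
        by (rule integrable_compact_support[where R = N])
           (use N suppN(5) in \<open>auto intro!: continuous_intros cont(5)\<close>)
      fix x
      show "(cmod (Res N x))\<^sup>2 \<le> indicator {-N..N} x *\<^sub>R (A / N)\<^sup>2"
        using Res_le[OF N, of x] suppN(5)[OF N, of x] by (cases "x \<in> {-N..N}") (auto intro: power_mono)
    qed (intro integrable_scaleR_left integrable_real_indicator; use N in simp)
    also have "\<dots> = 2 * N * (A / N)\<^sup>2" using N by simp
    also have "\<dots> = 2 * A\<^sup>2 / N" using N by (simp add: power2_eq_square)
    finally show ?thesis by (simp add: L2_norm_def)
  qed
  define \<eta> where "\<eta> = cmod (y0 x0) / 2"
  have \<eta>: "0 < \<eta>" using nz by (simp add: \<eta>_def)
  have "isCont y0 x0" using dy(1) has_vector_derivative_continuous by blast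
  then obtain \<delta> where \<delta>: "\<delta> > 0" "\<And>x. dist x x0 < \<delta> \<Longrightarrow> dist (y0 x) (y0 x0) < \<eta>"
    using \<eta> unfolding continuous_at_eps_delta by blast
  have y0_ge: "\<eta> \<le> cmod (y0 x)" if "dist x x0 < \<delta>" for x
  proof -
    have "cmod (y0 x0) \<le> cmod (y0 x) + dist (y0 x) (y0 x0)"
      by (metis dist_norm norm_triangle_sub norm_minus_commute)
    then show ?thesis using \<delta>(2)[OF that] unfolding \<eta>_def by simp
  qed
  have "isCont \<chi>0 0" using d\<chi>(1) DERIV_isCont by blast
  then obtain \<delta>' where \<delta>': "\<delta>' > 0" "\<And>x. dist x 0 < \<delta>' \<Longrightarrow> dist (\<chi>0 x) 1 < 1/2"
    unfolding continuous_at_eps_delta \<chi>0 using half_gt_zero zero_less_one by blast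
  \<comment> \<open>For N at least \<open>N0\<close>, scaling by 1/N brings the interval between
    \<open>x0\<close> and \<open>x0 + \<delta>\<close> into the region where \<chi>0 exceeds
    1/2.\<close>
  define N0 where "N0 = max 1 ((\<bar>x0\<bar> + \<delta>) / \<delta>' + 1)"
  have V_L2: "\<delta> * (\<eta> / 2)\<^sup>2 \<le> (L2_norm (V N))\<^sup>2" if N: "N0 \<le> N" for N
  proof -
    have N1: "1 \<le> N" using N by (simp add: N0_def)
    have "(\<bar>x0\<bar> + \<delta>) / \<delta>' < N" using N unfolding N0_def by simp
    then have N\<delta>: "\<bar>x0\<bar> + \<delta> < N * \<delta>'" using \<delta>'(1) by (simp add: field_simps)
    have "\<delta> * (\<eta> / 2)\<^sup>2 = (LINT x|lborel. indicator {x0..x0+\<delta>} x *\<^sub>R (\<eta> / 2)\<^sup>2)" using \<delta>(1) by simp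
    \<comment> \<open>The right endpoint is dropped because the lower bound on \<open>y0\<close>
      holds at distances strictly below \<delta>.\<close>
    also have "\<dots> = (LINT x|lborel. indicator {x0..<x0+\<delta>} x *\<^sub>R (\<eta> / 2)\<^sup>2)" using \<delta>(1) by simp
    also have "\<dots> \<le> (LINT x|lborel. (cmod (V N x))\<^sup>2)"
    proof (rule integral_mono)
      show "integrable lborel (\<lambda>x. (cmod (V N x))\<^sup>2)"
        by (rule integrable_compact_support[where R = N])
           (use N1 suppN(1) in \<open>auto intro!: continuous_intros cont(1)\<close>)
      fix x
      show "indicator {x0..<x0+\<delta>} x *\<^sub>R (\<eta> / 2)\<^sup>2 \<le> (cmod (V N x))\<^sup>2"
      proof (cases "x \<in> {x0..<x0+\<delta>}")
        case True
        then have "\<bar>x\<bar> < N * \<delta>'" "dist x x0 < \<delta>" using N\<delta> by (auto simp: dist_real_def)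
        then have "dist (x / N) 0 < \<delta>'" "\<eta> \<le> cmod (y0 x)" using N1 y0_ge by (auto simp: field_simps)
        then have "1/2 * \<eta> \<le> \<bar>\<chi>0 (x / N)\<bar> * cmod (y0 x)"
          using \<delta>'(2)[of "x / N"] \<eta> by (intro mult_mono) (auto simp: dist_real_def abs_if split: if_splits)
        then have "\<eta> / 2 \<le> cmod (V N x)" by (simp add: V_def)
        then show ?thesis using True \<eta> by (auto intro: power_mono)
      qed simp
    qed (intro integrable_scaleR_left integrable_real_indicator; use \<delta>(1) in simp)
    finally show ?thesis by (simp add: L2_norm_def)
  qed
  have False if K: "\<forall>(v, g)\<in>linearization f c u. L2_norm v \<le> K * L2_norm (\<lambda>x. g x - z * v x)" for K
  proof -
    have "\<delta> * (\<eta> / 2)\<^sup>2 * N \<le> K\<^sup>2 * (2 * A\<^sup>2)" if N: "N0 \<le> N" for N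
    proof -
      have N1: "1 \<le> N" using N by (simp add: N0_def)
      have "L2_norm (V N) \<le> K * L2_norm (Res N)"
        using bspec[OF K mem[OF N1]] by (simp add: G_def)
      then have "(L2_norm (V N))\<^sup>2 \<le> (K * L2_norm (Res N))\<^sup>2"
        by (intro power_mono) (auto simp: L2_norm_def)
      also have "\<dots> \<le> K\<^sup>2 * (2 * A\<^sup>2 / N)"
        unfolding power_mult_distrib by (intro mult_left_mono Res_L2 N1) auto
      finally have "\<delta> * (\<eta> / 2)\<^sup>2 \<le> K\<^sup>2 * (2 * A\<^sup>2 / N)" using V_L2[OF N] by simp
      then show ?thesis using N1 by (simp add: field_simps)
    qed
    moreover have pos: "0 < \<delta> * (\<eta> / 2)\<^sup>2" using \<delta>(1) \<eta> by simp
    moreover obtain N where "N0 \<le> N" "K\<^sup>2 * (2 * A\<^sup>2) / (\<delta> * (\<eta> / 2)\<^sup>2) < N"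
      by (meson gt_ex less_imp_le max.bounded_iff max.strict_boundedE)
    ultimately show False by (simp add: divide_less_eq) (smt (verit) mult.commute)
  qed
  then show ?thesis unfolding L2_spectrum_def by blast
qed

section \<open>Floquet solutions\<close>

lemma has_vector_derivative_Un:
  assumes "(f has_vector_derivative D) (at x within A)" "(f has_vector_derivative D) (at x within B)"
  shows "(f has_vector_derivative D) (at x within A \<union> B)"
  using assms unfolding has_vector_derivative_def has_derivative_within by (auto simp: at_within_union intro: filterlim_sup)

definition quasi_periodic_extension :: "real \<Rightarrow> complex \<Rightarrow> (real \<Rightarrow> complex) \<Rightarrow> real \<Rightarrow> complex" where
  "quasi_periodic_extension T \<rho> y x = \<rho> powi \<lfloor>x / T\<rfloor> * y (x - T * of_int \<lfloor>x / T\<rfloor>)"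

context
  fixes T :: real and \<rho> :: complex
  assumes T: "0 < T" and \<rho>: "cmod \<rho> = 1"
begin

lemma floor_remainder: "x - T * of_int \<lfloor>x / T\<rfloor> \<in> {0..<T}"
proof -
  have "T * of_int \<lfloor>x / T\<rfloor> \<le> x"
    using T by (metis mult.commute of_int_floor_le pos_le_divide_eq)
  moreover have "x / T < of_int \<lfloor>x / T\<rfloor> + 1" by linarith
  then have "x < T * of_int \<lfloor>x / T\<rfloor> + T" using T by (simp add: field_simps)
  ultimately show ?thesis by simp
qed

text \<open>The floor assigns the right endpoint of a cell to the next cell. The Floquet condition
  makes the two formulas agree there, so one formula holds on the closed cell, as derivatives within
  a cell require.\<close>

lemma quasi_periodic_extension_segment:
  assumes "y T = \<rho> * y 0" and x: "x \<in> {T * of_int i..T * of_int i + T}"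
  shows "quasi_periodic_extension T \<rho> y x = \<rho> powi i * y (x - T * of_int i)"
proof (cases "x = T * of_int i + T")
  case True
  then have "x / T = of_int (i + 1)" using T by (simp add: field_simps)
  then have "\<lfloor>x / T\<rfloor> = i + 1" by (metis floor_of_int)
  moreover have "\<rho> \<noteq> 0" using \<rho> by auto
  ultimately show ?thesis
    using assms(1) True by (simp add: quasi_periodic_extension_def power_int_add algebra_simps)
next
  case False
  then have "of_int i \<le> x / T" "x / T < of_int i + 1" using x T by (auto simp: field_simps)
  then have "\<lfloor>x / T\<rfloor> = i" by linarith
  then show ?thesis by (simp add: quasi_periodic_extension_def)
qed

lemma quasi_periodic_extension_deriv:
  assumes d: "\<And>x. x \<in> {0..T} \<Longrightarrow> (y has_vector_derivative y' x) (at x within {0..T})"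
    and y: "y T = \<rho> * y 0" and y': "y' T = \<rho> * y' 0"
  shows "(quasi_periodic_extension T \<rho> y has_vector_derivative quasi_periodic_extension T \<rho> y' x) (at x)"
proof -
  let ?I = "\<lambda>i. {T * of_int i..T * of_int i + T}"
  have within: "(quasi_periodic_extension T \<rho> y has_vector_derivative quasi_periodic_extension T \<rho> y' x) (at x within ?I i)"
    if x: "x \<in> ?I i" for i
  proof -
    have "((\<lambda>t. t - T * of_int i) has_vector_derivative 1) (at x within ?I i)"
      by (auto intro!: derivative_eq_intros)
    moreover have "(\<lambda>t. t - T * of_int i) ` ?I i \<subseteq> {0..T}" by auto
    moreover have "x - T * of_int i \<in> {0..T}" using x by auto
    ultimately have "((\<lambda>t. y (t - T * of_int i)) has_vector_derivative y' (x - T * of_int i)) (at x within ?I i)"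
      using vector_diff_chain_within[of "\<lambda>t. t - T * of_int i" 1 x "?I i" y "y' (x - T * of_int i)"]
        has_vector_derivative_within_subset[OF d] by (fastforce simp: o_def)
    then have "((\<lambda>t. \<rho> powi i * y (t - T * of_int i)) has_vector_derivative \<rho> powi i * y' (x - T * of_int i)) (at x within ?I i)"
      by (rule has_vector_derivative_mult_right)
    then show ?thesis
      unfolding quasi_periodic_extension_segment[of y', OF y' x]
      by (rule has_vector_derivative_transform[OF x, rotated])
         (use quasi_periodic_extension_segment[of y, OF y] in auto)
  qed
  let ?i = "\<lfloor>x / T\<rfloor>"
  have x: "T * of_int ?i \<le> x" "x < T * of_int ?i + T" using floor_remainder[of x] by auto
  \<comment> \<open>If x is the left endpoint of its cell, a two-sided neighbourhood also needs the
    preceding cell; the one-sided derivatives agree by the boundary conditions.\<close>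
  have "(quasi_periodic_extension T \<rho> y has_vector_derivative quasi_periodic_extension T \<rho> y' x)
      (at x within ?I ?i \<union> ?I (?i - 1))"
  proof (cases "x = T * of_int ?i")
    case True
    then have "x \<in> ?I ?i" "x \<in> ?I (?i - 1)" using T by (auto simp: algebra_simps)
    then show ?thesis using within by (intro has_vector_derivative_Un)
  next
    case False
    then have "x \<in> interior (?I ?i)" using x by (simp add: interior_atLeastAtMost_real)
    then have "at x within ?I ?i = at x" "at x within ?I ?i \<union> ?I (?i - 1) = at x"
      by (meson at_within_interior) (meson \<open>x \<in> interior (?I ?i)\<close> at_within_interior interior_mono subsetD sup_ge1)
    then show ?thesis using within[of ?i] x by simp
  qed
  moreover have "?I ?i \<union> ?I (?i - 1) = {T * of_int ?i - T..T * of_int ?i + T}"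
    using T by (auto simp: algebra_simps)
  moreover have "at x within {T * of_int ?i - T..T * of_int ?i + T} = at x"
    using x T by (intro at_within_Icc_at) linarith+
  ultimately show ?thesis by (simp only:)
qed

lemma quasi_periodic_extension_bounded:
  assumes "continuous_on {0..T} y"
  obtains D where "\<And>x. cmod (quasi_periodic_extension T \<rho> y x) \<le> D"
proof -
  have "bounded (y ` {0..T})" by (intro compact_imp_bounded compact_continuous_image assms) simp
  then obtain D where D: "\<forall>x\<in>{0..T}. cmod (y x) \<le> D" by (auto simp: bounded_iff)
  have "cmod (quasi_periodic_extension T \<rho> y x) = cmod (y (x - T * of_int \<lfloor>x / T\<rfloor>))" for x
    by (simp add: quasi_periodic_extension_def norm_mult norm_power_int \<rho>)
  then show ?thesis using that[of D] D floor_remainder by (metis atLeastAtMost_iff atLeastLessThan_iff less_imp_le)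
qed

end

lemma periodic_int_multiple:
  fixes u :: "real \<Rightarrow> 'a"
  assumes "\<And>x. u (x + T) = u x"
  shows "u (x - T * of_int i) = u x"
proof -
  have n: "u (x + T * of_nat k) = u x" for k x
  proof (induction k)
    case (Suc k)
    then show ?case using assms[of "x + T * of_nat k"] by (simp add: algebra_simps)
  qed simp
  show ?thesis
  proof (cases i)
    case (nonneg k)
    then show ?thesis using n[of "x - T * of_int i" k] by simp
  next
    case (neg k)
    have "x - T * of_int i = x + T * of_nat (Suc k)" unfolding neg by (simp only: of_int_minus of_int_of_nat_eq mult_minus_right diff_minus_eq_add)
    then show ?thesis using n[of x "Suc k"] by (simp only:)
  qed
qed

lemma spectrum_of_floquet_solution:
  fixes y0 y1 q :: "real \<Rightarrow> complex" and u :: "real \<Rightarrow> real"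
  assumes T: "0 < T" and \<rho>: "cmod \<rho> = 1"
    and b_cont: "continuous_on UNIV (\<lambda>x. deriv f (u x))" and u_per: "\<And>x. u (x + T) = u x"
    and dy: "\<And>x. x \<in> {0..T} \<Longrightarrow> (y0 has_vector_derivative y1 x) (at x within {0..T})"
      "\<And>x. x \<in> {0..T} \<Longrightarrow> (y1 has_vector_derivative of_real (c - deriv f (u x)) * y0 x - q x) (at x within {0..T})"
      "\<And>x. x \<in> {0..T} \<Longrightarrow> (q has_vector_derivative z * y0 x) (at x within {0..T})"
    and bc: "y0 T = \<rho> * y0 0" "y1 T = \<rho> * y1 0" "q T = \<rho> * q 0"
    and nz: "x0 \<in> {0..T}" "y0 x0 \<noteq> 0"
  shows "z \<in> L2_spectrum (linearization f c u)"
proof -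
  let ?E = "quasi_periodic_extension T \<rho>"
  have uT: "u T = u 0" using u_per[of 0] by simp
  have cont: "continuous_on {0..T} y0" "continuous_on {0..T} y1" "continuous_on {0..T} q"
    by (rule continuous_on_vector_derivative[OF dy(1)] continuous_on_vector_derivative[OF dy(2)]
        continuous_on_vector_derivative[OF dy(3)]; assumption)+
  obtain D0 D1 D2 where D: "\<And>x. cmod (?E y0 x) \<le> D0" "\<And>x. cmod (?E y1 x) \<le> D1" "\<And>x. cmod (?E q x) \<le> D2"
    using quasi_periodic_extension_bounded[OF T \<rho>] cont by metis
  have "bounded ((\<lambda>x. deriv f (u x)) ` {0..T})"
    by (intro compact_imp_bounded compact_continuous_image continuous_on_subset[OF b_cont]) auto
  then obtain D3 where D3: "\<forall>x\<in>{0..T}. \<bar>deriv f (u x)\<bar> \<le> D3" by (auto simp: bounded_iff)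
  have D3': "\<bar>deriv f (u x)\<bar> \<le> D3" for x
    using D3 floor_remainder[OF T \<rho>, of x] periodic_int_multiple[of u T x "\<lfloor>x / T\<rfloor>", OF u_per]
    by (metis atLeastAtMost_iff atLeastLessThan_iff less_imp_le)
  define D where "D = max (max D0 D1) (max D2 D3)"
  show ?thesis
  proof (rule spectrum_of_bounded_solution[where ?y0.0 = "?E y0" and ?y1.0 = "?E y1" and q = "?E q" and D = D])
    fix x
    show "(?E y0 has_vector_derivative ?E y1 x) (at x)"
      by (rule quasi_periodic_extension_deriv[OF T \<rho> dy(1) bc(1,2)])
    have "(?E y1 has_vector_derivative ?E (\<lambda>x. of_real (c - deriv f (u x)) * y0 x - q x) x) (at x)"
      by (rule quasi_periodic_extension_deriv[OF T \<rho> dy(2) bc(2)]) (simp_all add: uT bc algebra_simps)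
    also have "?E (\<lambda>x. of_real (c - deriv f (u x)) * y0 x - q x) x = (of_real c - of_real (deriv f (u x))) * ?E y0 x - ?E q x"
      unfolding quasi_periodic_extension_def periodic_int_multiple[of u T, OF u_per] by (simp add: algebra_simps)
    finally show "(?E y1 has_vector_derivative (of_real c - of_real (deriv f (u x))) * ?E y0 x - ?E q x) (at x)" .
    have "(?E q has_vector_derivative ?E (\<lambda>x. z * y0 x) x) (at x)"
      by (rule quasi_periodic_extension_deriv[OF T \<rho> dy(3) bc(3)]) (simp_all add: bc)
    also have "?E (\<lambda>x. z * y0 x) x = z * ?E y0 x" by (simp add: quasi_periodic_extension_def)
    finally show "(?E q has_vector_derivative z * ?E y0 x) (at x)" .
    show "cmod (?E y0 x) \<le> D" "cmod (?E y1 x) \<le> D" "cmod (?E q x) \<le> D" "\<bar>deriv f (u x)\<bar> \<le> D"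
      using D(1)[of x] D(2)[of x] D(3)[of x] D3'[of x] unfolding D_def by linarith+
  next
    show "?E y0 x0 \<noteq> 0"
      using quasi_periodic_extension_segment[OF T \<rho> bc(1), of x0 0] nz by simp
  qed (rule b_cont)
qed

section \<open>The characteristic polynomial of the Whitham system\<close>

lemma has_derivative_vector_3:
  fixes f1 f2 f3 :: "'a :: real_normed_vector \<Rightarrow> real"
  assumes "(f1 has_derivative f1') (at x within S)" "(f2 has_derivative f2') (at x within S)"
    "(f3 has_derivative f3') (at x within S)"
  shows "((\<lambda>x. vector [f1 x, f2 x, f3 x] :: real^3) has_derivative (\<lambda>h. vector [f1' h, f2' h, f3' h])) (at x within S)"
proof -
  have "\<forall>j. ((\<lambda>x. (vector [f1 x, f2 x, f3 x] :: real^3) $ j) has_derivative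
      (\<lambda>h. (vector [f1' h, f2' h, f3' h] :: real^3) $ j)) (at x within S)"
    unfolding forall_3 vector_3 using assms by blast
  then have "((\<lambda>x. (vector [f1 x, f2 x, f3 x] :: real^3) \<bullet> i) has_derivative
      (\<lambda>h. (vector [f1' h, f2' h, f3' h] :: real^3) \<bullet> i)) (at x within S)" if "i \<in> Basis" for i
    using that unfolding Basis_vec_def Basis_real_def by (clarsimp simp: inner_axis)
  then show ?thesis
    by (subst has_derivative_componentwise_within) blast
qed

lemma jacobian_eqI:
  fixes f :: "real^'n \<Rightarrow> real^'m"
  assumes "(f has_derivative (\<lambda>h. J *v h)) (at x)"
  shows "jacobian f (at x) = J"
  unfolding jacobian_def frechet_derivative_at[OF assms, symmetric] by simp

lemma det_zero_iff_kernel: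
  fixes A :: "'a::field^'n^'n"
  shows "det A = 0 \<longleftrightarrow> (\<exists>v. v \<noteq> 0 \<and> A *v v = 0)"
  by (metis invertible_det_nz invertible_left_inverse matrix_left_invertible_ker)

lemma map_matrix_of_real_mult:
  fixes A :: "real^'n^'m" and B :: "real^'k^'n"
  shows "map_matrix complex_of_real (A ** B) = map_matrix complex_of_real A ** map_matrix complex_of_real B"
  by (simp add: vec_eq_iff matrix_matrix_mult_def)

lemma matrix_inv_inverse:
  fixes A :: "'a::field^'n^'n"
  assumes "det A \<noteq> 0"
  shows "A ** matrix_inv A = mat 1" "matrix_inv A ** A = mat 1"
  using assms someI_ex[of "\<lambda>B. A ** B = mat 1 \<and> B ** A = mat 1"]
  unfolding invertible_det_nz[symmetric] invertible_def matrix_inv_def by auto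

lemma complex_eigenvalue_iff_pencil:
  fixes A B :: "real^'n^'n"
  assumes "det B \<noteq> 0"
  shows "complex_eigenvalue (matrix_inv B ** A) z \<longleftrightarrow>
    det (map_matrix complex_of_real A - map_matrix (\<lambda>x. z * of_real x) B) = 0"
proof -
  let ?c = "map_matrix complex_of_real"
  have "?c (mat 1) = mat 1" by (simp add: vec_eq_iff mat_def)
  then have inv: "?c B ** ?c (matrix_inv B) = mat 1" "?c (matrix_inv B) ** ?c B = mat 1"
    by (simp_all add: matrix_inv_inverse[OF assms] flip: map_matrix_of_real_mult)
  have pencil: "(?c A - map_matrix (\<lambda>x. z * of_real x) B) *v v = ?c A *v v - z *s (?c B *v v)" for v
    by (simp add: vec_eq_iff matrix_vector_mult_def sum_distrib_left sum_subtractf algebra_simps)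
  have "?c (matrix_inv B ** A) *v v = z *s v \<longleftrightarrow> ?c A *v v = z *s (?c B *v v)" for v
  proof
    assume "?c (matrix_inv B ** A) *v v = z *s v"
    then have "?c B *v (?c (matrix_inv B) *v (?c A *v v)) = ?c B *v (z *s v)"
      by (simp add: map_matrix_of_real_mult flip: matrix_vector_mul_assoc)
    then show "?c A *v v = z *s (?c B *v v)"
      by (simp only: matrix_vector_mul_assoc matrix_mul_assoc inv vector_scalar_commute matrix_mul_lid)
  next
    assume "?c A *v v = z *s (?c B *v v)"
    then have "?c (matrix_inv B) *v (?c A *v v) = z *s (?c (matrix_inv B) *v (?c B *v v))"
      by (simp add: vector_scalar_commute)
    then show "?c (matrix_inv B ** A) *v v = z *s v"
      by (simp add: matrix_vector_mul_assoc inv map_matrix_of_real_mult)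
  qed
  then show ?thesis
    unfolding complex_eigenvalue_def det_zero_iff_kernel pencil by simp
qed

lemma cubic_factors:
  fixes d0 d1 d2 d3 :: complex
  assumes "d3 \<noteq> 0"
  obtains z1 z2 z3 where "\<And>z. d0 + d1 * z + d2 * z\<^sup>2 + d3 * z ^ 3 = d3 * (z - z1) * (z - z2) * (z - z3)"
proof -
  define p where "p = [:d0, d1, d2, d3:]"
  have p: "p \<noteq> 0" "degree p = 3" "lead_coeff p = d3" using assms by (simp_all add: p_def)
  obtain A where A: "size A = degree p" "p = smult (lead_coeff p) (\<Prod>x\<in>#A. [:- x, 1:])"
    using alg_closed_imp_factorization[OF p(1)] by blast
  obtain z1 z2 z3 where z: "A = {#z1, z2, z3#}"
  proof -
    have 3: "size A = Suc (Suc (Suc 0))" using A(1) p(2) by simp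
    obtain z1 B where B: "A = add_mset z1 B" using size_eq_Suc_imp_eq_union[OF 3] by blast
    then have 2: "size B = Suc (Suc 0)" using 3 by simp
    obtain z2 C where C: "B = add_mset z2 C" using size_eq_Suc_imp_eq_union[OF 2] by blast
    then have 1: "size C = Suc 0" using 2 by simp
    obtain z3 where "C = {#z3#}" using 1 size_1_singleton_mset[of C] by auto
    then show ?thesis using that B C by simp
  qed
  have "poly p z = d3 * (z - z1) * (z - z2) * (z - z3)" for z
    by (subst A(2)) (simp add: z p(3) algebra_simps)
  moreover have "poly p z = d0 + d1 * z + d2 * z\<^sup>2 + d3 * z ^ 3" for z
    by (simp add: p_def algebra_simps power2_eq_square power3_eq_cube)
  ultimately show ?thesis using that by metis
qed

text \<open>The pencil \<open>\<mu> D - \<zeta> / T J\<close> of the Jacobians \<open>D\<close> of the densities and \<open>J\<close> of the fluxes, after adding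
  multiples of the third row to the others. The column for \<open>s\<close> carries a sign since \<open>c = c0 - s\<close>.\<close>

definition whitham_pencil ::
  "real^3 \<Rightarrow> real^3 \<Rightarrow> real^3 \<Rightarrow> complex \<Rightarrow> complex \<Rightarrow> complex^3^3" where
  "whitham_pencil dT dM dP \<mu> \<zeta> = vector [
     vector [\<mu> * of_real (dM $ 1) - \<zeta>, \<mu> * of_real (dM $ 2), - (\<mu> * of_real (dM $ 3))],
     vector [\<mu> * of_real (dP $ 1), \<mu> * of_real (dP $ 2) + 2 * \<zeta>, - (\<mu> * of_real (dP $ 3))],
     vector [- (\<mu> * of_real (dT $ 1)), - (\<mu> * of_real (dT $ 2)), \<mu> * of_real (dT $ 3) + \<zeta>]]"

locale whitham_point =
  fixes T M P :: "real^3 \<Rightarrow> real" and p0 q0 dT dM dP :: "real^3" and a0 E0 c0 :: real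
  assumes p0: "p0 = vector [a0, E0, c0]" and q0: "q0 = vector [a0, E0, 0]"
    and T_deriv: "(T has_derivative (\<lambda>h. dT \<bullet> h)) (at p0)"
    and M_deriv: "(M has_derivative (\<lambda>h. dM \<bullet> h)) (at p0)"
    and P_deriv: "(P has_derivative (\<lambda>h. dP \<bullet> h)) (at p0)"
    and T_pos: "0 < T p0"
begin

lemma aEs_q0: "aEs c0 q0 = p0"
  by (simp add: aEs_def p0 q0)

lemma aEs_deriv: "(aEs c0 has_derivative (\<lambda>h. vector [h $ 1, h $ 2, - h $ 3])) (at q0)"
  unfolding aEs_def[abs_def]
  by (rule has_derivative_vector_3) (auto intro!: derivative_eq_intros bounded_linear_imp_has_derivative bounded_linear_vec_nth)

lemma chain_aEs:
  assumes "(g has_derivative (\<lambda>h. d \<bullet> h)) (at p0)"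
  shows "((\<lambda>q. g (aEs c0 q)) has_derivative (\<lambda>h. d $ 1 * h $ 1 + d $ 2 * h $ 2 - d $ 3 * h $ 3)) (at q0)"
  using has_derivative_compose[OF aEs_deriv, of g "\<lambda>h. d \<bullet> h"] assms
  by (simp add: aEs_q0 inner_vec_def sum_3)

definition density_jacobian :: "real^3^3" where
  "density_jacobian = vector [
     vector [(dM $ 1 * T p0 - M p0 * dT $ 1) / (T p0)\<^sup>2, (dM $ 2 * T p0 - M p0 * dT $ 2) / (T p0)\<^sup>2,
       - (dM $ 3 * T p0 - M p0 * dT $ 3) / (T p0)\<^sup>2],
     vector [(dP $ 1 * T p0 - P p0 * dT $ 1) / (T p0)\<^sup>2, (dP $ 2 * T p0 - P p0 * dT $ 2) / (T p0)\<^sup>2,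
       - (dP $ 3 * T p0 - P p0 * dT $ 3) / (T p0)\<^sup>2],
     vector [- dT $ 1 / (T p0)\<^sup>2, - dT $ 2 / (T p0)\<^sup>2, dT $ 3 / (T p0)\<^sup>2]]"

text \<open>At s = 0 the product rule for s M \<omega> leaves only M \<omega>, so no gradient of T,
  M or P enters.\<close>

definition flux_jacobian :: "real^3^3" where
  "flux_jacobian = vector [vector [1, 0, - M p0 / T p0], vector [0, - 2, - P p0 / T p0],
     vector [0, 0, - 1 / T p0]]"

lemma quotient_deriv:
  assumes "(g has_derivative (\<lambda>h. d \<bullet> h)) (at p0)"
  shows "((\<lambda>q. g (aEs c0 q) * (1 / T (aEs c0 q))) has_derivative
    (\<lambda>h. ((d $ 1 * T p0 - g p0 * dT $ 1) * h $ 1 + (d $ 2 * T p0 - g p0 * dT $ 2) * h $ 2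
      - (d $ 3 * T p0 - g p0 * dT $ 3) * h $ 3) / (T p0)\<^sup>2)) (at q0)"
  using has_derivative_divide'[OF chain_aEs[OF assms] chain_aEs[OF T_deriv]] T_pos
  by (simp add: aEs_q0 power2_eq_square algebra_simps)

lemma jacobian_density: "jacobian (whitham_density c0 T M P) (at q0) = density_jacobian"
proof (rule jacobian_eqI)
  have 1: "((\<lambda>q. 1 / T (aEs c0 q)) has_derivative
      (\<lambda>h. - (dT $ 1 * h $ 1 + dT $ 2 * h $ 2 - dT $ 3 * h $ 3) / (T p0)\<^sup>2)) (at q0)"
    using has_derivative_divide'[OF has_derivative_const[of 1] chain_aEs[OF T_deriv]] T_pos
    by (simp add: aEs_q0 power2_eq_square algebra_simps)
  show "(whitham_density c0 T M P has_derivative (\<lambda>h. density_jacobian *v h)) (at q0)"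
    unfolding whitham_density_def[abs_def] Let_def
    by (rule has_derivative_eq_rhs[OF has_derivative_vector_3[OF quotient_deriv[OF M_deriv] quotient_deriv[OF P_deriv] 1]])
       (auto simp: fun_eq_iff vec_eq_iff forall_3 matrix_vector_mult_def sum_3 density_jacobian_def
          add_divide_distrib diff_divide_distrib algebra_simps)
qed

lemma jacobian_flux: "jacobian (whitham_flux c0 T M P) (at q0) = flux_jacobian"
proof (rule jacobian_eqI)
  have nth: "((\<lambda>q. q $ i) has_derivative (\<lambda>h. h $ i)) (at q0)" for i
    by (intro bounded_linear_imp_has_derivative bounded_linear_vec_nth)
  have s: "((\<lambda>q. - (q $ 3) * g (aEs c0 q) * (1 / T (aEs c0 q))) has_derivative (\<lambda>h. - (h $ 3) * (g p0 / T p0))) (at q0)"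
    if "(g has_derivative (\<lambda>h. d \<bullet> h)) (at p0)" for g d
    unfolding mult.assoc
    by (rule derivative_eq_intros nth quotient_deriv[OF that] refl)+ (simp add: q0 aEs_q0[unfolded q0])
  have 1: "((\<lambda>q. q $ 1 - q $ 3 * M (aEs c0 q) * (1 / T (aEs c0 q))) has_derivative (\<lambda>h. h $ 1 - h $ 3 * (M p0 / T p0))) (at q0)"
    using has_derivative_add[OF nth[of 1] s[OF M_deriv]] by simp
  have 2: "((\<lambda>q. - (q $ 3) * P (aEs c0 q) * (1 / T (aEs c0 q)) - 2 * q $ 2) has_derivative (\<lambda>h. - (h $ 3) * (P p0 / T p0) - 2 * h $ 2)) (at q0)"
    by (intro has_derivative_diff s[OF P_deriv] has_derivative_mult_right nth)
  have one: "((\<lambda>_. 1) has_derivative (\<lambda>h. (0 :: real^3) \<bullet> h)) (at p0)" by simp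
  have 3: "((\<lambda>q. - (q $ 3) * (1 / T (aEs c0 q))) has_derivative (\<lambda>h. - (h $ 3) * (1 / T p0))) (at q0)"
    using s[OF one] by simp
  show "(whitham_flux c0 T M P has_derivative (\<lambda>h. flux_jacobian *v h)) (at q0)"
    unfolding whitham_flux_def[abs_def] Let_def
    by (rule has_derivative_eq_rhs[OF has_derivative_vector_3[OF 1 2 3]])
       (auto simp: fun_eq_iff vec_eq_iff forall_3 matrix_vector_mult_def sum_3 flux_jacobian_def)
qed

lemma det_flux_jacobian: "det flux_jacobian \<noteq> 0"
  using T_pos by (simp add: det_3 flux_jacobian_def)

text \<open>\<open>R\<close> undoes the row operations: its multiples of the third row restore the
  terms with M and P that come from the quotient rule and from the fluxes. Its determinant supplies
  the power of T.\<close>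

lemma det_pencil:
  "det (map_matrix (\<lambda>x. \<mu> * of_real x) density_jacobian - map_matrix (\<lambda>x. \<zeta> * of_real x) flux_jacobian)
    = det (whitham_pencil dT dM dP \<mu> (\<zeta> * of_real (T p0))) / of_real (T p0) ^ 4"
proof -
  define t where "t = complex_of_real (T p0)"
  have t: "t \<noteq> 0" "complex_of_real (T p0) = t" using T_pos by (auto simp: t_def)
  define R :: "complex^3^3" where "R = vector [vector [1 / t, 0, of_real (M p0) / t\<^sup>2],
    vector [0, 1 / t, of_real (P p0) / t\<^sup>2], vector [0, 0, 1 / t\<^sup>2]]"
  have "map_matrix (\<lambda>x. \<mu> * of_real x) density_jacobian - map_matrix (\<lambda>x. \<zeta> * of_real x) flux_jacobian
      = R ** whitham_pencil dT dM dP \<mu> (\<zeta> * t)"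
    using t(1) unfolding density_jacobian_def flux_jacobian_def whitham_pencil_def R_def
    by (simp add: vec_eq_iff forall_3 matrix_matrix_mult_def sum_3 t(2) field_simps power2_eq_square)
  moreover have "det R = 1 / t ^ 4" by (simp add: R_def det_3 eval_nat_numeral)
  ultimately show ?thesis by (simp add: det_mul t(2))
qed

lemma eigenvalue_iff:
  "complex_eigenvalue (whitham_matrix c0 T M P q0) z \<longleftrightarrow>
    det (whitham_pencil dT dM dP 1 (z * of_real (T p0))) = 0"
  using det_pencil[of 1 z] T_pos
  unfolding whitham_matrix_def jacobian_density jacobian_flux complex_eigenvalue_iff_pencil[OF det_flux_jacobian]
  by simp

text \<open>The coefficient of z^3 is -2/T, so the characteristic polynomial is always a genuine
  cubic with three complex roots. These are the eigenvalues, and hyperbolicity amounts to their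
  being real.\<close>

lemma hyperbolic_iff:
  "whitham_hyperbolic c0 T M P q0 \<longleftrightarrow>
    (\<forall>z. complex_eigenvalue (whitham_matrix c0 T M P q0) z \<longrightarrow> z \<in> \<real>)"
proof -
  let ?t = "complex_of_real (T p0)"
  let ?\<chi> = "\<lambda>z. det (whitham_pencil dT dM dP 1 (z * ?t)) / ?t ^ 4"
  have t: "?t \<noteq> 0" using T_pos by simp
  have char: "whitham_char c0 T M P q0 \<mu> \<kappa> = \<mu> ^ 3 * ?\<chi> (\<i> * \<kappa> / (\<mu> * ?t))" if "\<mu> \<noteq> 0" for \<mu> \<kappa>
  proof -
    have "det (whitham_pencil dT dM dP \<mu> (\<mu> * \<zeta>)) = \<mu> ^ 3 * det (whitham_pencil dT dM dP 1 \<zeta>)" for \<zeta>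
      by (simp add: whitham_pencil_def det_3 algebra_simps power3_eq_cube)
    from this[of "\<i> * \<kappa> / \<mu>"] show ?thesis
      using that t unfolding whitham_char_def jacobian_density jacobian_flux aEs_q0 det_pencil
      by (simp add: field_simps)
  qed
  obtain d0 d1 d2 where d: "\<And>z. ?\<chi> z = d0 + d1 * z + d2 * z\<^sup>2 + (- 2 / ?t) * z ^ 3"
  proof
    fix z
    let ?A = "\<lambda>i. complex_of_real (dM $ i)" and ?B = "\<lambda>i. complex_of_real (dP $ i)" and ?C = "\<lambda>i. complex_of_real (dT $ i)"
    show "?\<chi> z = (?A 1 * (?B 2 * ?C 3 - ?B 3 * ?C 2) - ?A 2 * (?B 1 * ?C 3 - ?B 3 * ?C 1)
          + ?A 3 * (?B 1 * ?C 2 - ?B 2 * ?C 1)) / ?t ^ 4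
        + (?A 1 * (?B 2 + 2 * ?C 3) - (?B 2 * ?C 3 - ?B 3 * ?C 2) - ?A 2 * ?B 1 - 2 * ?A 3 * ?C 1) / ?t ^ 3 * z
        + (2 * ?A 1 - (?B 2 + 2 * ?C 3)) / ?t ^ 2 * z\<^sup>2 + (- 2 / ?t) * z ^ 3"
      using t by (simp add: det_3 whitham_pencil_def field_simps power2_eq_square power3_eq_cube eval_nat_numeral)
  qed
  obtain z1 z2 z3 where z: "\<And>z. ?\<chi> z = (- 2 / ?t) * (z - z1) * (z - z2) * (z - z3)"
    using cubic_factors[of "- 2 / ?t" d0 d1 d2] t d by (metis divide_eq_0_iff neg_equal_0_iff_equal zero_neq_numeral)
  have ev: "complex_eigenvalue (whitham_matrix c0 T M P q0) z \<longleftrightarrow> ?\<chi> z = 0" for z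
    using t by (simp add: eigenvalue_iff)
  show ?thesis
  proof
    assume "whitham_hyperbolic c0 T M P q0"
    then obtain k and r1 r2 r3 :: real where k: "k \<noteq> 0" and
      eq: "\<And>\<mu> \<kappa>. \<mu> \<noteq> 0 \<Longrightarrow> (let z = \<i> * \<kappa> / (\<mu> * ?t) in whitham_char c0 T M P q0 \<mu> \<kappa> =
                 \<mu> ^ 3 * (k * (z - of_real r1) * (z - of_real r2) * (z - of_real r3)))"
      unfolding whitham_hyperbolic_def aEs_q0 by blast
    \<comment> \<open>With \<mu> = 1, the value \<open>- \<i> * z * ?t\<close> of \<kappa> makes the
      spectral variable equal to z.\<close>
    have "?\<chi> z = k * (z - of_real r1) * (z - of_real r2) * (z - of_real r3)" for z
      using eq[of 1 "- \<i> * z * ?t"] char[of 1 "- \<i> * z * ?t"] t by (simp add: Let_def)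
    then show "\<forall>z. complex_eigenvalue (whitham_matrix c0 T M P q0) z \<longrightarrow> z \<in> \<real>"
      unfolding ev using k by auto
  next
    assume real: "\<forall>z. complex_eigenvalue (whitham_matrix c0 T M P q0) z \<longrightarrow> z \<in> \<real>"
    have "z1 \<in> \<real>" "z2 \<in> \<real>" "z3 \<in> \<real>" using real unfolding ev z by auto
    then obtain r1 r2 r3 where "z1 = of_real r1" "z2 = of_real r2" "z3 = of_real r3"
      by (metis Reals_cases)
    then have "\<forall>\<mu> \<kappa>. \<mu> \<noteq> 0 \<longrightarrow> (let z = \<i> * \<kappa> / (\<mu> * ?t) in whitham_char c0 T M P q0 \<mu> \<kappa> =
        \<mu> ^ 3 * ((- 2 / ?t) * (z - of_real r1) * (z - of_real r2) * (z - of_real r3)))"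
      using char z unfolding Let_def by metis
    moreover have "- 2 / ?t \<noteq> 0" using t by simp
    ultimately show "whitham_hyperbolic c0 T M P q0"
      unfolding whitham_hyperbolic_def aEs_q0 by blast
  qed
qed

end

section \<open>The Evans function at low frequency\<close>

text \<open>\<open>y 1, y 2, y 3\<close> are the derivatives of the profile with respect to \<open>a, E, c\<close>, and \<open>dT, dM, dP\<close>
  the gradients of period, mass and momentum.\<close>

locale evans = profile_well f F p m n v
  for f F :: "real \<Rightarrow> real" and p :: "real^3" and m n :: real and v :: "real \<Rightarrow> real" +
  fixes y y' :: "3 \<Rightarrow> real \<Rightarrow> real" and dT dM dP :: "real^3"
  assumes y_deriv: "\<And>i x. x \<in> {0..per} \<Longrightarrow> (y i has_real_derivative y' i x) (at x within {0..per})"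
    and y'_deriv: "\<And>i x. x \<in> {0..per} \<Longrightarrow> (y' i has_real_derivative
      axis i 1 $ 1 + axis i 1 $ 3 * v x + (p $ 3 - deriv f (v x)) * y i x) (at x within {0..per})"
    and y_0: "\<And>i. y i 0 = - (axis i 1 $ 2 + axis i 1 $ 1 * m + axis i 1 $ 3 * m\<^sup>2 / 2) / force m"
    and y'_0: "\<And>i. y' i 0 = 0"
    and y'_per: "\<And>i. y' i per = - force m * dT $ i"
    and integral_y: "\<And>i. integral {0..per} (y i) = dM $ i - m * dT $ i"
    and integral_v_y: "\<And>i. integral {0..per} (\<lambda>x. v x * y i x) = (dP $ i - m\<^sup>2 * dT $ i) / 2"
begin

definition b :: "real \<Rightarrow> real" where "b x = p $ 3 - deriv f (v x)"

lemma force_deriv: "((\<lambda>x. force (v x)) has_real_derivative b x * deriv v x) (at x)"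
  unfolding force_def b_def
  by (rule derivative_eq_intros v_deriv DERIV_chain2[OF f_C1(1) v_deriv] refl | simp add: algebra_simps)+

text \<open>Translation and variation of the energy give two solutions of L y = 0. The turning point
  moves with E at the rate \<open>- 1 / force m\<close>, which is exactly what normalizes the
  Wronskian to 1.\<close>

sublocale fundamental_pair per b "deriv v" "\<lambda>x. force (v x)" "y 2" "y' 2"
proof
  fix x assume x: "x \<in> {0..per}"
  show "(deriv v has_real_derivative force (v x)) (at x within {0..per})"
    "((\<lambda>x. force (v x)) has_real_derivative b x * deriv v x) (at x within {0..per})"
    by (auto intro: has_field_derivative_at_within v_second force_deriv)
  show "(y 2 has_real_derivative y' 2 x) (at x within {0..per})" by (rule y_deriv[OF x])
  show "(y' 2 has_real_derivative b x * y 2 x) (at x within {0..per})"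
    using y'_deriv[OF x, of 2] by (simp add: b_def axis_def)
next
  show "deriv v 0 * y' 2 0 - force (v 0) * y 2 0 = 1"
    using force_m_pos by (simp add: v_0 y_0 y'_0 axis_def)
qed (rule per_pos)

definition q :: "3 \<Rightarrow> real \<Rightarrow> real" where "q i x = - (axis i 1 $ 1 + axis i 1 $ 3 * v x)"
definition w :: "3 \<Rightarrow> complex \<Rightarrow> real \<Rightarrow> complex" where "w i = resolvent (\<lambda>x. of_real (y i x))"
definition w' :: "3 \<Rightarrow> complex \<Rightarrow> real \<Rightarrow> complex" where
  "w' i \<mu> x = of_real (y' i x) + \<mu> * Volterra' (w i \<mu>) x"
definition Q :: "3 \<Rightarrow> complex \<Rightarrow> real \<Rightarrow> complex" where
  "Q i \<mu> x = of_real (q i x) + \<mu> * weighted_integral (\<lambda>_. 1) (w i \<mu>) x"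

lemma cy: "continuous_on {0..per} (\<lambda>x. complex_of_real (y i x))"
  using DERIV_continuous_on[OF y_deriv] by (intro continuous_intros) auto

lemma w_cont: "\<mu> \<in> ball 0 radius \<Longrightarrow> continuous_on {0..per} (w i \<mu>)"
  unfolding w_def by (rule resolvent_cont[OF cy])

lemma w_eq: "\<mu> \<in> ball 0 radius \<Longrightarrow> x \<in> {0..per} \<Longrightarrow> w i \<mu> x = of_real (y i x) + \<mu> * Volterra (w i \<mu>) x"
  unfolding w_def by (rule resolvent_eq[OF cy])

text \<open>\<open>Q i \<mu>\<close> is L applied to \<open>w i \<mu>\<close>, just as
  \<open>q i\<close> is L applied to \<open>y i\<close>. For i = 1, 2 the third identity is the
  eigenvalue equation. For i = 3 it contains the extra term \<open>- deriv v\<close>; since L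
  annihilates \<open>deriv v\<close>, this term is absorbed in the combination
  \<open>deriv v - \<mu> * w 3 \<mu>\<close>.\<close>

lemma w_deriv:
  assumes \<mu>: "\<mu> \<in> ball 0 radius" and x: "x \<in> {0..per}"
  shows "(w i \<mu> has_vector_derivative w' i \<mu> x) (at x within {0..per})"
    and "(w' i \<mu> has_vector_derivative of_real (b x) * w i \<mu> x - Q i \<mu> x) (at x within {0..per})"
    and "(Q i \<mu> has_vector_derivative of_real (- (axis i 1 $ 3) * deriv v x) + \<mu> * w i \<mu> x) (at x within {0..per})"
proof -
  note V = Volterra_deriv[OF w_cont[OF \<mu>, of i] x]
  have "((\<lambda>x. of_real (y i x) + \<mu> * Volterra (w i \<mu>) x) has_vector_derivative w' i \<mu> x) (at x within {0..per})"
    unfolding w'_def by (intro has_vector_derivative_add has_vector_derivative_of_real y_deriv x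
        has_vector_derivative_mult_right V)
  then show "(w i \<mu> has_vector_derivative w' i \<mu> x) (at x within {0..per})"
    by (rule has_vector_derivative_transform[OF x, rotated]) (rule w_eq[OF \<mu>])
  have "(w' i \<mu> has_vector_derivative of_real (axis i 1 $ 1 + axis i 1 $ 3 * v x + (p $ 3 - deriv f (v x)) * y i x)
      + \<mu> * (b x *\<^sub>R Volterra (w i \<mu>) x - weighted_integral (\<lambda>_. 1) (w i \<mu>) x)) (at x within {0..per})"
    unfolding w'_def[abs_def] by (intro has_vector_derivative_add has_vector_derivative_of_real y'_deriv x
        has_vector_derivative_mult_right V)
  then show "(w' i \<mu> has_vector_derivative of_real (b x) * w i \<mu> x - Q i \<mu> x) (at x within {0..per})"
    unfolding w_eq[OF \<mu> x] Q_def q_def b_def by (simp add: scaleR_conv_of_real algebra_simps)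
  have "(q i has_real_derivative - (axis i 1 $ 3) * deriv v x) (at x within {0..per})"
    unfolding q_def[abs_def]
    by (rule derivative_eq_intros has_field_derivative_at_within[OF v_deriv] refl | simp)+
  then show "(Q i \<mu> has_vector_derivative of_real (- (axis i 1 $ 3) * deriv v x) + \<mu> * w i \<mu> x) (at x within {0..per})"
    using weighted_integral_deriv[OF continuous_on_const w_cont[OF \<mu>] x, of 1 i]
    unfolding Q_def[abs_def]
    by (intro has_vector_derivative_add has_vector_derivative_of_real has_vector_derivative_mult_right) auto
qed

lemma w_0: "\<mu> \<in> ball 0 radius \<Longrightarrow> w i \<mu> 0 = of_real (y i 0)" "w' i \<mu> 0 = 0" "Q i \<mu> 0 = of_real (q i 0)"
  using w_eq[of \<mu> 0 i] per_pos by (simp_all add: w'_def Q_def y'_0)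

definition Iw :: "3 \<Rightarrow> complex \<Rightarrow> complex" where "Iw i \<mu> = weighted_integral (\<lambda>_. 1) (w i \<mu>) per"
definition Ivw :: "3 \<Rightarrow> complex \<Rightarrow> complex" where "Ivw i \<mu> = weighted_integral v (w i \<mu>) per"
definition Dw :: "3 \<Rightarrow> complex \<Rightarrow> complex" where "Dw i \<mu> = w' i \<mu> per"

lemma per_in: "per \<in> {0..per}" "0 \<in> {0..per}"
  using per_pos by auto

lemma Iw_holomorphic: "Iw i holomorphic_on ball 0 radius"
  and Ivw_holomorphic: "Ivw i holomorphic_on ball 0 radius"
  and Dw_holomorphic: "Dw i holomorphic_on ball 0 radius"
proof -
  have h: "(\<lambda>\<mu>. weighted_integral k (w i \<mu>) per) holomorphic_on ball 0 radius" if "continuous_on {0..per} k" for k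
    unfolding w_def by (rule resolvent_holomorphic[OF cy that per_in(1)])
  show "Iw i holomorphic_on ball 0 radius" "Ivw i holomorphic_on ball 0 radius"
    unfolding Iw_def[abs_def] Ivw_def[abs_def] by (intro h v_cont continuous_on_const)+
  show "Dw i holomorphic_on ball 0 radius"
    unfolding Dw_def[abs_def] w'_def Volterra'_def scaleR_conv_of_real
    by (intro holomorphic_intros h c\<Phi>1 c\<Phi>2 continuous_on_const)
qed

text \<open>At \<mu> = 0 the Neumann series reduces to \<open>y i\<close>, so the jumps are those
  already expressed by the gradients of T, M, P.\<close>

lemma Iw_0: "Iw i 0 = of_real (dM $ i - m * dT $ i)"
  and Ivw_0: "Ivw i 0 = of_real ((dP $ i - m\<^sup>2 * dT $ i) / 2)"
  and Dw_0: "Dw i 0 = - of_real (force m * dT $ i)"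
proof -
  have w0: "w i 0 x = of_real (y i x)" if "x \<in> {0..per}" for x
    using resolvent_0[OF cy that] by (simp add: w_def)
  have *: "weighted_integral k (w i 0) per = of_real (integral {0..per} (\<lambda>x. k x * y i x))"
    if k: "continuous_on {0..per} k" for k
  proof -
    have "(\<lambda>x. k x * y i x) integrable_on {0..per}"
      using DERIV_continuous_on[OF y_deriv] k by (intro integrable_continuous_interval continuous_intros) auto
    then have "((\<lambda>x. of_real (k x * y i x)) has_integral complex_of_real (integral {0..per} (\<lambda>x. k x * y i x))) {0..per}"
      by (intro has_integral_of_real integrable_integral)
    then have "integral {0..per} (\<lambda>x. of_real (k x * y i x)) = complex_of_real (integral {0..per} (\<lambda>x. k x * y i x))"
      by (rule integral_unique)
    moreover have "weighted_integral k (w i 0) per = integral {0..per} (\<lambda>x. of_real (k x * y i x))"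
      unfolding weighted_integral_def by (intro integral_cong) (simp add: w0 scaleR_conv_of_real)
    ultimately show ?thesis by simp
  qed
  show "Iw i 0 = of_real (dM $ i - m * dT $ i)"
    unfolding Iw_def using *[OF continuous_on_const[of _ 1]] by (simp add: integral_y)
  show "Ivw i 0 = of_real ((dP $ i - m\<^sup>2 * dT $ i) / 2)"
    unfolding Ivw_def using *[OF v_cont] by (simp only: integral_v_y)
  show "Dw i 0 = - of_real (force m * dT $ i)"
    by (simp add: Dw_def w'_def y'_per)
qed

definition R :: "complex \<Rightarrow> complex" where "R \<epsilon> = (if \<epsilon> = 0 then 1 else (exp \<epsilon> - 1) / \<epsilon>)"

text \<open>The Evans function in the scaling \<open>\<lambda> = \<epsilon> t\<close>, \<open>\<epsilon> = \<i> \<theta>\<close>: the columns are the jumps over a period of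
  the solutions \<open>v' - \<lambda> w 3\<close>, \<open>w 2\<close>, \<open>w 1\<close> of the eigenvalue equation, relative to the Floquet multiplier
  \<open>exp \<epsilon>\<close>, the rows the coordinates \<open>q = L y\<close>, \<open>v q + v' y' - v'' y\<close> and \<open>y'\<close>. The first two rows and the first
  column have been divided by \<open>\<epsilon>\<close>.\<close>

definition evans_matrix :: "complex \<Rightarrow> complex \<Rightarrow> complex^3^3" where
  "evans_matrix \<epsilon> t = vector [
     vector [- (t\<^sup>2 * Iw 3 (\<epsilon> * t)) - R \<epsilon> * t * of_real m, t * Iw 2 (\<epsilon> * t), t * Iw 1 (\<epsilon> * t) + R \<epsilon>],
     vector [- (t\<^sup>2 * Ivw 3 (\<epsilon> * t)) - R \<epsilon> * t * of_real (m\<^sup>2 / 2), t * Ivw 2 (\<epsilon> * t) - R \<epsilon>, t * Ivw 1 (\<epsilon> * t)],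
     vector [- (t * Dw 3 (\<epsilon> * t)) - R \<epsilon> * of_real (force m), Dw 2 (\<epsilon> * t), Dw 1 (\<epsilon> * t)]]"

lemma v_per_0: "v per = m" "deriv v per = 0" "deriv v 0 = 0"
  using v_per[of 0] v_0 deriv_v_0[of per] deriv_v_0[of 0] by auto

lemma evans_zero_in_spectrum:
  assumes \<theta>: "\<theta> \<noteq> 0" and ball: "\<i> * of_real \<theta> * t \<in> ball 0 radius"
    and det: "det (evans_matrix (\<i> * of_real \<theta>) t) = 0"
  shows "\<i> * of_real \<theta> * t \<in> L2_spectrum (linearization f (p $ 3) v)"
proof -
  define \<epsilon> where "\<epsilon> = \<i> * complex_of_real \<theta>"
  define \<mu> where "\<mu> = \<epsilon> * t"
  have \<epsilon>: "\<epsilon> \<noteq> 0" using \<theta> by (simp add: \<epsilon>_def)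
  have \<mu>: "\<mu> \<in> ball 0 radius" using ball by (simp add: \<mu>_def \<epsilon>_def)
  have R: "\<epsilon> * R \<epsilon> = exp \<epsilon> - 1" using \<epsilon> by (simp add: R_def)
  obtain x where x: "x \<noteq> 0" "evans_matrix \<epsilon> t *v x = 0"
    using det det_zero_iff_kernel unfolding \<epsilon>_def by blast
  \<comment> \<open>Since the first column of the matrix has been divided by \<epsilon>, the
    coefficient of the first solution is the kernel coordinate divided by \<epsilon>.\<close>
  define \<alpha> where "\<alpha> = x $ 1 / \<epsilon>"
  define \<beta> where "\<beta> = x $ 2"
  define \<gamma> where "\<gamma> = x $ 3"
  have x1: "x $ 1 = \<epsilon> * \<alpha>" using \<epsilon> by (simp add: \<alpha>_def)
  have rows: "(- (t\<^sup>2 * Iw 3 \<mu>) - R \<epsilon> * t * of_real m) * (\<epsilon> * \<alpha>) + t * Iw 2 \<mu> * \<beta> + (t * Iw 1 \<mu> + R \<epsilon>) * \<gamma> = 0"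
    "(- (t\<^sup>2 * Ivw 3 \<mu>) - R \<epsilon> * t * of_real (m\<^sup>2 / 2)) * (\<epsilon> * \<alpha>) + (t * Ivw 2 \<mu> - R \<epsilon>) * \<beta> + t * Ivw 1 \<mu> * \<gamma> = 0"
    "(- (t * Dw 3 \<mu>) - R \<epsilon> * of_real (force m)) * (\<epsilon> * \<alpha>) + Dw 2 \<mu> * \<beta> + Dw 1 \<mu> * \<gamma> = 0"
  proof -
    have row: "evans_matrix \<epsilon> t $ i $ 1 * (\<epsilon> * \<alpha>) + evans_matrix \<epsilon> t $ i $ 2 * \<beta> + evans_matrix \<epsilon> t $ i $ 3 * \<gamma> = 0" for i
    proof -
      have "(evans_matrix \<epsilon> t *v x) $ i = 0" unfolding x(2) by simp
      then show ?thesis by (simp only: matrix_vector_mult_def sum_3 vec_lambda_beta x1 \<beta>_def \<gamma>_def)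
    qed
    show "(- (t\<^sup>2 * Iw 3 \<mu>) - R \<epsilon> * t * of_real m) * (\<epsilon> * \<alpha>) + t * Iw 2 \<mu> * \<beta> + (t * Iw 1 \<mu> + R \<epsilon>) * \<gamma> = 0"
      using row[of 1] by (simp only: evans_matrix_def vector_3 \<mu>_def)
    show "(- (t\<^sup>2 * Ivw 3 \<mu>) - R \<epsilon> * t * of_real (m\<^sup>2 / 2)) * (\<epsilon> * \<alpha>) + (t * Ivw 2 \<mu> - R \<epsilon>) * \<beta> + t * Ivw 1 \<mu> * \<gamma> = 0"
      using row[of 2] by (simp only: evans_matrix_def vector_3 \<mu>_def)
    show "(- (t * Dw 3 \<mu>) - R \<epsilon> * of_real (force m)) * (\<epsilon> * \<alpha>) + Dw 2 \<mu> * \<beta> + Dw 1 \<mu> * \<gamma> = 0"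
      using row[of 3] by (simp only: evans_matrix_def vector_3 \<mu>_def)
  qed
  define Y0 where "Y0 x = \<alpha> * (of_real (deriv v x) - \<mu> * w 3 \<mu> x) + \<beta> * w 2 \<mu> x + \<gamma> * w 1 \<mu> x" for x
  define Y1 where "Y1 x = \<alpha> * (of_real (force (v x)) - \<mu> * w' 3 \<mu> x) + \<beta> * w' 2 \<mu> x + \<gamma> * w' 1 \<mu> x" for x
  define YQ where "YQ x = - (\<alpha> * \<mu> * Q 3 \<mu> x) + \<beta> * Q 2 \<mu> x + \<gamma> * Q 1 \<mu> x" for x
  have dv: "((\<lambda>x. complex_of_real (v x)) has_vector_derivative of_real (deriv v x)) (at x within {0..per})"
    "((\<lambda>x. complex_of_real (deriv v x)) has_vector_derivative of_real (force (v x))) (at x within {0..per})"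
    "((\<lambda>x. complex_of_real (force (v x))) has_vector_derivative of_real (b x * deriv v x)) (at x within {0..per})" for x
    by (rule has_vector_derivative_of_real, rule has_field_derivative_at_within, rule v_deriv v_second force_deriv)+
  have dY0: "(Y0 has_vector_derivative Y1 x) (at x within {0..per})" if x: "x \<in> {0..per}" for x
    unfolding Y0_def[abs_def] Y1_def
    by (intro has_vector_derivative_add has_vector_derivative_diff has_vector_derivative_mult_right dv w_deriv \<mu> x)
  have dY1: "(Y1 has_vector_derivative of_real (b x) * Y0 x - YQ x) (at x within {0..per})" if x: "x \<in> {0..per}" for x
  proof -
    have "(Y1 has_vector_derivative \<alpha> * (of_real (b x * deriv v x) - \<mu> * (of_real (b x) * w 3 \<mu> x - Q 3 \<mu> x))
        + \<beta> * (of_real (b x) * w 2 \<mu> x - Q 2 \<mu> x) + \<gamma> * (of_real (b x) * w 1 \<mu> x - Q 1 \<mu> x)) (at x within {0..per})"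
      unfolding Y1_def[abs_def]
      by (intro has_vector_derivative_add has_vector_derivative_diff has_vector_derivative_mult_right dv w_deriv \<mu> x)
    then show ?thesis unfolding Y0_def YQ_def by (simp add: algebra_simps)
  qed
  have dYQ: "(YQ has_vector_derivative \<mu> * Y0 x) (at x within {0..per})" if x: "x \<in> {0..per}" for x
  proof -
    have "(YQ has_vector_derivative - (\<alpha> * \<mu> * (of_real (- (axis (3::3) 1 $ 3) * deriv v x) + \<mu> * w 3 \<mu> x))
        + \<beta> * (of_real (- (axis (2::3) 1 $ 3) * deriv v x) + \<mu> * w 2 \<mu> x)
        + \<gamma> * (of_real (- (axis (1::3) 1 $ 3) * deriv v x) + \<mu> * w 1 \<mu> x)) (at x within {0..per})"
      unfolding YQ_def[abs_def]
      by (intro has_vector_derivative_add has_vector_derivative_minus has_vector_derivative_mult_right w_deriv \<mu> x)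
    then show ?thesis unfolding Y0_def by (simp add: axis_def algebra_simps)
  qed
  have g0: "of_real (force m) \<noteq> (0::complex)" using force_m_pos by simp
  have q0: "q 3 0 = - m" "q 2 0 = 0" "q 1 0 = - 1" "q i per = q i 0" for i
    by (simp_all add: q_def axis_def v_0 v_per_0)
  have YQ_0: "YQ 0 = \<alpha> * \<mu> * of_real m - \<gamma>" unfolding YQ_def w_0 q0 by simp
  have YQ_per: "YQ per - YQ 0 = \<mu> * (- (\<alpha> * \<mu> * Iw 3 \<mu>) + \<beta> * Iw 2 \<mu> + \<gamma> * Iw 1 \<mu>)"
    unfolding YQ_def Q_def q0(4) Iw_def by (simp add: algebra_simps)
  have bcQ: "YQ per = exp \<epsilon> * YQ 0"
  proof -
    have "\<mu> * (- (\<alpha> * \<mu> * Iw 3 \<mu>) + \<beta> * Iw 2 \<mu> + \<gamma> * Iw 1 \<mu>) - (\<epsilon> * R \<epsilon>) * (\<alpha> * \<mu> * of_real m - \<gamma>)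
      = \<epsilon> * ((- (t\<^sup>2 * Iw 3 \<mu>) - R \<epsilon> * t * of_real m) * (\<epsilon> * \<alpha>) + t * Iw 2 \<mu> * \<beta> + (t * Iw 1 \<mu> + R \<epsilon>) * \<gamma>)"
      by (simp add: \<mu>_def algebra_simps power2_eq_square)
    then have "YQ per - YQ 0 = (exp \<epsilon> - 1) * YQ 0"
      unfolding rows(1) R YQ_per[symmetric] YQ_0[symmetric] by simp
    then show ?thesis by (simp add: algebra_simps)
  qed
  have Y1_0: "Y1 0 = \<alpha> * of_real (force m)" unfolding Y1_def w_0 v_0 by simp
  have bc1: "Y1 per = exp \<epsilon> * Y1 0"
  proof -
    have "Y1 per - Y1 0 - (\<epsilon> * R \<epsilon>) * Y1 0
        = (- (t * Dw 3 \<mu>) - R \<epsilon> * of_real (force m)) * (\<epsilon> * \<alpha>) + Dw 2 \<mu> * \<beta> + Dw 1 \<mu> * \<gamma>"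
      unfolding Y1_0 unfolding Y1_def v_per_0 Dw_def by (simp add: \<mu>_def algebra_simps)
    then show ?thesis unfolding rows(3) R by (simp add: algebra_simps)
  qed
  \<comment> \<open>Because \<open>deriv v\<close> solves L y = 0, everything in the derivative of
    \<open>E\<close> cancels except \<mu> v \<open>Y0\<close>. \<open>G\<close> is a primitive of
    this, with v^2 / 2 accounting for the part v v'.\<close>
  define E where "E x = of_real (v x) * YQ x + of_real (deriv v x) * Y1 x - of_real (force (v x)) * Y0 x" for x
  define G where "G x = \<mu> * (\<alpha> * (of_real (v x) * of_real (v x) / 2) - \<alpha> * \<mu> * weighted_integral v (w 3 \<mu>) x
      + \<beta> * weighted_integral v (w 2 \<mu>) x + \<gamma> * weighted_integral v (w 1 \<mu>) x)" for x
  have "((\<lambda>x. E x - G x) has_vector_derivative 0) (at x within {0..per})" if x: "x \<in> {0..per}" for x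
  proof -
    have wi: "(weighted_integral v (w i \<mu>) has_vector_derivative of_real (v x) * w i \<mu> x) (at x within {0..per})" for i
      using weighted_integral_deriv[OF v_cont w_cont[OF \<mu>] x] by (simp add: scaleR_conv_of_real)
    have vv: "((\<lambda>x. complex_of_real (v x) * of_real (v x) / 2) has_vector_derivative of_real (v x) * of_real (deriv v x)) (at x within {0..per})"
      using has_vector_derivative_divide[OF has_vector_derivative_mult[OF dv(1)[of x] dv(1)[of x]], of 2] by simp
    have dE: "(E has_vector_derivative (of_real (v x) * (\<mu> * Y0 x) + of_real (deriv v x) * YQ x)
       + (of_real (deriv v x) * (of_real (b x) * Y0 x - YQ x) + of_real (force (v x)) * Y1 x)
       - (of_real (force (v x)) * Y1 x + of_real (b x * deriv v x) * Y0 x)) (at x within {0..per})"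
      unfolding E_def[abs_def]
      by (intro has_vector_derivative_add has_vector_derivative_diff has_vector_derivative_mult dv dY0 dY1 dYQ x)
    have dG: "(G has_vector_derivative \<mu> * (\<alpha> * (of_real (v x) * of_real (deriv v x)) - \<alpha> * \<mu> * (of_real (v x) * w 3 \<mu> x)
        + \<beta> * (of_real (v x) * w 2 \<mu> x) + \<gamma> * (of_real (v x) * w 1 \<mu> x))) (at x within {0..per})"
      unfolding G_def[abs_def]
      by (intro has_vector_derivative_add has_vector_derivative_diff has_vector_derivative_mult_right wi vv)
    show ?thesis
      using has_vector_derivative_diff[OF dE dG] unfolding Y0_def by (simp add: algebra_simps)
  qed
  then obtain C where "\<And>x. x \<in> {0..per} \<Longrightarrow> E x - G x = C"
    using has_vector_derivative_zero_constant[of "{0..per}" "\<lambda>x. E x - G x"] by auto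
  then have "E per - G per = E 0 - G 0" using per_in by metis
  then have E_per: "E per - E 0 = \<mu> * (- (\<alpha> * \<mu> * Ivw 3 \<mu>) + \<beta> * Ivw 2 \<mu> + \<gamma> * Ivw 1 \<mu>)"
    unfolding G_def Ivw_def v_per_0 v_0 by (simp add: algebra_simps)
  have E_ends: "E 0 = of_real m * YQ 0 - of_real (force m) * Y0 0" "E per = of_real m * YQ per - of_real (force m) * Y0 per"
    unfolding E_def v_per_0 v_0 by simp_all
  have Y0_0: "of_real (force m) * Y0 0 = \<alpha> * \<mu> * of_real (m\<^sup>2 / 2) - \<beta> - \<gamma> * of_real m"
  proof -
    have "force m * y 3 0 = - (m\<^sup>2 / 2)" "force m * y 2 0 = - 1" "force m * y 1 0 = - m"
      using force_m_pos by (simp_all add: y_0 axis_def)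
    then have "of_real (force m) * complex_of_real (y 3 0) = - of_real (m\<^sup>2 / 2)"
      "of_real (force m) * complex_of_real (y 2 0) = - 1" "of_real (force m) * complex_of_real (y 1 0) = - of_real m"
      by (metis of_real_minus of_real_mult of_real_1)+
    moreover have "of_real (force m) * Y0 0 = - (\<alpha> * \<mu> * (of_real (force m) * of_real (y 3 0)))
        + \<beta> * (of_real (force m) * of_real (y 2 0)) + \<gamma> * (of_real (force m) * of_real (y 1 0))"
      unfolding Y0_def w_0(1)[OF \<mu>] v_per_0 by (simp add: algebra_simps)
    ultimately show ?thesis by simp
  qed
  have E_0: "E 0 = \<alpha> * \<mu> * of_real (m\<^sup>2 / 2) + \<beta>"
    unfolding E_ends YQ_0 Y0_0 by (simp add: power2_eq_square algebra_simps)
  have bcE: "E per = exp \<epsilon> * E 0"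
  proof -
    have "\<mu> * (- (\<alpha> * \<mu> * Ivw 3 \<mu>) + \<beta> * Ivw 2 \<mu> + \<gamma> * Ivw 1 \<mu>) - (\<epsilon> * R \<epsilon>) * (\<alpha> * \<mu> * of_real (m\<^sup>2 / 2) + \<beta>)
      = \<epsilon> * ((- (t\<^sup>2 * Ivw 3 \<mu>) - R \<epsilon> * t * of_real (m\<^sup>2 / 2)) * (\<epsilon> * \<alpha>) + (t * Ivw 2 \<mu> - R \<epsilon>) * \<beta> + t * Ivw 1 \<mu> * \<gamma>)"
      by (simp add: \<mu>_def algebra_simps power2_eq_square)
    then have "E per - E 0 = (exp \<epsilon> - 1) * E 0"
      unfolding rows(2) R E_per[symmetric] E_0[symmetric] by simp
    then show ?thesis by (simp add: algebra_simps)
  qed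
  \<comment> \<open>At both ends v = m and v' = 0, so \<open>E\<close> is there a combination of
    \<open>YQ\<close> and \<open>Y0\<close> in which \<open>Y0\<close> has the non-zero coefficient
    \<open>- force m\<close>. The condition on \<open>Y0\<close> thus follows from those on
    \<open>E\<close> and \<open>YQ\<close>.\<close>
  have bc0: "Y0 per = exp \<epsilon> * Y0 0"
  proof -
    have "of_real (force m) * Y0 per = of_real (force m) * (exp \<epsilon> * Y0 0)"
      using bcE bcQ unfolding E_ends by (auto simp: algebra_simps)
    then show ?thesis using g0 by simp
  qed
  \<comment> \<open>If \<open>Y0\<close> vanished on the period, so would \<open>Y1\<close>, and the
    equation would give \<open>YQ 0 = 0\<close>. The values at 0 determine \<alpha>, then \<gamma>,
    then \<beta>, and the kernel vector would be 0.\<close>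
  have "\<exists>x0\<in>{0..per}. Y0 x0 \<noteq> 0"
  proof (rule ccontr)
    assume "\<not> ?thesis"
    then have Y0: "Y0 x = 0" if "x \<in> {0..per}" for x using that by blast
    have unique: "Z' = 0" if "(Z has_vector_derivative Z') (at x within {0..per})" "x \<in> {0..per}"
      "\<And>x. x \<in> {0..per} \<Longrightarrow> Z x = 0" for Z Z' x
    proof (rule vector_derivative_unique_within_closed_interval[of 0 per x Z])
      show "(Z has_vector_derivative 0) (at x within cbox 0 per)"
        using has_vector_derivative_transform[of x "{0..per}" Z "\<lambda>_. 0" 0] that by simp
    qed (use that per_pos in auto)
    have Y1: "Y1 x = 0" if "x \<in> {0..per}" for x using unique[OF dY0[OF that] that Y0] .
    have "YQ 0 = 0" using unique[OF dY1[OF per_in(2)] per_in(2) Y1] Y0[OF per_in(2)] by simp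
    moreover have \<alpha>0: "\<alpha> = 0" using Y1[OF per_in(2)] g0 unfolding Y1_0 by simp
    ultimately have "\<gamma> = 0" unfolding YQ_0 by simp
    then have "\<beta> = 0" using Y0_0 Y0[OF per_in(2)] \<alpha>0 by simp
    then have "x = 0" using \<alpha>0 \<open>\<gamma> = 0\<close> x1 by (simp add: vec_eq_iff forall_3 \<beta>_def \<gamma>_def)
    then show False using x(1) by simp
  qed
  then obtain x0 where x0: "x0 \<in> {0..per}" "Y0 x0 \<noteq> 0" by blast
  have "\<mu> \<in> L2_spectrum (linearization f (p $ 3) v)"
  proof (rule spectrum_of_floquet_solution[where T = per and \<rho> = "exp \<epsilon>" and ?y0.0 = Y0 and ?y1.0 = Y1
        and q = YQ and ?x0.0 = x0])
    show "cmod (exp \<epsilon>) = 1" by (simp add: \<epsilon>_def)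
    show "(Y1 has_vector_derivative of_real (p $ 3 - deriv f (v x)) * Y0 x - YQ x) (at x within {0..per})"
      if "x \<in> {0..per}" for x using dY1[OF that] by (simp only: b_def)
    show "continuous_on UNIV (\<lambda>x. deriv f (v x))"
      by (rule continuous_on_compose2[OF f_C1(2) v_cont]) auto
  qed (fact per_pos v_per dY0 dYQ bc0 bc1 bcQ x0)+
  then show ?thesis by (simp add: \<mu>_def \<epsilon>_def)
qed

section \<open>The zero-frequency limit and Hurwitz's theorem\<close>

lemma R_continuous: "continuous_on UNIV R"
proof -
  have "isCont R \<epsilon>" for \<epsilon>
  proof (cases "\<epsilon> = 0")
    case True
    have "((\<lambda>h. (exp (0 + h) - exp 0) / h) \<longlongrightarrow> exp (0::complex)) (at 0)"
      using DERIV_exp[of "0::complex"] by (simp only: DERIV_def)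
    then have "((\<lambda>h. (exp h - 1) / h) \<longlongrightarrow> (1::complex)) (at 0)" by simp
    then have "(R \<longlongrightarrow> 1) (at 0)"
      by (rule Lim_transform_eventually) (auto simp: R_def eventually_at_filter)
    then show ?thesis using True by (simp add: isCont_def R_def)
  next
    case False
    then have "\<forall>\<^sub>F z in nhds \<epsilon>. z \<noteq> 0" by (rule t1_space_nhds)
    then have "\<forall>\<^sub>F z in nhds \<epsilon>. (exp z - 1) / z = R z"
      by eventually_elim (simp add: R_def)
    then have "isCont (\<lambda>z. (exp z - 1) / z) \<epsilon> \<longleftrightarrow> isCont R \<epsilon>" by (rule isCont_cong)
    moreover have "isCont (\<lambda>z. (exp z - 1) / z) \<epsilon>" using False by (intro continuous_intros) auto
    ultimately show ?thesis by blast
  qed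
  then show ?thesis by (simp add: continuous_at_imp_continuous_on)
qed

text \<open>In the first two rows the terms with m are multiples of the third row and drop out. The
  columns come in the order c, E, a, which accounts for the sign; the rows contribute the factors t,
  t/2 and \<open>force m\<close>, and the column for c another t.\<close>

lemma det_evans_matrix_0:
  assumes "t \<noteq> 0"
  shows "det (evans_matrix 0 t) = - (of_real (force m) * t ^ 3 / 2) * det (whitham_pencil dT dM dP 1 (- 1 / t))"
  using assms
  by (simp add: det_3 evans_matrix_def whitham_pencil_def Iw_0 Ivw_0 Dw_0 R_def field_simps power2_eq_square power3_eq_cube)

text \<open>The value at t = 0 reflects the leading coefficient of the characteristic polynomial; it
  rules out a constant limit.\<close>

lemma det_evans_matrix_0_0: "det (evans_matrix 0 0) = - of_real (force m)"
  by (simp add: det_3 evans_matrix_def Iw_0 Ivw_0 Dw_0 R_def)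

lemma stable_imp_real_roots:
  assumes stable: "spectrally_stable f (p $ 3) v" and \<zeta>: "det (whitham_pencil dT dM dP 1 \<zeta>) = 0"
  shows "\<zeta> \<in> \<real>"
proof (rule ccontr)
  assume nr: "\<zeta> \<notin> \<real>"
  define t0 where "t0 = - 1 / \<zeta>"
  have \<zeta>0: "\<zeta> \<noteq> 0" using nr by auto
  have t0: "t0 \<noteq> 0" "- 1 / t0 = \<zeta>" using \<zeta>0 by (simp_all add: t0_def)
  have Im: "Im t0 \<noteq> 0"
  proof
    assume "Im t0 = 0"
    then have "t0 \<in> \<real>" by (simp add: complex_is_Real_iff)
    then have "- 1 / t0 \<in> \<real>" by (intro Reals_divide) auto
    then show False using nr unfolding t0(2) by simp
  qed
  \<comment> \<open>The sign of \<open>Im t0\<close> selects the half-plane that contains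
    \<open>t0\<close>. On it, the real part of \<open>\<epsilon> n * t\<close> is a non-zero
    multiple of \<open>Im t\<close>, so stability excludes zeros of the approximating
    determinants.\<close>
  define \<sigma> where "\<sigma> = Im t0"
  have \<sigma>_pos: "0 < \<sigma> * Im t0"
    using Im zero_less_power2[of "Im t0"] by (simp add: \<sigma>_def power2_eq_square)
  define r where "r = cmod t0 + 1"
  define S where "S = {t. 0 < \<sigma> * Im t} \<inter> ball 0 r"
  \<comment> \<open>The factor 2 keeps the products \<open>\<epsilon> * t\<close> strictly inside
    the disc on which the Neumann series converge.\<close>
  define \<theta>0 where "\<theta>0 = radius / (2 * r)"
  have r: "0 < r" by (simp add: r_def add_nonneg_pos)
  have \<theta>0: "0 < \<theta>0" using radius(1) r by (simp add: \<theta>0_def)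
  have small: "\<epsilon> * t \<in> ball 0 radius" if "\<epsilon> \<in> cball 0 \<theta>0" "t \<in> cball 0 r" for \<epsilon> t :: complex
  proof -
    have "cmod (\<epsilon> * t) \<le> \<theta>0 * r" unfolding norm_mult using that \<theta>0 by (intro mult_mono) auto
    also have "\<dots> < radius" using radius(1) r by (simp add: \<theta>0_def)
    finally show ?thesis by simp
  qed
  define \<epsilon> where "\<epsilon> n = \<i> * complex_of_real (\<theta>0 / real (Suc n))" for n
  have \<epsilon>_in: "\<epsilon> n \<in> cball 0 \<theta>0" for n
    using \<theta>0 by (simp add: \<epsilon>_def norm_mult norm_divide divide_le_eq del: of_nat_Suc)
  have hol: "(\<lambda>t. det (evans_matrix e t)) holomorphic_on ball 0 r" if e: "e \<in> cball 0 \<theta>0" for e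
  proof -
    have "(\<lambda>t. h (e * t)) holomorphic_on ball 0 r" if "h holomorphic_on ball 0 radius" for h :: "complex \<Rightarrow> complex"
      using holomorphic_on_compose_gen[of "\<lambda>t. e * t" "ball 0 r" h "ball 0 radius"] that small[OF e]
      by (force simp: o_def intro!: holomorphic_intros)
    note this[OF Iw_holomorphic] this[OF Ivw_holomorphic] this[OF Dw_holomorphic]
    then show ?thesis unfolding det_3 evans_matrix_def vector_3 by (intro holomorphic_intros)
  qed
  have cont: "continuous_on (cball 0 \<theta>0 \<times> cball 0 r) (\<lambda>(e, t). det (evans_matrix e t))"
  proof -
    have "continuous_on (cball 0 \<theta>0 \<times> cball 0 r) (\<lambda>z. h (fst z * snd z))" if "h holomorphic_on ball 0 radius" for h :: "complex \<Rightarrow> complex"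
      by (rule continuous_on_compose2[OF holomorphic_on_imp_continuous_on[OF that]])
         (use small in \<open>auto intro!: continuous_intros\<close>)
    note this[OF Iw_holomorphic] this[OF Ivw_holomorphic] this[OF Dw_holomorphic]
      continuous_on_compose2[OF R_continuous continuous_on_fst[OF continuous_on_id]]
    then show ?thesis unfolding det_3 evans_matrix_def vector_3 split_beta by (intro continuous_intros) auto
  qed
  have \<epsilon>_lim: "\<epsilon> \<longlonglongrightarrow> 0"
  proof -
    have "(\<lambda>n. \<i> * complex_of_real (\<theta>0 * inverse (real (Suc n)))) \<longlonglongrightarrow> \<i> * of_real (\<theta>0 * 0)"
      by (intro tendsto_intros LIMSEQ_inverse_real_of_nat)
    then show ?thesis by (simp add: \<epsilon>_def[abs_def] divide_inverse)
  qed
  have S_sub: "S \<subseteq> ball 0 r" "S \<subseteq> cball 0 r" by (auto simp: S_def)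
  have "det (evans_matrix 0 t0) \<noteq> 0"
  proof (rule Hurwitz_no_zeros[where S = S and \<F> = "\<lambda>n t. det (evans_matrix (\<epsilon> n) t)"
        and g = "\<lambda>t. det (evans_matrix 0 t)" and ?z0.0 = t0])
    have "open {t. 0 < \<sigma> * Im t}" by (intro open_Collect_less continuous_intros)
    then show "open S" unfolding S_def by blast
    have "convex {t. 0 < \<sigma> * Im t}"
    proof -
      have "{t. 0 < \<sigma> * Im t} = {t. inner (\<sigma> *\<^sub>R \<i>) t > 0}" by (simp add: inner_complex_def)
      then show ?thesis by (simp only: convex_halfspace_gt)
    qed
    then show "connected S" unfolding S_def by (intro convex_connected convex_Int convex_ball)
    show "(\<lambda>t. det (evans_matrix (\<epsilon> n) t)) holomorphic_on S" for n
      using hol[OF \<epsilon>_in] S_sub(1) holomorphic_on_subset by blast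
    show "(\<lambda>t. det (evans_matrix 0 t)) holomorphic_on S"
      using hol[of 0] \<theta>0 S_sub(1) holomorphic_on_subset by fastforce
    show "uniform_limit K (\<lambda>n t. det (evans_matrix (\<epsilon> n) t)) (\<lambda>t. det (evans_matrix 0 t)) sequentially"
      if K: "K \<subseteq> S" for K
    proof (rule uniform_limitI)
      fix e :: real assume "e > 0"
      \<comment> \<open>Joint continuity on a compact product turns the convergence of
        \<open>\<epsilon> n\<close> into convergence uniform in t.\<close>
      have "uniformly_continuous_on (cball 0 \<theta>0 \<times> cball 0 r) (\<lambda>(e, t). det (evans_matrix e t))"
        by (intro compact_uniformly_continuous cont compact_Times compact_cball)
      then obtain d where d: "d > 0" "\<And>z z'. z \<in> cball 0 \<theta>0 \<times> cball 0 r \<Longrightarrow> z' \<in> cball 0 \<theta>0 \<times> cball 0 r \<Longrightarrow>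
          dist z' z < d \<Longrightarrow> dist ((\<lambda>(e, t). det (evans_matrix e t)) z') ((\<lambda>(e, t). det (evans_matrix e t)) z) < e"
        using \<open>e > 0\<close> unfolding uniformly_continuous_on_def by metis
      have "\<forall>\<^sub>F n in sequentially. dist (\<epsilon> n) 0 < d" using \<epsilon>_lim d(1) by (rule tendstoD)
      then show "\<forall>\<^sub>F n in sequentially. \<forall>t\<in>K. dist (det (evans_matrix (\<epsilon> n) t)) (det (evans_matrix 0 t)) < e"
      proof (rule eventually_mono, intro ballI)
        fix n t assume n: "dist (\<epsilon> n) 0 < d" and t: "t \<in> K"
        then have "t \<in> cball 0 r" using K S_sub by blast
        then show "dist (det (evans_matrix (\<epsilon> n) t)) (det (evans_matrix 0 t)) < e"
          using d(2)[of "(0, t)" "(\<epsilon> n, t)"] \<epsilon>_in[of n] n \<theta>0 by (auto simp: dist_Pair_Pair)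
      qed
    qed
    show "t0 \<in> S" using \<sigma>_pos by (simp add: S_def r_def)
    show "det (evans_matrix (\<epsilon> n) t) \<noteq> 0" if t: "t \<in> S" for n t
    proof
      assume "det (evans_matrix (\<epsilon> n) t) = 0"
      moreover have "\<theta>0 / real (Suc n) \<noteq> 0" using \<theta>0 by simp
      moreover have "\<epsilon> n * t \<in> ball 0 radius" using small[OF \<epsilon>_in] t S_sub by blast
      ultimately have "\<epsilon> n * t \<in> L2_spectrum (linearization f (p $ 3) v)"
        unfolding \<epsilon>_def by (intro evans_zero_in_spectrum)
      then have "Re (\<epsilon> n * t) = 0" using stable unfolding spectrally_stable_def by blast
      moreover have "Re (\<epsilon> n * t) = - (\<theta>0 / real (Suc n)) * Im t" by (simp add: \<epsilon>_def)
      ultimately have "Im t = 0" using \<theta>0 by simp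
      then show False using t by (simp add: S_def)
    qed
    show "\<not> (\<lambda>t. det (evans_matrix 0 t)) constant_on S"
    proof
      assume "(\<lambda>t. det (evans_matrix 0 t)) constant_on S"
      \<comment> \<open>A constant limit would equal its value at \<open>t0\<close>, which is 0. The
        points t0 / (n + 1) stay in \<open>S\<close> and tend to the boundary point 0, where the
        determinant is not 0.\<close>
      then have zero: "det (evans_matrix 0 t) = 0" if "t \<in> S" for t
        using \<open>t0 \<in> S\<close> that det_evans_matrix_0[OF t0(1)] \<zeta> t0(2) unfolding constant_on_def by force
      have c: "isCont (\<lambda>t. det (evans_matrix 0 t)) 0"
        using hol[of 0] \<theta>0 r holomorphic_on_imp_continuous_on
        by (metis (no_types, lifting) centre_in_ball centre_in_cball continuous_on_interior interior_ball less_imp_le)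
      have "(\<lambda>n. of_real (inverse (real (Suc n))) * t0) \<longlonglongrightarrow> of_real 0 * t0"
        by (intro tendsto_mult_right tendsto_of_real LIMSEQ_inverse_real_of_nat)
      then have lim: "(\<lambda>n. of_real (inverse (real (Suc n))) * t0) \<longlonglongrightarrow> 0"
        by (simp only: of_real_0 mult_zero_left)
      have "(\<lambda>n. det (evans_matrix 0 (of_real (inverse (real (Suc n))) * t0))) \<longlonglongrightarrow> det (evans_matrix 0 0)"
        by (rule isCont_tendsto_compose[OF c lim])
      moreover have "of_real (inverse (real (Suc n))) * t0 \<in> S" for n
      proof -
        have "inverse (real (Suc n)) * cmod t0 \<le> 1 * cmod t0"
          by (intro mult_right_mono) (auto simp: inverse_le_1_iff)
        moreover have "0 < inverse (real (Suc n)) * (\<sigma> * Im t0)" by (rule mult_pos_pos[OF _ \<sigma>_pos]) simp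
        ultimately show ?thesis
          by (simp add: S_def r_def norm_mult norm_inverse mult_ac del: of_nat_Suc of_real_inverse)
      qed
      ultimately have "(\<lambda>n::nat. 0) \<longlonglongrightarrow> det (evans_matrix 0 0)" by (simp only: zero)
      then have "det (evans_matrix 0 0) = 0" by (simp add: LIMSEQ_const_iff)
      then show False using det_evans_matrix_0_0 force_m_pos by simp
    qed
  qed
  then show False using det_evans_matrix_0[OF t0(1)] \<zeta> t0(2) by simp
qed

end

section \<open>From the family of waves to the theorem\<close>

lemma has_derivative_imp_difference_quotient:
  fixes g :: "real^3 \<Rightarrow> real"
  assumes g: "(g has_derivative (\<lambda>h. d \<bullet> h)) (at p)" and e: "e \<longlonglongrightarrow> 0" "\<And>n. e n \<noteq> 0"
  shows "(\<lambda>n. (g (p + e n *\<^sub>R \<delta>) - g p) / e n) \<longlonglongrightarrow> d \<bullet> \<delta>"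
proof -
  have "((\<lambda>t. p + t *\<^sub>R \<delta>) has_derivative (\<lambda>t. t *\<^sub>R \<delta>)) (at 0)"
    by (auto intro!: derivative_eq_intros)
  then have "((\<lambda>t. g (p + t *\<^sub>R \<delta>)) has_derivative (\<lambda>t. d \<bullet> (t *\<^sub>R \<delta>))) (at 0)"
    by (rule has_derivative_compose) (use g in simp)
  then have "((\<lambda>t. g (p + t *\<^sub>R \<delta>)) has_real_derivative d \<bullet> \<delta>) (at 0)"
    unfolding has_field_derivative_def by (rule has_derivative_eq_rhs) (simp add: fun_eq_iff)
  then have "(\<lambda>n. (g (p + e n *\<^sub>R \<delta>) - g (p + 0 *\<^sub>R \<delta>)) / e n) \<longlonglongrightarrow> (d \<bullet> \<delta>) * 1"
    by (rule difference_quotient_moving) (use e in simp_all)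
  then show ?thesis by simp
qed

text \<open>Openness of \<open>U\<close> and continuity of the turning points provide a radius d on
  which the margins hold; for a unit vector \<delta> the distance from \<open>p0\<close> is just
  \<open>e n\<close>. The additional length 1 beyond the period leaves room for the moving
  endpoint.\<close>

lemma (in wave_branch) directional_sequence:
  assumes "norm \<delta> = 1"
  obtains e where "wave_direction f F U um up u p0 \<delta> e (base.per + 1)"
proof -
  have "\<forall>\<^sub>F p in at p0. p \<in> U"
    using openU p0 by (rule eventually_at_in_open')
  moreover have "\<forall>\<^sub>F p in at p0. um p0 - 1 < um p" "\<forall>\<^sub>F p in at p0. up p < up p0 + 1"
    using um_cont up_cont by (auto intro!: order_tendstoD simp: isCont_def)
  ultimately have "\<forall>\<^sub>F p in at p0. p \<in> U \<and> um p0 - 1 < um p \<and> up p < up p0 + 1"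
    by eventually_elim simp
  then obtain d where d: "d > 0"
    "\<And>p. p \<noteq> p0 \<Longrightarrow> dist p p0 < d \<Longrightarrow> p \<in> U \<and> um p0 - 1 < um p \<and> up p < up p0 + 1"
    unfolding eventually_at by auto
  define e where "e n = d / 2 * inverse (real (Suc n))" for n
  have e: "0 < e n" "e n < d" for n
  proof -
    show "0 < e n" using d(1) by (simp add: e_def)
    have "e n \<le> d / 2 * 1" unfolding e_def using d(1) by (intro mult_left_mono) (auto simp: inverse_le_1_iff)
    then show "e n < d" using d(1) by simp
  qed
  have "p0 + e n *\<^sub>R \<delta> \<noteq> p0" "dist (p0 + e n *\<^sub>R \<delta>) p0 < d" for n
    using e[of n] assms by (auto simp: dist_norm)
  note near = d(2)[OF this]
  have "wave_direction f F U um up u p0 \<delta> e (base.per + 1)"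
  proof
    show "e \<longlonglongrightarrow> 0"
      using tendsto_mult_left[OF LIMSEQ_inverse_real_of_nat, of "d / 2"] by (simp add: e_def[abs_def])
    show "e n \<noteq> 0" "p0 + e n *\<^sub>R \<delta> \<in> U" "um p0 - 1 \<le> um (p0 + e n *\<^sub>R \<delta>)" "up (p0 + e n *\<^sub>R \<delta>) \<le> up p0 + 1" for n
      using e[of n] near[of n] by auto
    show "0 < base.per + 1" using base.per_pos by simp
  qed
  then show ?thesis by (rule that)
qed

lemma (in wave_branch) parameter_derivative:
  fixes dT dM dP :: "real^3"
  assumes T: "(period F um up has_derivative (\<lambda>h. dT \<bullet> h)) (at p0)"
    and M: "(mass (period F um up) u has_derivative (\<lambda>h. dM \<bullet> h)) (at p0)"
    and P: "(momentum (period F um up) u has_derivative (\<lambda>h. dP \<bullet> h)) (at p0)"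
    and \<delta>: "norm \<delta> = 1"
  obtains y y' where
    "\<And>x. x \<in> {0..base.per} \<Longrightarrow> (y has_real_derivative y' x) (at x within {0..base.per})"
    "\<And>x. x \<in> {0..base.per} \<Longrightarrow> (y' has_real_derivative
      \<delta> $ 1 + \<delta> $ 3 * u p0 x + (p0 $ 3 - deriv f (u p0 x)) * y x) (at x within {0..base.per})"
    "y 0 = - (\<delta> $ 2 + \<delta> $ 1 * um p0 + \<delta> $ 3 * (um p0)\<^sup>2 / 2) / base.force (um p0)" "y' 0 = 0"
    "y' base.per = - base.force (um p0) * (dT \<bullet> \<delta>)"
    "integral {0..base.per} y = dM \<bullet> \<delta> - um p0 * (dT \<bullet> \<delta>)"
    "integral {0..base.per} (\<lambda>x. u p0 x * y x) = (dP \<bullet> \<delta> - (um p0)\<^sup>2 * (dT \<bullet> \<delta>)) / 2"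
proof -
  obtain e where "wave_direction f F U um up u p0 \<delta> e (base.per + 1)"
    using directional_sequence[OF \<delta>] by blast
  then interpret D: wave_direction f F U um up u p0 \<delta> e "base.per + 1" .
  note dq = has_derivative_imp_difference_quotient[OF _ D.e_lim D.e_nz, where p = p0 and \<delta> = \<delta>, folded D.p_def]
  have sub: "{0..base.per} \<subseteq> {0..base.per + 1}" by auto
  have per: "base.per < base.per + 1" by simp
  show ?thesis
  proof (rule that[of D.y D.y'])
    show "(D.y has_real_derivative D.y' x) (at x within {0..base.per})"
      "(D.y' has_real_derivative \<delta> $ 1 + \<delta> $ 3 * u p0 x + (p0 $ 3 - deriv f (u p0 x)) * D.y x) (at x within {0..base.per})"
      if "x \<in> {0..base.per}" for x
      using that sub has_field_derivative_subset[OF D.y_deriv _] has_field_derivative_subset[OF D.y'_deriv _] by blast+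
    show "D.y 0 = - (\<delta> $ 2 + \<delta> $ 1 * um p0 + \<delta> $ 3 * (um p0)\<^sup>2 / 2) / base.force (um p0)" "D.y' 0 = 0"
      by (rule D.y_0 D.y'_0)+
    show "D.y' base.per = - base.force (um p0) * (dT \<bullet> \<delta>)"
      by (rule D.y'_per[OF per dq[OF T]])
    show "integral {0..base.per} D.y = dM \<bullet> \<delta> - um p0 * (dT \<bullet> \<delta>)"
      by (rule D.integral_y[OF per dq[OF T] dq[OF M]])
    show "integral {0..base.per} (\<lambda>x. u p0 x * D.y x) = (dP \<bullet> \<delta> - (um p0)\<^sup>2 * (dT \<bullet> \<delta>)) / 2"
      by (rule D.integral_u_y[OF per dq[OF T] dq[OF P]])
  qed
qed

lemma C1_on_vector_3_gradients:
  fixes g1 g2 g3 :: "real^3 \<Rightarrow> real"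
  assumes "C1_on U (\<lambda>p. vector [g1 p, g2 p, g3 p])" "open U" "p \<in> U"
  obtains d1 d2 d3 where "(g1 has_derivative (\<lambda>h. d1 \<bullet> h)) (at p)" "(g2 has_derivative (\<lambda>h. d2 \<bullet> h)) (at p)"
    "(g3 has_derivative (\<lambda>h. d3 \<bullet> h)) (at p)"
proof -
  let ?G = "\<lambda>p. vector [g1 p, g2 p, g3 p] :: real^3"
  have "?G differentiable (at p)"
    using assms unfolding C1_on_def by (simp add: differentiable_on_eq_differentiable_at)
  then obtain J where J: "(?G has_derivative (\<lambda>h. J *v h)) (at p)"
    using jacobian_works by blast
  have "((\<lambda>p. ?G p $ i) has_derivative (\<lambda>h. J $ i \<bullet> h)) (at p)" for i
    using bounded_linear.has_derivative[OF bounded_linear_vec_nth J, of i]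
    by (simp add: matrix_vector_mult_def inner_vec_def)
  from this[of 1] this[of 2] this[of 3] show ?thesis by (intro that) simp_all
qed

theorem corollary1:
  fixes f F :: "real \<Rightarrow> real"
    and U :: "(real^3) set"
    and um up :: "real^3 \<Rightarrow> real"
    and u :: "real^3 \<Rightarrow> real \<Rightarrow> real"
    and T M P :: "real^3 \<Rightarrow> real"
    and a0 E0 c0 :: real
    and p0 q0 :: "real^3"
  assumes f_smooth: "C_k_real 2 f"
    and F_deriv: "\<And>v. (F has_real_derivative f v) (at v)"
    and F_zero: "F 0 = 0"
    and family: "wave_family f F U um up u"
    and T_def: "T = period F um up"
    and M_def: "M = mass T u"
    and P_def: "P = momentum T u"
    and TMP_C1: "C1_on U (\<lambda>p. vector [T p, M p, P p])"
    and p0_def: "p0 = vector [a0, E0, c0]"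
    and q0_def: "q0 = vector [a0, E0, 0]"
    and p0_in: "p0 \<in> U"
    and jacobian_nonzero: "det (jacobian (\<lambda>p. vector [T p, M p, P p] :: real^3) (at p0)) \<noteq> 0"
    and nonsingular:
      "nonsingular_mod_translation (waves_mod_translation U u) (wave_class U u c0) q0"
  shows
    "(spectrally_stable f c0 (u p0) \<longrightarrow>
        (\<forall>z. complex_eigenvalue (whitham_matrix c0 T M P q0) z \<longrightarrow> z \<in> \<real>)) \<and>
     ((\<forall>z. complex_eigenvalue (whitham_matrix c0 T M P q0) z \<longrightarrow> z \<in> \<real>) \<longleftrightarrow>
        whitham_hyperbolic c0 T M P q0)"
proof -
  have "(f has_real_derivative deriv f x) (at x)" "continuous_on UNIV (deriv f)" for x
  proof -
    have d: "(deriv ^^ j) f differentiable_on UNIV" if "j < 2" for j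
      using f_smooth that unfolding C_k_real_def by blast
    show "(f has_real_derivative deriv f x) (at x)"
      using d[of 0] by (simp add: differentiable_on_def DERIV_deriv_iff_real_differentiable)
    show "continuous_on UNIV (deriv f)"
      using differentiable_imp_continuous_on[OF d[of 1]] by simp
  qed
  then interpret wave_branch f F U um up u p0
    using F_deriv family p0_in by unfold_locales
  obtain dT dM dP where d: "(T has_derivative (\<lambda>h. dT \<bullet> h)) (at p0)"
    "(M has_derivative (\<lambda>h. dM \<bullet> h)) (at p0)" "(P has_derivative (\<lambda>h. dP \<bullet> h)) (at p0)"
    using C1_on_vector_3_gradients[OF TMP_C1 openU p0_in] by blast
  have "T p0 = base.per" by (simp add: T_def period_eq_per)
  then interpret W: whitham_point T M P p0 q0 dT dM dP a0 E0 c0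
    using p0_def q0_def d base.per_pos by unfold_locales auto
  \<comment> \<open>Bundling all properties into one predicate lets a single choice provide
    \<open>y\<close> and \<open>y'\<close> as functions of the index.\<close>
  define deriv_i where "deriv_i i y y' \<longleftrightarrow> (\<forall>x\<in>{0..base.per}. (y has_real_derivative y' x) (at x within {0..base.per})) \<and>
      (\<forall>x\<in>{0..base.per}. (y' has_real_derivative
        axis i 1 $ 1 + axis i 1 $ 3 * u p0 x + (p0 $ 3 - deriv f (u p0 x)) * y x) (at x within {0..base.per})) \<and>
      y 0 = - (axis i 1 $ 2 + axis i 1 $ 1 * um p0 + axis i 1 $ 3 * (um p0)\<^sup>2 / 2) / base.force (um p0) \<and> y' 0 = 0 \<and>
      y' base.per = - base.force (um p0) * dT $ i \<and>
      integral {0..base.per} y = dM $ i - um p0 * dT $ i \<and>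
      integral {0..base.per} (\<lambda>x. u p0 x * y x) = (dP $ i - (um p0)\<^sup>2 * dT $ i) / 2" for i :: 3 and y y'
  have "\<exists>y y'. deriv_i i y y'" for i
  proof -
    have "norm (axis i 1 :: real^3) = 1" by simp
    note derivative = parameter_derivative[OF d[unfolded M_def P_def T_def] this]
    have ax: "d \<bullet> axis i 1 = d $ i" for d :: "real^3" by (simp add: inner_axis)
    show ?thesis
    proof (rule derivative)
      fix y y' :: "real \<Rightarrow> real"
      assume *: "\<And>x. x \<in> {0..base.per} \<Longrightarrow> (y has_real_derivative y' x) (at x within {0..base.per})"
      "\<And>x. x \<in> {0..base.per} \<Longrightarrow> (y' has_real_derivative
        axis i 1 $ 1 + axis i 1 $ 3 * u p0 x + (p0 $ 3 - deriv f (u p0 x)) * y x) (at x within {0..base.per})"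
      "y 0 = - (axis i 1 $ 2 + axis i 1 $ 1 * um p0 + axis i 1 $ 3 * (um p0)\<^sup>2 / 2) / base.force (um p0)" "y' 0 = 0"
      "y' base.per = - base.force (um p0) * (dT \<bullet> axis i 1)"
      "integral {0..base.per} y = dM \<bullet> axis i 1 - um p0 * (dT \<bullet> axis i 1)"
      "integral {0..base.per} (\<lambda>x. u p0 x * y x) = (dP \<bullet> axis i 1 - (um p0)\<^sup>2 * (dT \<bullet> axis i 1)) / 2"
      have "deriv_i i y y'"
        unfolding deriv_i_def using *(1-4) *(5-7)[unfolded ax] by (intro conjI ballI)
      then show ?thesis by blast
    qed
  qed
  then obtain y y' where "\<And>i. deriv_i i (y i) (y' i)" by metis
  note deriv = this[unfolded deriv_i_def]
  interpret E: evans f F p0 "um p0" "up p0" "u p0" y y' dT dM dP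
    by unfold_locales (use deriv in blast)+
  have "p0 $ 3 = c0" by (simp add: p0_def)
  have "z \<in> \<real>" if "spectrally_stable f c0 (u p0)" "complex_eigenvalue (whitham_matrix c0 T M P q0) z" for z
  proof -
    have "z * of_real (T p0) \<in> \<real>"
      using E.stable_imp_real_roots that \<open>p0 $ 3 = c0\<close> W.eigenvalue_iff by simp
    then have "z * of_real (T p0) / of_real (T p0) \<in> \<real>" by (intro Reals_divide) auto
    then show ?thesis using W.T_pos by simp
  qed
  then show ?thesis using W.hyperbolic_iff by blast
qed

end
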